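(* Let $q\ge1$, $\vec{\psi}\in\mathcal{C}^{+1}(\Omega)^q$ and $\beta\ge0$. The $\sigma$-invariant probability measures which maximize the quadratic pressure are exactly the dynamical Gibbs measures $\mu_{\beta t\cdot\vec{\psi}}$, where $t$ ranges over the points of $\mathbb{R}^q$ at which $\varphi_\beta$ attains its maximum. That is, $\{\mu\in M_\sigma(\Omega):\ \widehat{\mathcal{H}}(\mu)+\frac{\beta}{2}\|\int\vec{\psi}\,d\mu\|^2=\mathcal{P}_2(\beta)\}=\{\mu_{\beta t\cdot\vec{\psi}}:\ t\in\mathbb{R}^q,\ \varphi_\beta(t)=\max_{\mathbb{R}^q}\varphi_\beta\}$.
   Context: Setting: $(E,d)$ is a compact metric space and $\rho$ is a Borel probability measure on $E$ with full support such that, for every sufficiently small $\varepsilon>0$, the map $x\mapsto\rho(B(x,\varepsilon))$ is continuous on $E$. $A:E\times E\to[0,1]$ satisfies: (i) $A$ is continuous with values in $\{0,1\}$; (ii) $A$ is Lipschitz continuous with respect to the second variable with Lipschitz constant $\mathrm{Lip}(A)$; (iii) there is $N\ge1$ such that for all $n\ge N$ and all $a,b\in E$ there exist $z_1,\dots,z_{n-1}\in E$ with $A(a,z_1)A(z_1,z_2)\cdots A(z_{n-1},b)=1$. Put $\Omega=\{x=x_0x_1x_2\ldots\in E^{\mathbb{N}}: A(x_i,x_{i+1})>0\ \forall i\in\mathbb{N}\}$, with metric $d_\Omega(x,y)=\sum_{n\ge0}d(x_n,y_n)/2^{n+1}$ and shift $\sigma(x_0x_1x_2\ldots)=x_1x_2\ldots$.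 $\mathcal{C}^0(\Omega)$ is the space of real continuous functions on $\Omega$ with the sup norm; $\mathcal{C}^{+1}(\Omega)$ is the space of real Lipschitz functions on $\Omega$. $M_\sigma(\Omega)$ is the set of $\sigma$-invariant Borel probability measures on $\Omega$. For $\phi\in\mathcal{C}^{+1}(\Omega)$ the transfer operator is $\mathcal{L}_\phi(f)(\omega)=\int_E e^{\phi(t\omega)}A(t,\omega_0)f(t\omega)\,d\rho(t)$, where $t\omega=t\omega_0\omega_1\ldots$ and the integrand is $0$ when $A(t,\omega_0)=0$; $r_\phi$ is its spectral radius on $\mathcal{C}^0(\Omega)$. The conformal measure $\nu_\phi$ is the unique probability measure on $\Omega$ with $\mathcal{L}_\phi^*\nu_\phi=r_\phi\nu_\phi$; $G_\phi$ is the positive function in $\mathcal{C}^{+1}(\Omega)$ with $\mathcal{L}_\phi G_\phi=r_\phi G_\phi$ and $\int G_\phi\,d\nu_\phi=1$; the dynamical Gibbs measure of $\phi$ is $\mu_\phi=G_\phi\nu_\phi$. For $t\in\mathbb{R}^q$ and $\vec{\psi}=(\psi_1,\dots,\psi_q)$, $t\cdot\vec{\psi}=\sum_i t_i\psi_i$; $\|\cdot\|$ is the Euclidean norm. $\mathcal{H}(z,\vec{\psi})=\inf_{t\in\mathbb{R}^q}\{\log r_{t\cdot\vec{\psi}}-t\cdot z\}$. The entropy of $\mu\in M_\sigma(\Omega)$ is $\widehat{\mathcal{H}}(\mu)=\inf_{\vec{\chi}\in\mathcal{C}^{+1}(\Omega)^q}\mathcal{H}(\int\vec{\chi}\,d\mu,\vec{\chi})$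 (equivalently $\inf_{\phi\in\mathcal{C}^{+1}(\Omega)}(\log r_\phi-\int\phi\,d\mu)$). The quadratic pressure is $\mathcal{P}_2(\beta)=\sup_{\mu\in M_\sigma(\Omega)}\{\widehat{\mathcal{H}}(\mu)+\frac{\beta}{2}\|\int\vec{\psi}\,d\mu\|^2\}$, and $\varphi_\beta(t)=-\frac{\beta}{2}\|t\|^2+\log r_{\beta t\cdot\vec{\psi}}$. *)

theory Defs
  imports "HOL-Probability.Probability"
begin

section \<open>The sequence space\<close>

text \<open>
  A function on \<open>\<Omega>\<close> is represented by a function on the whole type \<^typ>\<open>nat \<Rightarrow> 'e\<close> whose values
  outside \<open>\<Omega>\<close> are irrelevant. Where a function on \<open>\<Omega>\<close> has to be a single object (the elements of
  \<open>C0\<close>, the eigenfunction \<open>G\<close>), the representative in \<^const>\<open>extensional\<close> is taken.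
\<close>

definition Omega :: "('e \<Rightarrow> 'e \<Rightarrow> real) \<Rightarrow> (nat \<Rightarrow> 'e) set" where
  "Omega A = {x. \<forall>i. A (x i) (x (Suc i)) > 0}"

definition d_Omega :: "(nat \<Rightarrow> 'e::metric_space) \<Rightarrow> (nat \<Rightarrow> 'e) \<Rightarrow> real" where
  "d_Omega x y = (\<Sum>n. dist (x n) (y n) / 2 ^ (n + 1))"

definition shift :: "(nat \<Rightarrow> 'e) \<Rightarrow> (nat \<Rightarrow> 'e)" where
  "shift x = (\<lambda>n. x (Suc n))"

text \<open>
  Continuity and Borel sets on \<open>\<Omega>\<close> refer below to the library's product topology on
  \<^typ>\<open>nat \<Rightarrow> 'e\<close>. For a compact space this is the topology of \<^const>\<open>d_Omega\<close>.
\<close>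

lemma open_iff_d_Omega:
  fixes U :: "(nat \<Rightarrow> 'e::metric_space) set"
  assumes "compact (UNIV :: 'e set)"
  shows "open U \<longleftrightarrow> (\<forall>x\<in>U. \<exists>e>0. \<forall>y. d_Omega x y < e \<longrightarrow> y \<in> U)"
proof -
  obtain K where K: "\<And>a b :: 'e. dist a b \<le> K"
    using compact_imp_bounded[OF assms] unfolding bounded_two_points by auto
  have half: "(\<lambda>n. K / 2 ^ (n + 1)) sums K"
    using sums_mult[OF power_half_series, of K] by (simp add: power_divide)
  have bound: "norm (dist (x n) (y n) / 2 ^ (n + 1)) \<le> K / 2 ^ (n + 1)" for x y :: "nat \<Rightarrow> 'e" and n
    using K[of "x n" "y n"] by (simp add: divide_right_mono)
  have summ: "summable (\<lambda>n. dist (x n) (y n) / 2 ^ (n + 1))" for x y :: "nat \<Rightarrow> 'e"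
    by (rule summable_comparison_test'[OF sums_summable[OF half], of 0]) (use bound in blast)
  have term_le: "dist (x n) (y n) / 2 ^ (n + 1) \<le> d_Omega x y" for x y :: "nat \<Rightarrow> 'e" and n
    using sum_le_suminf[OF summ, of "{n}" x y] by (simp add: d_Omega_def)
  have cont: "continuous_on UNIV (\<lambda>y. d_Omega x y)" for x :: "nat \<Rightarrow> 'e"
  proof -
    have "uniform_limit UNIV (\<lambda>m y. \<Sum>n<m. dist (x n) (y n) / 2 ^ (n + 1)) (\<lambda>y. d_Omega x y) sequentially"
      unfolding d_Omega_def
      by (rule Weierstrass_m_test[OF bound sums_summable[OF half]])
    then show ?thesis
    proof (rule uniform_limit_theorem[rotated])
      show "\<forall>\<^sub>F m in sequentially. continuous_on UNIV (\<lambda>y. \<Sum>n<m. dist (x n) (y n) / 2 ^ (n + 1))"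
        by (intro always_eventually allI continuous_intros continuous_on_product_coordinates) auto
    qed simp
  qed
  show ?thesis
  proof (intro iffI ballI)
    fix x assume U: "open U" "x \<in> U"
    then have "openin (product_topology (\<lambda>i. euclidean) UNIV) U"
      unfolding open_fun_def by simp
    from product_topology_open_contains_basis[OF this U(2)]
    obtain X where X: "x \<in> (\<Pi>\<^sub>E i\<in>UNIV. X i)" "\<And>i. open (X i)" "finite {i. X i \<noteq> UNIV}"
      "(\<Pi>\<^sub>E i\<in>UNIV. X i) \<subseteq> U"
      by auto
    have "\<exists>r>0. ball (x i) r \<subseteq> X i" for i
      using X(1,2) by (meson PiE_mem UNIV_I open_contains_ball)
    then obtain r where r: "\<And>i. r i > 0" "\<And>i. ball (x i) (r i) \<subseteq> X i" by metis
    define e where "e = Min (insert 1 ((\<lambda>i. r i / 2 ^ (i + 1)) ` {i. X i \<noteq> UNIV}))"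
    have "e > 0" unfolding e_def using X(3) r(1) by (subst Min_gr_iff) auto
    moreover have "y \<in> U" if "d_Omega x y < e" for y
    proof -
      have "y i \<in> X i" for i
      proof (cases "X i = UNIV")
        case False
        then have "e \<le> r i / 2 ^ (i + 1)" unfolding e_def using X(3) by (intro Min_le) auto
        with term_le[of x i y] that have "dist (x i) (y i) / 2 ^ (i + 1) < r i / 2 ^ (i + 1)" by linarith
        then have "dist (x i) (y i) < r i" by (simp add: divide_less_cancel)
        then show ?thesis using r(2)[of i] by auto
      qed simp
      then show ?thesis using X(4) by auto
    qed
    ultimately show "\<exists>e>0. \<forall>y. d_Omega x y < e \<longrightarrow> y \<in> U" by blast
  next
    assume U: "\<forall>x\<in>U. \<exists>e>0. \<forall>y. d_Omega x y < e \<longrightarrow> y \<in> U"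
    show "open U"
    proof (subst open_subopen, intro ballI)
      fix x assume "x \<in> U"
      then obtain e where e: "e > 0" "\<And>y. d_Omega x y < e \<Longrightarrow> y \<in> U" using U by blast
      have "open {y. d_Omega x y < e}" by (rule open_Collect_less[OF cont]) simp
      moreover have "d_Omega x x = 0" by (simp add: d_Omega_def)
      ultimately show "\<exists>T. open T \<and> x \<in> T \<and> T \<subseteq> U"
        using e by (intro exI[of _ "{y. d_Omega x y < e}"]) auto
    qed
  qed
qed

definition C0 :: "('e::metric_space \<Rightarrow> 'e \<Rightarrow> real) \<Rightarrow> ((nat \<Rightarrow> 'e) \<Rightarrow> 'b::real_normed_vector) set" where
  "C0 A = {f \<in> extensional (Omega A). continuous_on (Omega A) f}"

definition sup_norm :: "('e \<Rightarrow> 'e \<Rightarrow> real) \<Rightarrow> ((nat \<Rightarrow> 'e) \<Rightarrow> 'b::real_normed_vector) \<Rightarrow> real" where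
  "sup_norm A f = (SUP \<omega>\<in>Omega A. norm (f \<omega>))"

definition Lip_Omega :: "('e::metric_space \<Rightarrow> 'e \<Rightarrow> real) \<Rightarrow> ((nat \<Rightarrow> 'e) \<Rightarrow> real) set" where
  "Lip_Omega A = {f. \<exists>C. \<forall>x\<in>Omega A. \<forall>y\<in>Omega A. \<bar>f x - f y\<bar> \<le> C * d_Omega x y}"

definition Lip_Omega_vec :: "('e::metric_space \<Rightarrow> 'e \<Rightarrow> real) \<Rightarrow> ((nat \<Rightarrow> 'e) \<Rightarrow> real ^ 'q) set" where
  "Lip_Omega_vec A = {\<psi>. \<forall>i. (\<lambda>\<omega>. \<psi> \<omega> $ i) \<in> Lip_Omega A}"

definition prob_Omega :: "('e::metric_space \<Rightarrow> 'e \<Rightarrow> real) \<Rightarrow> (nat \<Rightarrow> 'e) measure set" where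
  "prob_Omega A = {\<mu>. prob_space \<mu> \<and> sets \<mu> = sets (restrict_space borel (Omega A))}"

definition M_sigma :: "('e::metric_space \<Rightarrow> 'e \<Rightarrow> real) \<Rightarrow> (nat \<Rightarrow> 'e) measure set" where
  "M_sigma A = {\<mu> \<in> prob_Omega A. distr \<mu> \<mu> shift = \<mu>}"


section \<open>Transfer operator and Gibbs measures\<close>

text \<open>
  The codomain \<open>'b\<close> is \<^typ>\<open>real\<close> or \<^typ>\<open>complex\<close>; at \<^typ>\<open>complex\<close> this is the complexification
  of the real operator. \<^term>\<open>case_nat t \<omega>\<close> is the sequence \<open>t\<omega>\<close>; it may leave \<open>\<Omega>\<close>, but then
  \<open>A t (\<omega> 0) = 0\<close> and the integrand vanishes.
\<close>

definition transfer ::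
  "'e::metric_space measure \<Rightarrow> ('e \<Rightarrow> 'e \<Rightarrow> real) \<Rightarrow> ((nat \<Rightarrow> 'e) \<Rightarrow> real) \<Rightarrow>
   ((nat \<Rightarrow> 'e) \<Rightarrow> 'b::{banach, second_countable_topology}) \<Rightarrow> (nat \<Rightarrow> 'e) \<Rightarrow> 'b" where
  "transfer \<rho> A \<phi> f \<omega> =
     (LINT t|\<rho>. (exp (\<phi> (case_nat t \<omega>)) * A t (\<omega> 0)) *\<^sub>R f (case_nat t \<omega>))"

text \<open>
  As usual for an operator on a real Banach space, the spectrum is that of the complexification:
  \<open>z\<close> belongs to it unless \<open>z - L\<close> is a bijection of the complex space \<open>C0\<close> with bounded inverse.
\<close>

definition resolvent_op ::
  "'e::metric_space measure \<Rightarrow> ('e \<Rightarrow> 'e \<Rightarrow> real) \<Rightarrow> ((nat \<Rightarrow> 'e) \<Rightarrow> real) \<Rightarrow> complex \<Rightarrow>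
   ((nat \<Rightarrow> 'e) \<Rightarrow> complex) \<Rightarrow> (nat \<Rightarrow> 'e) \<Rightarrow> complex" where
  "resolvent_op \<rho> A \<phi> z f = (\<lambda>\<omega>\<in>Omega A. z * f \<omega> - transfer \<rho> A \<phi> f \<omega>)"

definition transfer_spectrum ::
  "'e::metric_space measure \<Rightarrow> ('e \<Rightarrow> 'e \<Rightarrow> real) \<Rightarrow> ((nat \<Rightarrow> 'e) \<Rightarrow> real) \<Rightarrow> complex set" where
  "transfer_spectrum \<rho> A \<phi> =
     {z. \<not> (bij_betw (resolvent_op \<rho> A \<phi> z) (C0 A) (C0 A) \<and>
            (\<exists>C. \<forall>f\<in>C0 A. sup_norm A f \<le> C * sup_norm A (resolvent_op \<rho> A \<phi> z f)))}"

definition spec_rad ::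
  "'e::metric_space measure \<Rightarrow> ('e \<Rightarrow> 'e \<Rightarrow> real) \<Rightarrow> ((nat \<Rightarrow> 'e) \<Rightarrow> real) \<Rightarrow> real" where
  "spec_rad \<rho> A \<phi> = (SUP z\<in>transfer_spectrum \<rho> A \<phi>. cmod z)"

definition conformal_measure ::
  "'e::metric_space measure \<Rightarrow> ('e \<Rightarrow> 'e \<Rightarrow> real) \<Rightarrow> ((nat \<Rightarrow> 'e) \<Rightarrow> real) \<Rightarrow> (nat \<Rightarrow> 'e) measure" where
  "conformal_measure \<rho> A \<phi> =
     (THE \<nu>. \<nu> \<in> prob_Omega A \<and>
        (\<forall>f :: (nat \<Rightarrow> 'e) \<Rightarrow> real. f \<in> C0 A \<longrightarrow>
           (LINT \<omega>|\<nu>. transfer \<rho> A \<phi> f \<omega>) = spec_rad \<rho> A \<phi> * (LINT \<omega>|\<nu>. f \<omega>)))"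

definition eigenfunction ::
  "'e::metric_space measure \<Rightarrow> ('e \<Rightarrow> 'e \<Rightarrow> real) \<Rightarrow> ((nat \<Rightarrow> 'e) \<Rightarrow> real) \<Rightarrow> (nat \<Rightarrow> 'e) \<Rightarrow> real" where
  "eigenfunction \<rho> A \<phi> =
     (THE G. G \<in> extensional (Omega A) \<and> G \<in> Lip_Omega A \<and>
        (\<forall>\<omega>\<in>Omega A. G \<omega> > 0) \<and>
        (\<forall>\<omega>\<in>Omega A. transfer \<rho> A \<phi> G \<omega> = spec_rad \<rho> A \<phi> * G \<omega>) \<and>
        (LINT \<omega>|conformal_measure \<rho> A \<phi>. G \<omega>) = 1)"

definition gibbs_measure ::
  "'e::metric_space measure \<Rightarrow> ('e \<Rightarrow> 'e \<Rightarrow> real) \<Rightarrow> ((nat \<Rightarrow> 'e) \<Rightarrow> real) \<Rightarrow> (nat \<Rightarrow> 'e) measure" where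
  "gibbs_measure \<rho> A \<phi> =
     density (conformal_measure \<rho> A \<phi>) (\<lambda>\<omega>. ennreal (eigenfunction \<rho> A \<phi> \<omega>))"


section \<open>Entropy and quadratic pressure\<close>

text \<open>
  Infima and suprema are taken in \<^typ>\<open>ereal\<close>: the entropy of an invariant measure can be \<open>-\<infinity>\<close>.
\<close>

definition H_fun ::
  "'e::metric_space measure \<Rightarrow> ('e \<Rightarrow> 'e \<Rightarrow> real) \<Rightarrow> real ^ 'q \<Rightarrow> ((nat \<Rightarrow> 'e) \<Rightarrow> real ^ 'q) \<Rightarrow> ereal" where
  "H_fun \<rho> A z \<psi> = (INF t. ereal (ln (spec_rad \<rho> A (\<lambda>\<omega>. t \<bullet> \<psi> \<omega>)) - t \<bullet> z))"

text \<open>The type argument carries the number \<open>q\<close> of auxiliary potentials.\<close>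

definition entropy_hat ::
  "'q::finite itself \<Rightarrow> 'e::metric_space measure \<Rightarrow> ('e \<Rightarrow> 'e \<Rightarrow> real) \<Rightarrow> (nat \<Rightarrow> 'e) measure \<Rightarrow> ereal" where
  "entropy_hat TYPE('q) \<rho> A \<mu> =
     (INF \<xi> \<in> (Lip_Omega_vec A :: ((nat \<Rightarrow> 'e) \<Rightarrow> real ^ 'q) set). H_fun \<rho> A (LINT \<omega>|\<mu>. \<xi> \<omega>) \<xi>)"

definition quad_energy ::
  "'e::metric_space measure \<Rightarrow> ('e \<Rightarrow> 'e \<Rightarrow> real) \<Rightarrow> ((nat \<Rightarrow> 'e) \<Rightarrow> real ^ 'q::finite) \<Rightarrow> real \<Rightarrow>
   (nat \<Rightarrow> 'e) measure \<Rightarrow> ereal" where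
  "quad_energy \<rho> A \<psi> \<beta> \<mu> =
     entropy_hat TYPE('q) \<rho> A \<mu> + ereal (\<beta> / 2 * (norm (LINT \<omega>|\<mu>. \<psi> \<omega>))\<^sup>2)"

definition quad_pressure ::
  "'e::metric_space measure \<Rightarrow> ('e \<Rightarrow> 'e \<Rightarrow> real) \<Rightarrow> ((nat \<Rightarrow> 'e) \<Rightarrow> real ^ 'q::finite) \<Rightarrow> real \<Rightarrow> ereal" where
  "quad_pressure \<rho> A \<psi> \<beta> = (SUP \<mu>\<in>M_sigma A. quad_energy \<rho> A \<psi> \<beta> \<mu>)"

definition varphi ::
  "'e::metric_space measure \<Rightarrow> ('e \<Rightarrow> 'e \<Rightarrow> real) \<Rightarrow> ((nat \<Rightarrow> 'e) \<Rightarrow> real ^ 'q::finite) \<Rightarrow> real \<Rightarrow>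
   real ^ 'q \<Rightarrow> real" where
  "varphi \<rho> A \<psi> \<beta> t = - (\<beta> / 2) * (norm t)\<^sup>2 + ln (spec_rad \<rho> A (\<lambda>\<omega>. (\<beta> *\<^sub>R t) \<bullet> \<psi> \<omega>))"

end

theory Submission
  imports Defs
begin

text \<open>
  For Lipschitz \<open>\<phi>\<close> the transfer operator \<open>T\<close> contracts a cone of locally log-Lipschitz functions, so
  \<open>T ^ k f / T ^ k 1\<close> converges uniformly to a constant \<open>Lam f\<close>. The functional \<open>Lam\<close> is an eigenvector of
  the adjoint of \<open>T\<close> and is represented by the conformal measure; its eigenvalue \<open>lam\<close> is the spectral
  radius, because the positive eigenfunction \<open>G = lim T ^ k 1 / lam ^ k\<close> turns \<open>T\<close> into a Markov operator.

  By definition the entropy of \<open>\<mu>\<close> is at most \<open>ln r - \<integral> \<phi> d\<mu>\<close>, where \<open>r\<close> is the spectral radius belonging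
  to \<open>\<phi>\<close>. Equality holds for the Gibbs measure of \<open>\<phi>\<close> by Jensen's inequality. Conversely, if equality
  holds for an invariant \<open>\<mu>\<close>, testing the definition with the normalised potentials
  \<open>\<phi> + ln h - ln (T h \<circ> shift)\<close>, whose spectral radius is \<open>1\<close>, gives \<open>\<integral> ln (T h / h) d\<mu> \<ge> ln r\<close> for all
  Lipschitz \<open>h > 0\<close>. The first-order condition at \<open>h = G\<close> says that \<open>\<mu> / G\<close> is an eigenvector of the
  adjoint of \<open>T\<close>, hence the conformal measure.

  Finally \<open>(\<beta>/2) \<bar>m\<bar>\<^sup>2\<close> is the maximum over \<open>t\<close> of \<open>\<beta> t \<bullet> m - (\<beta>/2) \<bar>t\<bar>\<^sup>2\<close>, attained at \<open>t = m\<close>, so that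
  maximising the quadratic energy over \<open>\<mu>\<close> and \<open>varphi\<close> over \<open>t\<close> are the same joint maximisation.
\<close>

text \<open>The obstacle is that \<open>A\<close> vanishes in places, so \<open>T\<close> controls
  functions only locally: points closer than \<open>r\<close> have the same admissible prefixes,
  while points further apart cannot be compared directly. Mixing supplies the missing comparison
  after \<open>M\<close> steps, as a Harnack inequality.

  Prefixing halves the distance, so \<open>T\<close> turns a Lipschitz constant \<open>K\<close> for
  the logarithm into \<open>(C + K) / 2\<close>. Every \<open>K > C\<close> shrinks strictly; the
  proof takes \<open>K = 3 * C\<close>, with image \<open>2 * C\<close>. The room between the two
  constants converts the Harnack inequality into a strict contraction.

  The contraction yields a functional on continuous functions, whereas the conformal measure is
  given by a definite description of a measure. A Riesz theorem provides existence, and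
  \<open>eigenfunctional_unique\<close> provides uniqueness. The same lemma serves twice: with
  weight 1 it identifies the conformal measure, and with weight \<open>1 / G\<close> it identifies
  the equilibrium state.\<close>

section \<open>The Riesz representation theorem on a compact metric space\<close>

lemma suminf_ennreal_half_powers: "(\<Sum>n. ennreal (e / 2 ^ Suc n)) = ennreal e" if "e \<ge> 0"
proof -
  have "(\<lambda>n. e * (1/2) ^ Suc n) sums (e * 1)"
    by (rule sums_mult[OF power_half_series])
  then have "(\<lambda>n. e / 2 ^ Suc n) sums e" by (simp add: power_divide)
  then show ?thesis using that by (intro sums_unique[symmetric] sums_ennreal[THEN iffD2]) auto
qed

text \<open>\<open>\<Lambda>\<close> is applied to functions on the whole type, but the axioms
  restrict it only on those continuous on \<open>X\<close>; by \<open>cong\<close>, the values of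
  such functions off \<open>X\<close> do not matter.\<close>

locale positive_functional =
  fixes X :: "'a::metric_space set" and \<Lambda> :: "('a \<Rightarrow> real) \<Rightarrow> real"
  assumes compact_X: "compact X"
    and add: "continuous_on X f \<Longrightarrow> continuous_on X g \<Longrightarrow> \<Lambda> (\<lambda>x. f x + g x) = \<Lambda> f + \<Lambda> g"
    and scale: "continuous_on X f \<Longrightarrow> \<Lambda> (\<lambda>x. c * f x) = c * \<Lambda> f"
    and nonneg: "continuous_on X f \<Longrightarrow> (\<And>x. x \<in> X \<Longrightarrow> f x \<ge> 0) \<Longrightarrow> \<Lambda> f \<ge> 0"
    and one: "\<Lambda> (\<lambda>x. 1) = 1"
begin

lemma diff: "continuous_on X f \<Longrightarrow> continuous_on X g \<Longrightarrow> \<Lambda> (\<lambda>x. f x - g x) = \<Lambda> f - \<Lambda> g"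
  using add[of f "\<lambda>x. (-1) * g x"] scale[of g "-1"] by (simp add: continuous_on_minus)

lemma mono:
  "continuous_on X f \<Longrightarrow> continuous_on X g \<Longrightarrow> (\<And>x. x \<in> X \<Longrightarrow> f x \<le> g x) \<Longrightarrow> \<Lambda> f \<le> \<Lambda> g"
  using nonneg[of "\<lambda>x. g x - f x"] diff[of g f] by (force intro: continuous_intros)

lemma cong: "continuous_on X f \<Longrightarrow> continuous_on X g \<Longrightarrow> (\<And>x. x \<in> X \<Longrightarrow> f x = g x) \<Longrightarrow> \<Lambda> f = \<Lambda> g"
  by (intro antisym mono) auto

lemma const: "\<Lambda> (\<lambda>x. c) = c"
  using scale[of "\<lambda>x. 1" c] one by simp

lemma sum: "(\<And>i. i \<in> I \<Longrightarrow> continuous_on X (f i)) \<Longrightarrow> \<Lambda> (\<lambda>x. \<Sum>i\<in>I. f i x) = (\<Sum>i\<in>I. \<Lambda> (f i))"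
proof (induction I rule: infinite_finite_induct)
  case (insert j J)
  then show ?case
    using add[of "f j" "\<lambda>x. \<Sum>i\<in>J. f i x"] by (simp add: continuous_on_sum)
qed (simp_all add: const)

text \<open>As in the Daniell construction, countable families of continuous functions take the
  place of open covers. Cutting a cover along a set then amounts to multiplying by continuous
  functions, which stays within the domain where \<open>\<Lambda>\<close> is controlled.\<close>

definition cover :: "'a set \<Rightarrow> (nat \<Rightarrow> 'a \<Rightarrow> real) \<Rightarrow> bool" where
  "cover E f \<longleftrightarrow> (\<forall>n. continuous_on X (f n) \<and> (\<forall>x\<in>X. f n x \<ge> 0)) \<and>
     (\<forall>x\<in>E. 1 \<le> (\<Sum>n. ennreal (f n x)))"

definition outer :: "'a set \<Rightarrow> ennreal" where
  "outer E = (INF f\<in>{f. cover E f}. \<Sum>n. ennreal (\<Lambda> (f n)))"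

lemma outer_le: "cover E f \<Longrightarrow> outer E \<le> (\<Sum>n. ennreal (\<Lambda> (f n)))"
  unfolding outer_def by (rule INF_lower) simp

lemma outer_approx:
  assumes "e > 0" "outer E < \<infinity>"
  shows "\<exists>f. cover E f \<and> (\<Sum>n. ennreal (\<Lambda> (f n))) \<le> outer E + ennreal e"
proof -
  have "outer E < outer E + ennreal e"
    using assms ennreal_add_left_cancel_less[of "outer E" 0 "ennreal e"] by simp
  then obtain f where "cover E f" "(\<Sum>n. ennreal (\<Lambda> (f n))) < outer E + ennreal e"
    unfolding outer_def INF_less_iff by auto
  then show ?thesis by (auto intro: less_imp_le)
qed

lemma cover_single:
  assumes "continuous_on X g" "\<And>x. x \<in> X \<Longrightarrow> g x \<ge> 0" "\<And>x. x \<in> E \<Longrightarrow> g x \<ge> 1"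
  shows "outer E \<le> ennreal (\<Lambda> g)"
proof -
  define f where "f n = (if n = 0 then g else (\<lambda>x. 0))" for n :: nat
  have s: "(\<Sum>n. ennreal (F (f n))) = ennreal (F g)" if "F (\<lambda>x. 0) = 0" for F
    using that by (subst suminf_finite[of "{0}"]) (auto simp: f_def)
  have "cover E f"
    unfolding cover_def using assms s[of "\<lambda>h. h x" for x]
    by (auto simp: f_def continuous_on_const)
  then show ?thesis using outer_le[of E f] s[of \<Lambda>] by (simp add: const)
qed

text \<open>Subadditivity and the splitting lemma produce families with two indices.
  \<open>prod_decode\<close> flattens them into one sequence, and sums in \<open>ennreal\<close> can
  be rearranged freely.\<close>

lemma cover_pairs:
  fixes h :: "nat \<Rightarrow> nat \<Rightarrow> 'a \<Rightarrow> real"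
  assumes "\<And>m n. continuous_on X (h m n)" "\<And>m n x. x \<in> X \<Longrightarrow> h m n x \<ge> 0"
    and "\<And>x. x \<in> E \<Longrightarrow> 1 \<le> (\<Sum>m. \<Sum>n. ennreal (h m n x))"
  shows "outer E \<le> (\<Sum>m. \<Sum>n. ennreal (\<Lambda> (h m n)))"
proof -
  define f where "f i = (case prod_decode i of (m, n) \<Rightarrow> h m n)" for i
  have s: "(\<Sum>i. ennreal (F (f i))) = (\<Sum>m. \<Sum>n. ennreal (F (h m n)))" for F
    using suminf_ennreal_2dimen[of "\<lambda>m. \<Sum>n. ennreal (F (h m n))" "\<lambda>(m, n). ennreal (F (h m n))"]
    by (simp add: f_def split_def)
  have "cover E f"
    unfolding cover_def using assms s[of "\<lambda>h. h x" for x] by (auto simp: f_def split_def)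
  then show ?thesis using outer_le[of E f] s[of \<Lambda>] by simp
qed

lemma outer_measure_space_outer: "outer_measure_space (Pow X) outer"
proof -
  have "positive (Pow X) outer"
    using cover_single[of "\<lambda>x. 0" "{}"] by (simp add: positive_def const)
  moreover have "increasing (Pow X) outer"
    unfolding increasing_def outer_def
  proof (intro ballI impI INF_superset_mono)
    fix D E :: "'a set" assume "D \<subseteq> E"
    then show "{f. cover E f} \<subseteq> {f. cover D f}" unfolding cover_def by blast
  qed simp
  moreover have "countably_subadditive (Pow X) outer"
    unfolding countably_subadditive_def
  proof (intro allI impI)
    fix E :: "nat \<Rightarrow> 'a set"
    show "outer (\<Union>i. E i) \<le> (\<Sum>i. outer (E i))"
    proof (cases "\<exists>i. outer (E i) = \<infinity>")
      case True
      then obtain i where "outer (E i) = top" by auto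
      then have "(\<Sum>i. outer (E i)) = top"
        using sum_le_suminf[of "\<lambda>i. outer (E i)" "{i}"] by (simp add: top_unique)
      then show ?thesis by simp
    next
      case False
      show ?thesis
      proof (rule ennreal_le_epsilon)
        fix e :: real assume "e > 0"
        have "\<exists>f. cover (E i) f \<and> (\<Sum>n. ennreal (\<Lambda> (f n))) \<le> outer (E i) + ennreal (e / 2 ^ Suc i)" for i
          using False \<open>e > 0\<close> by (intro outer_approx) (auto simp: less_top)
        then obtain f where f: "\<And>i. cover (E i) (f i)"
          "\<And>i. (\<Sum>n. ennreal (\<Lambda> (f i n))) \<le> outer (E i) + ennreal (e / 2 ^ Suc i)" by metis
        have "outer (\<Union>i. E i) \<le> (\<Sum>i. \<Sum>n. ennreal (\<Lambda> (f i n)))"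
        proof (rule cover_pairs)
          fix x assume "x \<in> (\<Union>i. E i)"
          then obtain i where "x \<in> E i" by auto
          then have "1 \<le> (\<Sum>n. ennreal (f i n x))" using f(1)[of i] by (auto simp: cover_def)
          also have "\<dots> \<le> (\<Sum>i. \<Sum>n. ennreal (f i n x))"
            using sum_le_suminf[of "\<lambda>i. \<Sum>n. ennreal (f i n x)" "{i}"] by simp
          finally show "1 \<le> (\<Sum>i. \<Sum>n. ennreal (f i n x))" .
        qed (use f(1) in \<open>auto simp: cover_def\<close>)
        also have "\<dots> \<le> (\<Sum>i. outer (E i) + ennreal (e / 2 ^ Suc i))"
          by (intro suminf_le f(2)) auto
        also have "\<dots> = (\<Sum>i. outer (E i)) + (\<Sum>i. ennreal (e / 2 ^ Suc i))"
          by (rule suminf_add[symmetric]) auto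
        also have "\<dots> = (\<Sum>i. outer (E i)) + ennreal e"
          using \<open>e > 0\<close> by (subst suminf_ennreal_half_powers) auto
        finally show "outer (\<Union>i. E i) \<le> (\<Sum>i. outer (E i)) + ennreal e" .
      qed
    qed
  qed
  ultimately show ?thesis by (simp add: outer_measure_space_def)
qed

text \<open>The truncations \<open>v k = min 1 (k u)\<close> increase to the indicator of \<open>U\<close>. Cover \<open>E \<inter> U\<close> by the
  increments \<open>f n (v (k+1) - v k)\<close> and \<open>E - U\<close> by \<open>f n (1 - v (K n))\<close>, where \<open>K n\<close> is so large that
  the two families overlap little.\<close>

lemma outer_cozero_split:
  fixes u :: "'a \<Rightarrow> real"
  assumes u: "continuous_on X u" "\<And>x. u x \<ge> 0" and E: "E \<subseteq> X"
  shows "outer (E \<inter> {x. u x > 0}) + outer (E - {x. u x > 0}) \<le> outer E"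
    (is "?P + ?Q \<le> _")
proof -
  have "?P + ?Q \<le> (\<Sum>n. ennreal (\<Lambda> (f n)))" if f: "cover E f" for f
  proof (rule ennreal_le_epsilon)
    fix e :: real assume "e > 0"
    define v where "v k x = min 1 (real k * u x)" for k x
    have fc: "continuous_on X (f n)" and f0: "\<And>x. x \<in> X \<Longrightarrow> f n x \<ge> 0" for n
      using f by (auto simp: cover_def)
    have vc: "continuous_on X (v k)" for k
      unfolding v_def by (intro continuous_intros u)
    have v01: "v k x \<ge> 0" "v k x \<le> 1" "v k x \<le> v (Suc k) x" for k x
      using u(2)[of x] by (auto simp: v_def mult_right_mono min_le_iff_disj algebra_simps)
    have [simp]: "v 0 x = 0" for x by (simp add: v_def)
    define h where "h n k x = f n x * (v (Suc k) x - v k x)" for n k x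
    have hc: "continuous_on X (h n k)" for n k
      unfolding h_def by (intro continuous_intros fc vc)
    have h0: "h n k x \<ge> 0" if "x \<in> X" for n k x
      unfolding h_def using f0[OF that] v01(3)[of k x] by simp
    have hsum: "(\<Sum>k<K. h n k x) = f n x * v K x" for n K x
      unfolding h_def sum_distrib_left[symmetric] by (subst sum_lessThan_telescope) simp
    have tel: "(\<Sum>k. ennreal (h n k x)) = ennreal (f n x)" if "x \<in> X" "u x > 0" for n x
    proof -
      obtain K0 :: nat where K0: "1 / u x < real K0" using reals_Archimedean2 by blast
      have "v K x = 1" if "K \<ge> K0" for K
      proof -
        have "1 < real K0 * u x" using K0 \<open>u x > 0\<close> by (simp add: field_simps)
        also have "\<dots> \<le> real K * u x" using that \<open>u x > 0\<close> by (intro mult_right_mono) auto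
        finally show ?thesis by (simp add: v_def)
      qed
      then have "\<forall>\<^sub>F K in sequentially. f n x * v K x = f n x"
        by (auto simp: eventually_sequentially)
      then have "(\<lambda>K. \<Sum>k<K. h n k x) \<longlonglongrightarrow> f n x"
        unfolding hsum by (rule tendsto_eventually)
      then have "(\<lambda>k. h n k x) sums f n x" by (simp add: sums_def)
      then show ?thesis
        using h0[OF that(1)] f0[OF that(1)] by (intro sums_unique[symmetric] sums_ennreal[THEN iffD2]) auto
    qed
    have Lsum: "(\<Sum>k<K. \<Lambda> (h n k)) = \<Lambda> (\<lambda>x. f n x * v K x)" for n K
      using sum[of "{..<K}" "h n"] hc by (simp add: hsum)
    define S where "S n = (\<Sum>k. ennreal (\<Lambda> (h n k)))" for n
    have Lh0: "\<Lambda> (h n k) \<ge> 0" for n k by (rule nonneg[OF hc h0])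
    \<comment> \<open>The increments telescope under \<open>\<Lambda>\<close>, so \<open>S n\<close>
      is the bounded limit of \<open>\<Lambda>\<close> applied to \<open>f n * v K\<close>. For
      \<open>K\<close> with error below \<open>e / 2 ^ Suc n\<close>, the remainder
      \<open>f n * (1 - v K)\<close> accounts for the rest of
      \<open>\<Lambda> (f n)\<close>.\<close>
    have "\<exists>K. S n + ennreal (\<Lambda> (\<lambda>x. f n x * (1 - v K x))) \<le> ennreal (\<Lambda> (f n)) + ennreal (e / 2 ^ Suc n)" for n
    proof -
      have "summable (\<lambda>k. \<Lambda> (h n k))"
      proof (rule bounded_imp_summable[OF Lh0])
        fix K
        have "(\<Sum>k\<le>K. \<Lambda> (h n k)) = \<Lambda> (\<lambda>x. f n x * v (Suc K) x)"
          using Lsum[where K="Suc K"] by (simp add: lessThan_Suc_atMost)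
        also have "\<dots> \<le> \<Lambda> (f n)"
          using v01 f0 by (intro mono continuous_intros fc vc) (auto intro: mult_left_le)
        finally show "(\<Sum>k\<le>K. \<Lambda> (h n k)) \<le> \<Lambda> (f n)" .
      qed
      then have s: "(\<lambda>k. \<Lambda> (h n k)) sums (\<Sum>k. \<Lambda> (h n k))" by (rule summable_sums)
      define s where "s = (\<Sum>k. \<Lambda> (h n k))"
      have Ss: "S n = ennreal s"
        unfolding S_def s_def using s Lh0 by (intro sums_unique[symmetric] sums_ennreal[THEN iffD2])
          (auto intro: suminf_nonneg sums_summable)
      have s0: "s \<ge> 0" unfolding s_def using s Lh0 by (intro suminf_nonneg sums_summable[OF s])
      have "(\<lambda>K. \<Lambda> (\<lambda>x. f n x * v K x)) \<longlonglongrightarrow> s" using s by (simp add: sums_def Lsum s_def)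
      then have "\<forall>\<^sub>F K in sequentially. s - e / 2 ^ Suc n < \<Lambda> (\<lambda>x. f n x * v K x)"
        using \<open>e > 0\<close> by (intro order_tendstoD(1)) auto
      then obtain K where K: "s - e / 2 ^ Suc n < \<Lambda> (\<lambda>x. f n x * v K x)"
        by (auto simp: eventually_sequentially)
      have "\<Lambda> (\<lambda>x. f n x * (1 - v K x)) = \<Lambda> (f n) - \<Lambda> (\<lambda>x. f n x * v K x)"
        using diff[of "f n" "\<lambda>x. f n x * v K x"] fc vc
        by (simp add: right_diff_distrib continuous_on_mult)
      moreover have "\<Lambda> (\<lambda>x. f n x * (1 - v K x)) \<ge> 0"
        using v01 f0 by (intro nonneg continuous_intros fc vc) auto
      moreover have "\<Lambda> (f n) \<ge> 0" by (rule nonneg[OF fc f0])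
      ultimately show ?thesis
        using K s0 \<open>e > 0\<close> unfolding Ss
        by (intro exI[of _ K]) (simp add: ennreal_plus[symmetric] del: ennreal_plus)
    qed
    then obtain K where K: "\<And>n. S n + ennreal (\<Lambda> (\<lambda>x. f n x * (1 - v (K n) x)))
        \<le> ennreal (\<Lambda> (f n)) + ennreal (e / 2 ^ Suc n)" by metis
    have "?P \<le> (\<Sum>n. S n)"
      unfolding S_def
    proof (rule cover_pairs[OF hc h0])
      fix x assume x: "x \<in> E \<inter> {x. u x > 0}"
      then show "1 \<le> (\<Sum>m n. ennreal (h m n x))"
        using f E by (subst tel) (auto simp: cover_def)
    qed auto
    moreover have "?Q \<le> (\<Sum>n. ennreal (\<Lambda> (\<lambda>x. f n x * (1 - v (K n) x))))"
    proof (rule outer_le)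
      have "v k x = 0" if "\<not> u x > 0" for k x using u(2)[of x] that by (simp add: v_def)
      then show "cover (E - {x. u x > 0}) (\<lambda>n x. f n x * (1 - v (K n) x))"
        using f v01(2) fc vc unfolding cover_def by (auto intro!: continuous_intros)
    qed
    ultimately have "?P + ?Q \<le> (\<Sum>n. S n) + (\<Sum>n. ennreal (\<Lambda> (\<lambda>x. f n x * (1 - v (K n) x))))"
      by (rule add_mono)
    also have "\<dots> = (\<Sum>n. S n + ennreal (\<Lambda> (\<lambda>x. f n x * (1 - v (K n) x))))"
      by (rule suminf_add) auto
    also have "\<dots> \<le> (\<Sum>n. ennreal (\<Lambda> (f n)) + ennreal (e / 2 ^ Suc n))"
      by (intro suminf_le K) auto
    also have "\<dots> = (\<Sum>n. ennreal (\<Lambda> (f n))) + (\<Sum>n. ennreal (e / 2 ^ Suc n))"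
      by (rule suminf_add[symmetric]) auto
    also have "\<dots> = (\<Sum>n. ennreal (\<Lambda> (f n))) + ennreal e"
      using \<open>e > 0\<close> by (subst suminf_ennreal_half_powers) auto
    finally show "?P + ?Q \<le> (\<Sum>n. ennreal (\<Lambda> (f n))) + ennreal e" .
  qed
  then show ?thesis unfolding outer_def[of E] by (intro INF_greatest) auto
qed

text \<open>The lower bound is a Dini argument: at each point some partial sum of a cover exceeds
  \<open>1 - e\<close>, the sets where this happens are relatively open and increase, so by
  compactness one partial sum works on all of \<open>X\<close>.\<close>

lemma outer_space: "outer X = 1"
proof (rule antisym)
  show "outer X \<le> 1" using cover_single[of "\<lambda>x. 1" X] one by simp
next
  show "1 \<le> outer X" unfolding outer_def
  proof (rule INF_greatest)
    fix f assume "f \<in> {f. cover X f}"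
    then have f: "cover X f" by simp
    then have fc: "continuous_on X (f n)" and f0: "\<And>x. x \<in> X \<Longrightarrow> f n x \<ge> 0" for n
      by (auto simp: cover_def)
    show "1 \<le> (\<Sum>n. ennreal (\<Lambda> (f n)))"
    proof (rule ennreal_le_epsilon)
      fix e :: real assume e: "e > 0"
      define W where "W N = {x\<in>X. 1 - e < (\<Sum>n<N. f n x)}" for N
      have "\<exists>U. open U \<and> U \<inter> X = W N" for N
      proof -
        have "continuous_on X (\<lambda>x. \<Sum>n<N. f n x)" by (intro continuous_intros fc)
        from continuous_on_open_invariant[THEN iffD1, OF this, rule_format, OF open_greaterThan[of "1 - e"]]
        show ?thesis by (auto simp: W_def vimage_def)
      qed
      then obtain U where U: "\<And>N. open (U N)" "\<And>N. U N \<inter> X = W N" by metis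
      have "X \<subseteq> (\<Union>N. U N)"
      proof
        fix x assume x: "x \<in> X"
        have "(\<lambda>N. \<Sum>n<N. ennreal (f n x)) \<longlonglongrightarrow> (\<Sum>n. ennreal (f n x))" by (rule summable_LIMSEQ) auto
        \<comment> \<open>For \<open>e > 1\<close> the number \<open>1 - e\<close> is negative and
          \<open>ennreal\<close> truncates it to 0, which is still below 1.\<close>
        moreover have "ennreal (1 - e) < (\<Sum>n. ennreal (f n x))"
        proof -
          have "ennreal (1 - e) < 1" using e by (cases "e \<le> 1") (auto simp: ennreal_less_one_iff ennreal_neg)
          also have "1 \<le> (\<Sum>n. ennreal (f n x))" using f x by (auto simp: cover_def)
          finally show ?thesis .
        qed
        ultimately have "\<forall>\<^sub>F N in sequentially. ennreal (1 - e) < (\<Sum>n<N. ennreal (f n x))"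
          by (rule order_tendstoD(1))
        then obtain N where "ennreal (1 - e) < (\<Sum>n<N. ennreal (f n x))" by (auto simp: eventually_sequentially)
        then have "1 - e < (\<Sum>n<N. f n x)"
          using f0[OF x] by (simp add: sum_ennreal) (meson ennreal_leI linorder_not_le)
        then show "x \<in> (\<Union>N. U N)" using U(2)[of N] x by (auto simp: W_def)
      qed
      from compactE_image[OF compact_X U(1) this] obtain I where
        I: "finite I" "X \<subseteq> (\<Union>N\<in>I. U N)" by auto
      define N where "N = Max (insert 0 I)"
      have "1 - e \<le> (\<Sum>n<N. f n x)" if x: "x \<in> X" for x
      proof -
        obtain M where M: "M \<in> I" "x \<in> U M" using I x by auto
        then have "1 - e < (\<Sum>n<M. f n x)" using U(2)[of M] x by (auto simp: W_def)
        also have "\<dots> \<le> (\<Sum>n<N. f n x)"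
          using M I f0[OF x] by (intro sum_mono2) (auto simp: N_def Max_ge_iff)
        finally show ?thesis by simp
      qed
      then have "\<Lambda> (\<lambda>x. 1 - e) \<le> \<Lambda> (\<lambda>x. \<Sum>n<N. f n x)"
        by (intro mono continuous_intros fc) auto
      then have "1 \<le> (\<Sum>n<N. \<Lambda> (f n)) + e" using sum[of "{..<N}" f] fc by (simp add: const)
      then have "1 \<le> ennreal ((\<Sum>n<N. \<Lambda> (f n)) + e)" by simp
      also have "\<dots> = (\<Sum>n<N. ennreal (\<Lambda> (f n))) + ennreal e"
        using e nonneg[OF fc f0] by (subst ennreal_plus) (auto intro: sum_nonneg simp: sum_ennreal)
      also have "\<dots> \<le> (\<Sum>n. ennreal (\<Lambda> (f n))) + ennreal e"
        by (intro add_mono sum_le_suminf) auto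
      finally show "1 \<le> (\<Sum>n. ennreal (\<Lambda> (f n))) + ennreal e" .
    qed
  qed
qed

text \<open>Slicing into layers of unit height: continuous layers recover the function exactly,
  indicator layers lose at most one unit. Applied to \<open>real m * f x\<close>, that loss becomes
  \<open>1 / real m\<close>.\<close>

lemma staircase_sum: "y \<ge> 0 \<Longrightarrow> (\<Sum>i<m. min 1 (max 0 (y - real i))) = min y (real m)"
  by (induction m) (auto simp: min_def max_def)

lemma staircase_bound: "min y (real m) \<le> 1 + (\<Sum>i<m. of_bool (real i + 1 \<le> y))"
proof -
  have *: "(\<Sum>i<m. of_bool (real i + 1 \<le> y)) = real m" if "real m \<le> y" for m
    using that by (induction m) auto
  show ?thesis
  proof (induction m)
    case (Suc m)
    then show ?case using *[of m] by (cases "real m \<le> y") auto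
  qed (auto simp: min_def)
qed

text \<open>Caratheodory's sigma-algebra contains every relatively open set, because such a set is
  where a distance function is positive. Integral and functional are then compared by slicing
  functions with values in [0, 1]; replacing \<open>f\<close> by \<open>1 - f\<close> reverses the
  inequality.\<close>

theorem representing_measure:
  "\<exists>\<mu>. prob_space \<mu> \<and> sets \<mu> = sets (restrict_space borel X) \<and>
     (\<forall>f. continuous_on X f \<longrightarrow> (LINT x|\<mu>. f x) = \<Lambda> f)"
proof -
  interpret S: sigma_algebra X "Pow X" by (rule sigma_algebra_Pow)
  define L where "L = lambda_system X (Pow X) outer"
  have ms: "measure_space X L outer"
    unfolding L_def by (rule S.caratheodory_lemma[OF outer_measure_space_outer])
  then interpret L: sigma_algebra X L by (simp add: measure_space_def)
  have openL: "X \<inter> U \<in> L" if "open U" for U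
  proof -
    \<comment> \<open>\<open>infdist\<close> to the empty set is 0 by convention, so
      \<open>U = UNIV\<close> needs a separate value.\<close>
    define u where "u x = (if U = UNIV then 1 else infdist x (- U))" for x
    have uc: "continuous_on X u" unfolding u_def by (cases "U = UNIV") (auto intro: continuous_intros)
    have u0: "u x \<ge> 0" for x by (simp add: u_def infdist_nonneg)
    have U: "u x > 0 \<longleftrightarrow> x \<in> U" for x
    proof (cases "U = UNIV")
      case False
      then have "infdist x (- U) = 0 \<longleftrightarrow> x \<notin> U"
        using in_closed_iff_infdist_zero[of "- U" x] \<open>open U\<close> by auto
      then show ?thesis using False infdist_nonneg[of x "- U"] by (auto simp: u_def less_le)
    qed (simp add: u_def)
    have "outer (E \<inter> (X \<inter> U)) + outer (E - X \<inter> U) = outer E" if "E \<subseteq> X" for E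
    proof (rule antisym)
      have 1: "E \<inter> (X \<inter> U) = E \<inter> {x. u x > 0}" "E - X \<inter> U = E - {x. u x > 0}"
        using that U by auto
      show "outer (E \<inter> (X \<inter> U)) + outer (E - X \<inter> U) \<le> outer E"
        unfolding 1 by (rule outer_cozero_split[OF uc u0 that])
      have "subadditive (Pow X) outer"
        using outer_measure_space_outer S.countably_subadditive_subadditive
        by (auto simp: outer_measure_space_def)
      moreover have "E \<inter> (X \<inter> U) \<union> (E - X \<inter> U) = E" by auto
      ultimately show "outer E \<le> outer (E \<inter> (X \<inter> U)) + outer (E - X \<inter> U)"
        using that subadditiveD[of "Pow X" outer "E \<inter> (X \<inter> U)" "E - X \<inter> U"] by auto
    qed
    then show ?thesis unfolding L_def S.lambda_system_eq by auto
  qed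
  have borelL: "X \<inter> B \<in> L" if "B \<in> sets borel" for B
  proof -
    have "B \<in> sigma_sets UNIV {S. open S}" using that by (simp add: borel_def)
    then show ?thesis
    proof induction
      case (Compl B)
      have "X \<inter> (UNIV - B) = X - X \<inter> B" by auto
      then show ?case using Compl by (simp add: L.compl_sets)
    next
      case (Union B)
      then have "(\<Union>i. X \<inter> B i) \<in> L" by (intro L.countable_UN) auto
      then show ?case by simp
    qed (auto intro: openL)
  qed
  define R where "R = sets (restrict_space borel X)"
  have RL: "R \<subseteq> L" unfolding R_def sets_restrict_space using borelL by auto
  have Rsa: "sigma_algebra X R"
    using sets.sigma_algebra_axioms[of "restrict_space borel X"] by (simp add: R_def space_restrict_space)
  define \<mu> where "\<mu> = measure_of X R outer"
  have ca: "countably_additive R outer" "positive R outer"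
    using ms RL unfolding measure_space_def countably_additive_def positive_def by blast+
  have "R \<subseteq> Pow X" using Rsa by (simp add: sigma_algebra_iff2)
  then have sets: "sets \<mu> = R" and space: "space \<mu> = X"
    using sigma_algebra.sigma_sets_eq[OF Rsa] by (auto simp: \<mu>_def)
  have em: "emeasure \<mu> B = outer B" if "B \<in> R" for B
    by (rule emeasure_measure_of_sigma[OF Rsa ca(2,1) that, folded \<mu>_def])
  have XR: "X \<in> R" using sets sets.top[of \<mu>] space by simp
  interpret prob_space \<mu> by standard (simp add: space em[OF XR] outer_space)
  have meas: "f \<in> borel_measurable \<mu>" if "continuous_on X f" for f :: "'a \<Rightarrow> real"
    using borel_measurable_continuous_on_restrict[OF that] sets
    by (simp add: R_def cong: measurable_cong_sets)
  have bdd: "\<exists>B. \<forall>x\<in>X. norm (f x) \<le> B" if "continuous_on X f" for f :: "'a \<Rightarrow> real"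
    using compact_imp_bounded[OF compact_continuous_image[OF that compact_X]] by (auto simp: bounded_iff)
  have int: "integrable \<mu> f" if f: "continuous_on X f" for f :: "'a \<Rightarrow> real"
  proof -
    obtain B where "\<forall>x\<in>X. norm (f x) \<le> B" using bdd[OF f] by auto
    then show ?thesis by (intro integrable_const_bound[of _ B] meas[OF f]) (auto simp: space)
  qed
  \<comment> \<open>Layer cake at the levels \<open>i / m\<close>: the indicator of
    \<open>B i\<close> lies below the continuous slice \<open>g i\<close>, so
    \<open>cover_single\<close> bounds its measure by \<open>\<Lambda> (g i)\<close>, and the slices
    add up to \<open>real m * f\<close>.\<close>
  have le01: "(LINT x|\<mu>. f x) \<le> \<Lambda> f"
    if f: "continuous_on X f" and f01: "\<And>x. x \<in> X \<Longrightarrow> 0 \<le> f x \<and> f x \<le> 1" for f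
  proof (rule field_le_epsilon)
    fix e :: real assume "e > 0"
    then obtain m :: nat where m: "m > 0" "1 / real m < e"
      by (metis ex_inverse_of_nat_less inverse_eq_divide)
    define g where "g i x = min 1 (max 0 (real m * f x - real i))" for i x
    have gc: "continuous_on X (g i)" for i unfolding g_def by (intro continuous_intros f)
    define B where "B i = {x\<in>X. real i + 1 \<le> real m * f x}" for i :: nat
    have BR: "B i \<in> sets \<mu>" for i
    proof -
      have "(\<lambda>x. real m * f x) \<in> borel_measurable \<mu>" using meas[OF f] by simp
      then have "{x \<in> space \<mu>. real i + 1 \<le> real m * f x} \<in> sets \<mu>" by measurable
      then show ?thesis by (simp add: B_def space)
    qed
    have Bg: "measure \<mu> (B i) \<le> \<Lambda> (g i)" for i
    proof -
      have "outer (B i) \<le> ennreal (\<Lambda> (g i))"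
        by (rule cover_single[OF gc]) (auto simp: g_def B_def)
      moreover have "\<Lambda> (g i) \<ge> 0" by (rule nonneg[OF gc]) (auto simp: g_def)
      ultimately show ?thesis
        using em[of "B i"] BR[of i] by (simp add: sets measure_def enn2real_leI)
    qed
    have "real m * (LINT x|\<mu>. f x) = (LINT x|\<mu>. real m * f x)" by simp
    also have "\<dots> \<le> (LINT x|\<mu>. 1 + (\<Sum>i<m. indicator (B i) x))"
    proof (rule integral_mono)
      show "integrable \<mu> (\<lambda>x. 1 + (\<Sum>i<m. indicator (B i) x) :: real)"
        by (intro Bochner_Integration.integrable_add Bochner_Integration.integrable_sum integrable_real_indicator BR)
          (auto simp: emeasure_eq_measure)
      fix x assume "x \<in> space \<mu>"
      then have x: "x \<in> X" by (simp add: space)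
      have "real m * f x \<le> real m" using f01[OF x] by (simp add: mult_left_le)
      moreover have "(\<Sum>i<m. indicator (B i) x) = (\<Sum>i<m. of_bool (real i + 1 \<le> real m * f x) :: real)"
        using x by (intro sum.cong) (auto simp: B_def)
      ultimately show "real m * f x \<le> 1 + (\<Sum>i<m. indicator (B i) x)"
        using staircase_bound[of "real m * f x" m] by simp
    qed (use int f in auto)
    also have "\<dots> = 1 + (\<Sum>i<m. measure \<mu> (B i))"
      using BR by (subst Bochner_Integration.integral_add)
        (auto simp: prob_space emeasure_eq_measure Bochner_Integration.integral_sum intro!: Bochner_Integration.integrable_sum)
    also have "\<dots> \<le> 1 + (\<Sum>i<m. \<Lambda> (g i))" by (intro add_left_mono sum_mono Bg)
    also have "(\<Sum>i<m. \<Lambda> (g i)) = \<Lambda> (\<lambda>x. \<Sum>i<m. g i x)" using sum[of "{..<m}" g] gc by simp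
    also have "\<dots> = \<Lambda> (\<lambda>x. real m * f x)"
    proof (rule cong)
      fix x assume x: "x \<in> X"
      have "real m * f x \<le> real m" using f01[OF x] by (simp add: mult_left_le)
      then show "(\<Sum>i<m. g i x) = real m * f x"
        unfolding g_def using f01[OF x] by (subst staircase_sum) auto
    qed (auto intro!: continuous_intros gc f)
    also have "\<dots> = real m * \<Lambda> f" by (rule scale[OF f])
    finally have "(LINT x|\<mu>. f x) \<le> \<Lambda> f + 1 / real m" using m(1) by (simp add: field_simps)
    then show "(LINT x|\<mu>. f x) \<le> \<Lambda> f + e" using m by linarith
  qed
  have eq01: "(LINT x|\<mu>. f x) = \<Lambda> f"
    if f: "continuous_on X f" and f01: "\<And>x. x \<in> X \<Longrightarrow> 0 \<le> f x \<and> f x \<le> 1" for f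
  proof (rule antisym)
    have "(LINT x|\<mu>. 1 - f x) \<le> \<Lambda> (\<lambda>x. 1 - f x)"
      by (rule le01) (use f f01 in \<open>auto intro: continuous_intros\<close>)
    then show "\<Lambda> f \<le> (LINT x|\<mu>. f x)"
      using f int[OF f] by (simp add: diff const prob_space)
  qed (rule le01[OF that])
  have "(LINT x|\<mu>. f x) = \<Lambda> f" if f: "continuous_on X f" for f
  proof -
    obtain B0 where B0: "\<forall>x\<in>X. norm (f x) \<le> B0" using bdd[OF f] by auto
    define B where "B = max 1 B0"
    have B: "B > 0" "\<And>x. x \<in> X \<Longrightarrow> \<bar>f x\<bar> \<le> B" using B0 by (auto simp: B_def le_max_iff_disj)
    \<comment> \<open>The affine map from [-B, B] onto [0, 1] reduces the general case to
      \<open>eq01\<close>.\<close>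
    define g where "g x = 1 / 2 + 1 / (2 * B) * f x" for x
    have gc: "continuous_on X g" unfolding g_def by (intro continuous_intros f)
    have "(LINT x|\<mu>. g x) = \<Lambda> g"
    proof (rule eq01[OF gc])
      fix x assume "x \<in> X"
      then show "0 \<le> g x \<and> g x \<le> 1" using B(1) B(2)[of x] by (auto simp: g_def field_simps)
    qed
    moreover have "(LINT x|\<mu>. g x) = 1 / 2 + 1 / (2 * B) * (LINT x|\<mu>. f x)"
      unfolding g_def using int[OF f] by (simp add: prob_space)
    moreover have "\<Lambda> g = 1 / 2 + 1 / (2 * B) * \<Lambda> f"
      unfolding g_def
      using add[OF continuous_on_const continuous_on_mult_left[OF f], of "1 / 2" "1 / (2 * B)"]
        scale[OF f, of "1 / (2 * B)"] by (simp add: const)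
    ultimately show ?thesis using B(1) by simp
  qed
  then show ?thesis using sets prob_space_axioms by (auto simp: R_def)
qed

end

text \<open>The open sets are exhausted by \<open>min 1 (n dist(x, - U))\<close>.\<close>

lemma measure_eq_if_continuous_integrals_eq:
  fixes \<mu> \<nu> :: "'a::metric_space measure"
  assumes X: "X \<in> sets borel" and "prob_space \<mu>" "prob_space \<nu>"
    and sets: "sets \<mu> = sets (restrict_space borel X)" "sets \<nu> = sets (restrict_space borel X)"
    and eq: "\<And>f :: 'a \<Rightarrow> real. continuous_on X f \<Longrightarrow> (LINT x|\<mu>. f x) = (LINT x|\<nu>. f x)"
  shows "\<mu> = \<nu>"
proof -
  have space: "space \<mu> = X" "space \<nu> = X"
    using sets[THEN sets_eq_imp_space_eq] by (auto simp: space_restrict_space)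
  have meas: "f \<in> borel_measurable \<mu>" "f \<in> borel_measurable \<nu>" if "continuous_on X f" for f :: "'a \<Rightarrow> real"
    using borel_measurable_continuous_on_restrict[OF that] sets by (simp_all cong: measurable_cong_sets)
  let ?E = "(\<inter>) X ` {U. open U}"
  have gen: "sets (restrict_space borel X) = sigma_sets X ?E"
  proof -
    have "sets (restrict_space borel X) = sets (restrict_space (sigma UNIV {U :: 'a set. open U}) X)"
      by (simp add: borel_def)
    also have "\<dots> = sigma_sets X ?E"
      using sigma_sets_Int[of X UNIV "{U :: 'a set. open U}"] X by (simp add: sets_restrict_space borel_def)
    finally show ?thesis .
  qed
  have openeq: "emeasure \<mu> (X \<inter> U) = emeasure \<nu> (X \<inter> U)" if U: "open U" for U
  proof -
    define f where "f n x = (if U = UNIV then 1 else min 1 (real n * infdist x (- U)))" for n x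
    have fc: "continuous_on X (f n)" for n
      unfolding f_def by (cases "U = UNIV") (auto intro!: continuous_intros)
    have lim: "(\<lambda>n. f n x) \<longlonglongrightarrow> indicator (X \<inter> U) x" if x: "x \<in> X" for x
    proof (cases "U = UNIV")
      case False
      show ?thesis
      proof (cases "x \<in> U")
        case True
        then have "infdist x (- U) > 0"
          using False U in_closed_iff_infdist_zero[of "- U" x] infdist_nonneg[of x "- U"] by (auto simp: less_le)
        then obtain n0 :: nat where n0: "1 / infdist x (- U) < real n0" using reals_Archimedean2 by blast
        have "f n x = 1" if "n \<ge> n0" for n
        proof -
          have "1 < real n0 * infdist x (- U)" using n0 \<open>infdist x (- U) > 0\<close> by (simp add: field_simps)
          also have "\<dots> \<le> real n * infdist x (- U)" using that by (intro mult_right_mono infdist_nonneg) auto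
          finally show ?thesis using False by (simp add: f_def)
        qed
        then show ?thesis using True x by (intro tendsto_eventually) (auto simp: eventually_sequentially)
      next
        case False
        then have "infdist x (- U) = 0" by simp
        then show ?thesis using False \<open>U \<noteq> UNIV\<close> by (simp add: f_def)
      qed
    qed (use x in \<open>simp add: f_def\<close>)
    have b: "norm (f n x) \<le> 1" for n x by (auto simp: f_def infdist_nonneg)
    have XU: "X \<inter> U \<in> sets \<mu>" "X \<inter> U \<in> sets \<nu>" using U by (auto simp: sets sets_restrict_space)
    interpret \<mu>: prob_space \<mu> by fact
    interpret \<nu>: prob_space \<nu> by fact
    have "(\<lambda>n. LINT x|\<mu>. f n x) \<longlonglongrightarrow> (LINT x|\<mu>. indicator (X \<inter> U) x)"
      by (rule integral_dominated_convergence[where w="\<lambda>x. 1"])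
        (use XU lim meas[OF fc] b in \<open>auto simp: space\<close>)
    moreover have "(\<lambda>n. LINT x|\<nu>. f n x) \<longlonglongrightarrow> (LINT x|\<nu>. indicator (X \<inter> U) x)"
      by (rule integral_dominated_convergence[where w="\<lambda>x. 1"])
        (use XU lim meas[OF fc] b in \<open>auto simp: space\<close>)
    ultimately have "(LINT x|\<mu>. indicator (X \<inter> U) x) = (LINT x|\<nu>. indicator (X \<inter> U) x :: real)"
      unfolding eq[OF fc] by (rule LIMSEQ_unique)
    then show ?thesis using XU by (simp add: \<mu>.emeasure_eq_measure \<nu>.emeasure_eq_measure space Int_ac)
  qed
  show ?thesis
  proof (rule measure_eqI_generator_eq[where A="\<lambda>_. X" and \<Omega>=X and E="?E"])
    show "Int_stable ?E"
    proof (rule Int_stableI_image)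
      fix U V :: "'a set" assume "U \<in> {U. open U}" "V \<in> {U. open U}"
      then show "\<exists>W\<in>{U. open U}. X \<inter> U \<inter> (X \<inter> V) = X \<inter> W"
        by (intro bexI[of _ "U \<inter> V"]) auto
    qed
    interpret prob_space \<mu> by fact
    show "emeasure \<mu> X \<noteq> \<infinity>" by simp
    show "range (\<lambda>_. X) \<subseteq> ?E" by (auto intro!: image_eqI[of _ _ UNIV])
  qed (use gen sets openeq in auto)
qed

section \<open>The shift space\<close>

lemma compact_UNIV_fun:
  assumes "compact (UNIV :: 'e::topological_space set)"
  shows "compact (UNIV :: ('i \<Rightarrow> 'e) set)"
proof -
  have "compactin (product_topology (\<lambda>i::'i. euclidean :: 'e topology) UNIV) (PiE UNIV (\<lambda>i. UNIV))"
    unfolding compactin_PiE using assms by simp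
  then show ?thesis by (simp add: euclidean_product_topology PiE_UNIV_domain)
qed

locale shift_space =
  fixes \<rho> :: "'e::metric_space measure" and A :: "'e \<Rightarrow> 'e \<Rightarrow> real"
  assumes compact_E: "compact (UNIV :: 'e set)"
    and prob_rho: "prob_space \<rho>"
    and borel_rho: "sets \<rho> = sets borel"
    and full_support: "\<And>U. open U \<Longrightarrow> U \<noteq> {} \<Longrightarrow> measure \<rho> U > 0"
    and A_01: "\<And>a b. A a b \<in> {0, 1}"
    and A_continuous: "continuous_on UNIV (\<lambda>(a, b). A a b)"
    and A_Lipschitz: "\<exists>L. \<forall>a. L-lipschitz_on UNIV (A a)"
    and A_mixing:
      "\<exists>N\<ge>1. \<forall>n\<ge>N. \<forall>a b. \<exists>z :: nat \<Rightarrow> 'e. z 0 = a \<and> z n = b \<and> (\<Prod>i<n. A (z i) (z (Suc i))) = 1"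
begin

abbreviation \<Omega> :: "(nat \<Rightarrow> 'e) set" where "\<Omega> \<equiv> Omega A"
abbreviation d :: "(nat \<Rightarrow> 'e) \<Rightarrow> (nat \<Rightarrow> 'e) \<Rightarrow> real" where "d \<equiv> d_Omega"

section \<open>The metric on sequences\<close>

lemma bounded_E: "\<exists>D>0. \<forall>a b :: 'e. dist a b \<le> D"
proof -
  obtain K where K: "\<And>a b :: 'e. dist a b \<le> K"
    using compact_imp_bounded[OF compact_E] unfolding bounded_two_points by auto
  then show ?thesis by (intro exI[of _ "max K 1"]) (auto simp: le_max_iff_disj)
qed

lemma summable_d: "summable (\<lambda>n. dist (x n) (y n :: 'e) / 2 ^ (n + 1))"
proof -
  obtain D where D: "\<And>a b :: 'e. dist a b \<le> D" using bounded_E by auto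
  have "summable (\<lambda>n. D * (1/2) ^ (n + 1))"
    by (intro summable_mult summable_ignore_initial_segment summable_geometric) auto
  then show ?thesis
    by (rule summable_comparison_test'[where N=0]) (use D in \<open>auto simp: power_divide divide_right_mono\<close>)
qed

lemma d_nonneg: "d x y \<ge> 0"
  unfolding d_Omega_def by (intro suminf_nonneg summable_d) auto

lemma d_commute: "d x y = d y x"
  unfolding d_Omega_def by (simp add: dist_commute)

lemma d_self [simp]: "d x x = 0"
  by (simp add: d_Omega_def)

lemma d_triangle: "d x z \<le> d x y + d y z"
  unfolding d_Omega_def
  by (subst suminf_add[OF summable_d summable_d], intro suminf_le summable_add summable_d)
    (auto simp: dist_triangle add_divide_distrib[symmetric] divide_right_mono)

lemma d_le: "\<exists>D>0. \<forall>x y. d x y \<le> D"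
proof -
  obtain D where D: "D > 0" "\<And>a b :: 'e. dist a b \<le> D" using bounded_E by auto
  have s: "(\<lambda>n. D * (1/2) ^ Suc n) sums (D * 1)"
    by (rule sums_mult[OF power_half_series])
  have "d x y \<le> D" for x y
    unfolding d_Omega_def using D(2) s
    by (subst (2) mult_1_right[symmetric], subst sums_unique[OF s], intro suminf_le summable_d sums_summable[OF s])
       (auto simp: power_divide divide_right_mono)
  then show ?thesis using D(1) by blast
qed

text \<open>Splitting off the zeroth coordinate is the source of all expansion and contraction
  estimates; in particular it gives \<open>d_case_nat\<close>, by which a common prefix symbol
  halves the distance.\<close>

lemma d_rec: "d x y = dist (x 0) (y 0) / 2 + d (shift x) (shift y) / 2"
proof -
  have "d x y = dist (x 0) (y 0) / 2 ^ (0 + 1) + (\<Sum>n. dist (x (Suc n)) (y (Suc n)) / 2 ^ (Suc n + 1))"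
    unfolding d_Omega_def using suminf_split_head[OF summable_d[of x y]] by simp
  also have "(\<Sum>n. dist (x (Suc n)) (y (Suc n)) / 2 ^ (Suc n + 1)) =
      (\<Sum>n. dist (x (Suc n)) (y (Suc n)) / 2 ^ (n + 1)) / 2"
    using suminf_divide[OF summable_d[of "shift x" "shift y"], of 2] by (simp add: shift_def mult.commute)
  finally show ?thesis by (simp add: d_Omega_def shift_def)
qed

lemma shift_case_nat [simp]: "shift (case_nat t x) = x"
  by (simp add: shift_def)

lemma case_nat_shift: "case_nat (x 0) (shift x) = x"
  by (auto simp: shift_def fun_eq_iff split: nat.split)

lemma d_case_nat: "d (case_nat t x) (case_nat t y) = d x y / 2"
  by (subst d_rec) simp

lemma d_shift: "d (shift x) (shift y) \<le> 2 * d x y"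
  using d_rec[of x y] by simp

lemma dist_head: "dist (x 0) (y 0) \<le> 2 * d x y"
  using d_rec[of x y] d_nonneg[of "shift x" "shift y"] by simp

lemma d_le_prefix: "(\<And>x y. d x y \<le> D) \<Longrightarrow> (\<And>i. i < m \<Longrightarrow> x i = y i) \<Longrightarrow> d x y \<le> D / 2 ^ m"
proof (induction m arbitrary: x y)
  case (Suc m)
  have "d (shift x) (shift y) \<le> D / 2 ^ m"
    using Suc.prems by (intro Suc.IH) (auto simp: shift_def)
  then show ?case using d_rec[of x y] Suc.prems(2)[of 0] by (simp add: mult.commute)
qed auto

lemma d_pos: "x \<noteq> y \<Longrightarrow> d x y > 0"
proof -
  assume "x \<noteq> y"
  then obtain i where "x i \<noteq> y i" by auto
  then have "0 < dist (x i) (y i) / 2 ^ (i + 1)" by simp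
  also have "\<dots> \<le> d x y"
    unfolding d_Omega_def using sum_le_suminf[OF summable_d, of "{i}" x y] by simp
  finally show ?thesis .
qed

lemma open_d_ball: "open {y. d x y < e}"
  unfolding open_iff_d_Omega[OF compact_E]
proof (intro ballI)
  fix y assume "y \<in> {y. d x y < e}"
  then show "\<exists>r>0. \<forall>z. d y z < r \<longrightarrow> z \<in> {y. d x y < e}"
    using order_le_less_trans[OF d_triangle[of x _ y]]
    by (intro exI[of _ "e - d x y"]) (simp add: less_diff_eq add.commute)
qed

text \<open>Continuity refers to the product topology of the type, of which \<open>d\<close> is not
  the built-in metric. An epsilon-delta argument in \<open>d\<close> therefore has to pass through
  \<open>open_d_ball\<close>.\<close>

lemma continuous_on_d_locally:
  fixes f :: "(nat \<Rightarrow> 'e) \<Rightarrow> 'b::metric_space"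
  assumes "\<And>x e. x \<in> S \<Longrightarrow> e > 0 \<Longrightarrow> \<exists>r>0. \<forall>y\<in>S. d x y < r \<longrightarrow> dist (f x) (f y) < e"
  shows "continuous_on S f"
  unfolding continuous_on_topological
proof (intro ballI allI impI)
  fix x B assume x: "x \<in> S" "open B" "f x \<in> B"
  then obtain e where e: "e > 0" "\<And>y. dist (f x) y < e \<Longrightarrow> y \<in> B"
    by (metis open_contains_ball mem_ball subsetD)
  obtain r where "r > 0" "\<forall>y\<in>S. d x y < r \<longrightarrow> dist (f x) (f y) < e" using assms[OF x(1) e(1)] by auto
  then show "\<exists>U. open U \<and> x \<in> U \<and> (\<forall>y\<in>S. y \<in> U \<longrightarrow> f y \<in> B)"
    using e open_d_ball by (intro exI[of _ "{y. d x y < r}"]) auto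
qed

section \<open>Admissible sequences and compactness of their space\<close>

lemma continuous_on_A:
  "continuous_on S f \<Longrightarrow> continuous_on S g \<Longrightarrow> continuous_on S (\<lambda>x. A (f x) (g x))"
  using continuous_on_compose2[OF A_continuous, of S "\<lambda>x. (f x, g x)"] by (auto intro: continuous_intros)

lemma A_pos_iff: "A a b > 0 \<longleftrightarrow> A a b = 1"
  using A_01[of a b] by auto

lemma Omega_iff: "x \<in> \<Omega> \<longleftrightarrow> (\<forall>i. A (x i) (x (Suc i)) = 1)"
  by (simp add: Omega_def A_pos_iff)

lemma case_nat_Omega: "\<omega> \<in> \<Omega> \<Longrightarrow> case_nat t \<omega> \<in> \<Omega> \<longleftrightarrow> A t (\<omega> 0) = 1"
  by (auto simp: Omega_iff split: nat.split)

lemma shift_Omega: "\<omega> \<in> \<Omega> \<Longrightarrow> shift \<omega> \<in> \<Omega>"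
  by (simp add: Omega_iff shift_def)

lemma compact_Omega: "compact \<Omega>"
proof -
  have "closed {x :: nat \<Rightarrow> 'e. \<forall>i. A (x i) (x (Suc i)) = 1}"
    by (intro closed_Collect_all closed_Collect_eq continuous_on_A continuous_on_product_coordinates)
      auto
  moreover have "\<Omega> = {x. \<forall>i. A (x i) (x (Suc i)) = 1}" by (auto simp: Omega_iff)
  ultimately show ?thesis
    using compact_Int_closed[OF compact_UNIV_fun[OF compact_E], of \<Omega>] by simp
qed

lemma Omega_borel: "\<Omega> \<in> sets borel"
  using compact_Omega by (simp add: compact_imp_closed borel_closed)

lemma path:
  "\<exists>N\<ge>1. \<forall>n\<ge>N. \<forall>a b. \<exists>z :: nat \<Rightarrow> 'e. z 0 = a \<and> z n = b \<and> (\<forall>i<n. A (z i) (z (Suc i)) = 1)"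
proof -
  have "(\<forall>i<n. A (z i) (z (Suc i)) = 1) \<longleftrightarrow> (\<Prod>i<n. A (z i) (z (Suc i))) = 1" for z :: "nat \<Rightarrow> 'e" and n
  proof
    assume *: "(\<Prod>i<n. A (z i) (z (Suc i))) = 1"
    show "\<forall>i<n. A (z i) (z (Suc i)) = 1"
    proof (intro allI impI)
      fix i assume "i < n"
      then have "A (z i) (z (Suc i)) \<noteq> 0"
        using * prod_zero_iff[of "{..<n}" "\<lambda>i. A (z i) (z (Suc i))"] by auto
      then show "A (z i) (z (Suc i)) = 1" using A_01[of "z i" "z (Suc i)"] by auto
    qed
  qed simp
  then show ?thesis using A_mixing by presburger
qed

text \<open>A closed path of length \<open>N \<ge> 1\<close> at \<open>a\<close> supplies a
  successor as its second vertex and a predecessor as its last vertex but one.\<close>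

lemma ex_succ: "\<exists>b. A a b = 1" and ex_pred: "\<exists>b. A b a = 1"
proof -
  obtain N where N: "N \<ge> 1" "\<forall>n\<ge>N. \<forall>a b. \<exists>z :: nat \<Rightarrow> 'e. z 0 = a \<and> z n = b \<and> (\<forall>i<n. A (z i) (z (Suc i)) = 1)"
    using path by blast
  then obtain z :: "nat \<Rightarrow> 'e" where z: "z 0 = a" "z N = a" "\<forall>i<N. A (z i) (z (Suc i)) = 1" by blast
  show "\<exists>b. A a b = 1" using z N(1) by (intro exI[of _ "z 1"]) auto
  show "\<exists>b. A b a = 1" using z(2) z(3)[rule_format, of "N - 1"] N(1) by (intro exI[of _ "z (N - 1)"]) simp
qed

lemma Omega_nonempty: "\<Omega> \<noteq> {}"
proof -
  obtain s where s: "\<And>a. A a (s a) = 1" using ex_succ by metis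
  have "(\<lambda>n. (s ^^ n) undefined) \<in> \<Omega>" using s by (simp add: Omega_iff)
  then show ?thesis by auto
qed

text \<open>A Lipschitz function with values 0 and 1 cannot jump over a short distance. The radius
  is uniform in \<open>t\<close>, so the transfer operator at two nearby points integrates over the
  same set of prefixes.\<close>

lemma A_locally_const: "\<exists>r>0. \<forall>x y t. d x y < r \<longrightarrow> A t (x 0) = A t (y 0)"
proof -
  obtain L where L: "\<And>a. L-lipschitz_on UNIV (A a)" using A_Lipschitz by auto
  then have L0: "L \<ge> 0" using lipschitz_on_nonneg by blast
  \<comment> \<open>The factor 2 matches \<open>dist_head\<close>, so that
    \<open>L * (2 * r) < 1\<close>; adding 1 to \<open>L\<close> covers
    \<open>L = 0\<close>.\<close>
  define r where "r = 1 / (2 * (L + 1))"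
  have "A t (x 0) = A t (y 0)" if "d x y < r" for x y t
  proof -
    have "dist (A t (x 0)) (A t (y 0)) \<le> L * dist (x 0) (y 0)" by (rule lipschitz_onD[OF L]) auto
    also have "\<dots> \<le> L * (2 * d x y)" by (intro mult_left_mono dist_head L0)
    also have "\<dots> \<le> L * (2 * r)" using that L0 by (intro mult_left_mono) auto
    also have "\<dots> < 1" using L0 by (simp add: r_def field_simps)
    finally show ?thesis using A_01[of t "x 0"] A_01[of t "y 0"] by (auto simp: dist_real_def)
  qed
  moreover have "r > 0" using L0 by (simp add: r_def)
  ultimately show ?thesis by blast
qed

lemma continuous_bounded:
  fixes f :: "(nat \<Rightarrow> 'e) \<Rightarrow> 'b::real_normed_vector"
  assumes "continuous_on \<Omega> f" shows "\<exists>B>0. \<forall>x\<in>\<Omega>. norm (f x) \<le> B"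
  using compact_imp_bounded[OF compact_continuous_image[OF assms compact_Omega]]
  by (auto simp: bounded_pos)

lemma positive_bounded_below:
  fixes f :: "(nat \<Rightarrow> 'e) \<Rightarrow> real"
  assumes "continuous_on \<Omega> f" "\<And>x. x \<in> \<Omega> \<Longrightarrow> f x > 0"
  shows "\<exists>c>0. \<forall>x\<in>\<Omega>. c \<le> f x"
proof -
  obtain x where "x \<in> \<Omega>" "\<forall>y\<in>\<Omega>. f x \<le> f y"
    using continuous_attains_inf[OF compact_Omega Omega_nonempty assms(1)] by auto
  then show ?thesis using assms(2) by blast
qed

section \<open>Calculus of Lipschitz functions\<close>

lemma LipI: "(\<And>x y. x \<in> \<Omega> \<Longrightarrow> y \<in> \<Omega> \<Longrightarrow> \<bar>f x - f y\<bar> \<le> C * d x y) \<Longrightarrow> f \<in> Lip_Omega A"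
  by (auto simp: Lip_Omega_def)

lemma LipE:
  assumes "f \<in> Lip_Omega A"
  obtains C where "C > 0" "\<And>x y. x \<in> \<Omega> \<Longrightarrow> y \<in> \<Omega> \<Longrightarrow> \<bar>f x - f y\<bar> \<le> C * d x y"
proof -
  obtain C where C: "\<And>x y. x \<in> \<Omega> \<Longrightarrow> y \<in> \<Omega> \<Longrightarrow> \<bar>f x - f y\<bar> \<le> C * d x y"
    using assms by (auto simp: Lip_Omega_def)
  have "\<bar>f x - f y\<bar> \<le> max C 1 * d x y" if "x \<in> \<Omega>" "y \<in> \<Omega>" for x y
    using C[OF that] mult_right_mono[OF max.cobounded1[of C 1] d_nonneg[of x y]] by linarith
  then show thesis using that[of "max C 1"] by auto
qed

lemma LipD:
  assumes "f \<in> Lip_Omega A"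
  shows "\<exists>C>0. \<forall>x\<in>\<Omega>. \<forall>y\<in>\<Omega>. \<bar>f x - f y\<bar> \<le> C * d x y"
  by (rule LipE[OF assms]) blast

lemma Lip_continuous: "f \<in> Lip_Omega A \<Longrightarrow> continuous_on \<Omega> f"
proof (erule LipE, rule continuous_on_d_locally)
  fix C x and e :: real
  assume C: "C > 0" "\<And>x y. x \<in> \<Omega> \<Longrightarrow> y \<in> \<Omega> \<Longrightarrow> \<bar>f x - f y\<bar> \<le> C * d x y" and x: "x \<in> \<Omega>" and e: "e > 0"
  have "dist (f x) (f y) < e" if "y \<in> \<Omega>" "d x y < e / C" for y
  proof -
    have "dist (f x) (f y) \<le> C * d x y" using C(2)[OF x that(1)] by (simp add: dist_real_def)
    also have "\<dots> < e" using that(2) C(1) by (simp add: field_simps)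
    finally show ?thesis .
  qed
  then show "\<exists>r>0. \<forall>y\<in>\<Omega>. d x y < r \<longrightarrow> dist (f x) (f y) < e"
    using C e by (intro exI[of _ "e / C"]) auto
qed

text \<open>For pairs at distance at least \<open>r\<close> the difference is bounded by
  \<open>2 * B\<close>, hence by \<open>2 * B / r\<close> times the distance.\<close>

lemma Lip_local:
  assumes r: "r > 0" and B: "\<And>x. x \<in> \<Omega> \<Longrightarrow> \<bar>f x\<bar> \<le> B"
    and C: "\<And>x y. x \<in> \<Omega> \<Longrightarrow> y \<in> \<Omega> \<Longrightarrow> d x y < r \<Longrightarrow> \<bar>f x - f y\<bar> \<le> C * d x y"
  shows "f \<in> Lip_Omega A"
proof (rule LipI)
  fix x y assume xy: "x \<in> \<Omega>" "y \<in> \<Omega>"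
  show "\<bar>f x - f y\<bar> \<le> max C (2 * B / r) * d x y"
  proof (cases "d x y < r")
    case True
    then show ?thesis
      using C[OF xy True] mult_right_mono[OF max.cobounded1[of C "2 * B / r"] d_nonneg[of x y]] by linarith
  next
    case False
    have "\<bar>f x - f y\<bar> \<le> 2 * B" using B[OF xy(1)] B[OF xy(2)] by linarith
    also have "\<dots> = 2 * B / r * r" using r by simp
    also have "\<dots> \<le> 2 * B / r * d x y"
      using False r B[OF xy(1)] by (intro mult_left_mono) auto
    also have "\<dots> \<le> max C (2 * B / r) * d x y" by (intro mult_right_mono d_nonneg) auto
    finally show ?thesis .
  qed
qed

lemma Lip_const: "(\<lambda>x. c) \<in> Lip_Omega A"
  by (rule LipI[of _ 0]) simp

lemma Lip_add: "f \<in> Lip_Omega A \<Longrightarrow> g \<in> Lip_Omega A \<Longrightarrow> (\<lambda>x. f x + g x) \<in> Lip_Omega A"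
proof (elim LipE)
  fix B C assume "\<And>x y. x \<in> \<Omega> \<Longrightarrow> y \<in> \<Omega> \<Longrightarrow> \<bar>f x - f y\<bar> \<le> B * d x y"
    "\<And>x y. x \<in> \<Omega> \<Longrightarrow> y \<in> \<Omega> \<Longrightarrow> \<bar>g x - g y\<bar> \<le> C * d x y"
  then show ?thesis by (intro LipI[of _ "B + C"]) (force simp: distrib_right)
qed

lemma Lip_mult:
  assumes f: "f \<in> Lip_Omega A" and g: "g \<in> Lip_Omega A" shows "(\<lambda>x. f x * g x) \<in> Lip_Omega A"
proof -
  obtain B where B: "\<forall>x\<in>\<Omega>. \<forall>y\<in>\<Omega>. \<bar>f x - f y\<bar> \<le> B * d x y" using LipD[OF f] by auto
  obtain C where C: "\<forall>x\<in>\<Omega>. \<forall>y\<in>\<Omega>. \<bar>g x - g y\<bar> \<le> C * d x y" using LipD[OF g] by auto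
  obtain F where F: "\<And>x. x \<in> \<Omega> \<Longrightarrow> \<bar>f x\<bar> \<le> F"
    using continuous_bounded[OF Lip_continuous[OF f]] by auto
  obtain G where G: "\<And>x. x \<in> \<Omega> \<Longrightarrow> \<bar>g x\<bar> \<le> G"
    using continuous_bounded[OF Lip_continuous[OF g]] by auto
  show ?thesis
  proof (rule LipI)
    fix x y assume xy: "x \<in> \<Omega>" "y \<in> \<Omega>"
    have "f x * g x - f y * g y = f x * (g x - g y) + (f x - f y) * g y" by (simp add: algebra_simps)
    then have "\<bar>f x * g x - f y * g y\<bar> \<le> \<bar>f x\<bar> * \<bar>g x - g y\<bar> + \<bar>f x - f y\<bar> * \<bar>g y\<bar>"
      using abs_triangle_ineq[of "f x * (g x - g y)" "(f x - f y) * g y"] by (simp add: abs_mult)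
    also have "\<dots> \<le> F * (C * d x y) + (B * d x y) * G"
      using F[OF xy(1)] G[OF xy(2)] B[rule_format, OF xy] C[rule_format, OF xy] by (intro add_mono mult_mono) linarith+
    finally show "\<bar>f x * g x - f y * g y\<bar> \<le> (F * C + B * G) * d x y" by (simp add: algebra_simps)
  qed
qed

lemma Lip_cmult: "f \<in> Lip_Omega A \<Longrightarrow> (\<lambda>x. c * f x) \<in> Lip_Omega A"
  by (rule Lip_mult[OF Lip_const])

lemma Lip_diff: "f \<in> Lip_Omega A \<Longrightarrow> g \<in> Lip_Omega A \<Longrightarrow> (\<lambda>x. f x - g x) \<in> Lip_Omega A"
  using Lip_add[of f, OF _ Lip_cmult[of g "-1"]] by simp

lemma Lip_comp:
  assumes f: "f \<in> Lip_Omega A" and h: "\<And>x. x \<in> \<Omega> \<Longrightarrow> f x \<in> S" "C-lipschitz_on S h"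
  shows "(\<lambda>x. h (f x)) \<in> Lip_Omega A"
proof -
  obtain B where B: "\<forall>x\<in>\<Omega>. \<forall>y\<in>\<Omega>. \<bar>f x - f y\<bar> \<le> B * d x y" using LipD[OF f] by auto
  show ?thesis
  proof (rule LipI)
    fix x y assume xy: "x \<in> \<Omega>" "y \<in> \<Omega>"
    have "\<bar>h (f x) - h (f y)\<bar> \<le> C * \<bar>f x - f y\<bar>"
      using lipschitz_onD[OF h(2) h(1)[OF xy(1)] h(1)[OF xy(2)]] by (simp add: dist_real_def)
    also have "\<dots> \<le> C * (B * d x y)" using B[rule_format, OF xy] lipschitz_on_nonneg[OF h(2)] by (rule mult_left_mono)
    finally show "\<bar>h (f x) - h (f y)\<bar> \<le> (C * B) * d x y" by (simp add: mult.assoc)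
  qed
qed

lemma Lip_ln:
  assumes f: "f \<in> Lip_Omega A" and pos: "\<And>x. x \<in> \<Omega> \<Longrightarrow> f x > 0" shows "(\<lambda>x. ln (f x)) \<in> Lip_Omega A"
proof -
  obtain c where c: "c > 0" "\<forall>x\<in>\<Omega>. c \<le> f x"
    using positive_bounded_below[OF Lip_continuous[OF f] pos] by auto
  have *: "ln a - ln b \<le> \<bar>a - b\<bar> / c" if "a \<ge> c" "b \<ge> c" for a b
  proof -
    have "ln a - ln b \<le> (a - b) / b" using that c(1) ln_diff_le[of a b] by simp
    also have "\<dots> \<le> \<bar>a - b\<bar> / b" using that c(1) by (intro divide_right_mono) auto
    also have "\<dots> \<le> \<bar>a - b\<bar> / c" using that c(1) by (intro divide_left_mono) auto
    finally show ?thesis .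
  qed
  have lip: "(1/c)-lipschitz_on {c..} ln"
  proof (rule lipschitz_onI)
    fix a b assume "a \<in> {c..}" "b \<in> {c..}"
    then show "dist (ln a) (ln b) \<le> 1 / c * dist a b"
      using *[of a b] *[of b a] by (simp add: dist_real_def abs_le_iff abs_minus_commute)
  qed (use c in auto)
  show ?thesis by (rule Lip_comp[OF f _ lip]) (use c(2) in auto)
qed

lemma Lip_inverse:
  assumes f: "f \<in> Lip_Omega A" and pos: "\<And>x. x \<in> \<Omega> \<Longrightarrow> f x > 0" shows "(\<lambda>x. inverse (f x)) \<in> Lip_Omega A"
proof -
  obtain c where c: "c > 0" "\<forall>x\<in>\<Omega>. c \<le> f x"
    using positive_bounded_below[OF Lip_continuous[OF f] pos] by auto
  have lip: "(1/c^2)-lipschitz_on {c..} inverse"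
  proof (rule lipschitz_onI)
    fix a b assume ab: "a \<in> {c..}" "b \<in> {c..}"
    then have "dist (inverse a) (inverse b) = \<bar>a - b\<bar> / (a * b)"
      using c(1) by (simp add: dist_real_def inverse_diff_inverse abs_mult field_simps)
    also have "\<dots> \<le> \<bar>a - b\<bar> / c^2"
      using ab c(1) by (intro divide_left_mono) (auto simp: power2_eq_square intro: mult_mono)
    finally show "dist (inverse a) (inverse b) \<le> 1 / c^2 * dist a b" by (simp add: dist_real_def)
  qed (use c in auto)
  show ?thesis by (rule Lip_comp[OF f _ lip]) (use c(2) in auto)
qed

lemma Lip_shift: "f \<in> Lip_Omega A \<Longrightarrow> (\<lambda>x. f (shift x)) \<in> Lip_Omega A"
proof (elim LipE)
  fix C assume C: "C > 0" "\<And>x y. x \<in> \<Omega> \<Longrightarrow> y \<in> \<Omega> \<Longrightarrow> \<bar>f x - f y\<bar> \<le> C * d x y"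
  show ?thesis
  proof (rule LipI)
    fix x y assume "x \<in> \<Omega>" "y \<in> \<Omega>"
    then have "\<bar>f (shift x) - f (shift y)\<bar> \<le> C * d (shift x) (shift y)" by (intro C shift_Omega)
    also have "\<dots> \<le> C * (2 * d x y)" using C(1) by (intro mult_left_mono d_shift) auto
    finally show "\<bar>f (shift x) - f (shift y)\<bar> \<le> (2 * C) * d x y" by simp
  qed
qed

lemma Lip_d: "d p \<in> Lip_Omega A"
proof (rule LipI[of _ 1])
  fix x y
  show "\<bar>d p x - d p y\<bar> \<le> 1 * d x y"
    using d_triangle[of p x y] d_triangle[of p y x] d_commute[of x y] by linarith
qed

text \<open>Stone-Weierstrass: Lipschitz functions form an algebra with constants, and
  \<open>d x\<close> separates \<open>x\<close> from every other point.\<close>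

lemma Lip_dense:
  fixes f :: "(nat \<Rightarrow> 'e) \<Rightarrow> real"
  assumes "continuous_on \<Omega> f" "e > 0" shows "\<exists>g\<in>Lip_Omega A. \<forall>x\<in>\<Omega>. \<bar>f x - g x\<bar> < e"
proof -
  interpret function_ring_on "Lip_Omega A" \<Omega>
  proof
    fix x y :: "nat \<Rightarrow> 'e" assume "x \<noteq> y"
    then show "\<exists>f\<in>Lip_Omega A. f x \<noteq> f y" using d_pos[of x y] Lip_d[of x] by (intro bexI[of _ "d x"]) auto
  qed (auto intro: compact_Omega Lip_continuous Lip_add Lip_mult Lip_const)
  show ?thesis using Stone_Weierstrass_basic assms by blast
qed

section \<open>Probability measures on the sequence space\<close>

lemma continuous_shift: "continuous_on S shift"
  unfolding shift_def
  by (intro continuous_on_coordinatewise_then_product continuous_on_subset[OF continuous_on_product_coordinates]) auto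

lemma continuous_on_shift_comp: "continuous_on \<Omega> f \<Longrightarrow> continuous_on \<Omega> (\<lambda>x. f (shift x))"
  by (rule continuous_on_compose2[OF _ continuous_shift]) (auto intro: shift_Omega)

lemma prob_OmegaD:
  assumes "\<mu> \<in> prob_Omega A"
  shows "prob_space \<mu>" "sets \<mu> = sets (restrict_space borel \<Omega>)" "space \<mu> = \<Omega>"
  using assms sets_eq_imp_space_eq[of \<mu> "restrict_space borel \<Omega>"]
  by (auto simp: prob_Omega_def space_restrict_space)

lemma measurable_continuous:
  fixes f :: "(nat \<Rightarrow> 'e) \<Rightarrow> 'b::{real_normed_vector, second_countable_topology}"
  assumes "\<mu> \<in> prob_Omega A" "continuous_on \<Omega> f" shows "f \<in> borel_measurable \<mu>"
  using borel_measurable_continuous_on_restrict[OF assms(2)] prob_OmegaD[OF assms(1)]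
  by (simp cong: measurable_cong_sets)

lemma integrable_continuous:
  fixes f :: "(nat \<Rightarrow> 'e) \<Rightarrow> 'b::{banach, second_countable_topology}"
  assumes "\<mu> \<in> prob_Omega A" "continuous_on \<Omega> f" shows "integrable \<mu> f"
proof -
  interpret prob_space \<mu> by (rule prob_OmegaD[OF assms(1)])
  obtain B where "\<forall>x\<in>\<Omega>. norm (f x) \<le> B" using continuous_bounded[OF assms(2)] by auto
  then show ?thesis
    by (intro integrable_const_bound[of _ B] measurable_continuous[OF assms])
      (auto simp: prob_OmegaD[OF assms(1)])
qed

text \<open>Uniform density reduces continuous test functions to Lipschitz ones, for which the
  estimates on \<open>T\<close> are available.\<close>

lemma prob_Omega_eqI:
  assumes \<mu>: "\<mu> \<in> prob_Omega A" and \<nu>: "\<nu> \<in> prob_Omega A"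
    and eq: "\<And>f. f \<in> Lip_Omega A \<Longrightarrow> (LINT x|\<mu>. f x) = (LINT x|\<nu>. f x)"
  shows "\<mu> = \<nu>"
proof (rule measure_eq_if_continuous_integrals_eq[OF Omega_borel prob_OmegaD(1)[OF \<mu>] prob_OmegaD(1)[OF \<nu>]
      prob_OmegaD(2)[OF \<mu>] prob_OmegaD(2)[OF \<nu>]])
  fix f :: "(nat \<Rightarrow> 'e) \<Rightarrow> real" assume f: "continuous_on \<Omega> f"
  interpret \<mu>: prob_space \<mu> by (rule prob_OmegaD[OF \<mu>])
  interpret \<nu>: prob_space \<nu> by (rule prob_OmegaD[OF \<nu>])
  have "\<bar>(LINT x|\<mu>. f x) - (LINT x|\<nu>. f x)\<bar> \<le> e" if "e > 0" for e
  proof -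
    obtain g where g: "g \<in> Lip_Omega A" "\<forall>x\<in>\<Omega>. \<bar>f x - g x\<bar> < e / 2"
      using Lip_dense[OF f, of "e / 2"] \<open>e > 0\<close> by auto
    have close: "\<bar>(LINT x|\<kappa>. f x) - (LINT x|\<kappa>. g x)\<bar> \<le> e / 2" if \<kappa>: "\<kappa> \<in> prob_Omega A" for \<kappa>
    proof -
      interpret prob_space \<kappa> by (rule prob_OmegaD[OF \<kappa>])
      note int = integrable_continuous[OF \<kappa> f] integrable_continuous[OF \<kappa> Lip_continuous[OF g(1)]]
      have "\<bar>LINT x|\<kappa>. f x - g x\<bar> \<le> (LINT x|\<kappa>. \<bar>f x - g x\<bar>)" by (rule integral_abs_bound)
      also have "\<dots> \<le> (LINT x|\<kappa>. e / 2)"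
        using g(2) int by (intro integral_mono) (auto simp: prob_OmegaD[OF \<kappa>] intro: less_imp_le)
      finally show ?thesis using int by (simp add: prob_space)
    qed
    show ?thesis using close[OF \<mu>] close[OF \<nu>] eq[OF g(1)] by linarith
  qed
  then have "\<bar>(LINT x|\<mu>. f x) - (LINT x|\<nu>. f x)\<bar> \<le> 0" by (metis add_0 field_le_epsilon)
  then show "(LINT x|\<mu>. f x) = (LINT x|\<nu>. f x)" by simp
qed

end

section \<open>The transfer operator\<close>

locale potential = shift_space \<rho> A for \<rho> :: "'e::metric_space measure" and A +
  fixes \<phi> :: "(nat \<Rightarrow> 'e) \<Rightarrow> real"
  assumes \<phi>_Lip: "\<phi> \<in> Lip_Omega A"
begin

abbreviation T :: "((nat \<Rightarrow> 'e) \<Rightarrow> 'b::{banach, second_countable_topology}) \<Rightarrow> (nat \<Rightarrow> 'e) \<Rightarrow> 'b"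
  where "T \<equiv> transfer \<rho> A \<phi>"

abbreviation integrand ::
    "((nat \<Rightarrow> 'e) \<Rightarrow> 'b::real_normed_vector) \<Rightarrow> (nat \<Rightarrow> 'e) \<Rightarrow> 'e \<Rightarrow> 'b"
  where "integrand f \<omega> t \<equiv> (exp (\<phi> (case_nat t \<omega>)) * A t (\<omega> 0)) *\<^sub>R f (case_nat t \<omega>)"

lemma \<phi>_continuous: "continuous_on \<Omega> \<phi>"
  by (rule Lip_continuous[OF \<phi>_Lip])

lemma A_cases: obtains "A a b = 0" | "A a b = 1"
  using A_01[of a b] by auto

lemma continuous_on_case_nat:
  assumes "continuous_on X s" "continuous_on X w"
  shows "continuous_on X (\<lambda>x. case_nat (s x) (w x) :: nat \<Rightarrow> 'e)"
proof (rule continuous_on_coordinatewise_then_product)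
  fix i :: nat
  show "continuous_on X (\<lambda>x. case_nat (s x) (w x) i)"
    using assms(1) continuous_on_product_then_coordinatewise[OF assms(2)] by (cases i) auto
qed

text \<open>A prefixed sequence may leave \<open>\<Omega>\<close>, where \<open>\<phi>\<close> and
  \<open>f\<close> are arbitrary. Since \<open>A\<close> is continuous with values 0 and 1, the
  domain splits into two relatively open pieces: on one the prefixed sequence stays in
  \<open>\<Omega>\<close>, on the other the integrand is 0. Prefix and tail may both vary, because
  measurability in the prefix and continuity in the tail are both needed.\<close>

lemma continuous_on_integrand:
  fixes f :: "(nat \<Rightarrow> 'e) \<Rightarrow> 'b::real_normed_vector"
  assumes s: "continuous_on X s" and w: "continuous_on X w" "\<And>x. x \<in> X \<Longrightarrow> w x \<in> \<Omega>"
    and f: "continuous_on \<Omega> f"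
  shows "continuous_on X (\<lambda>x. (exp (\<phi> (case_nat (s x) (w x))) * A (s x) (w x 0)) *\<^sub>R f (case_nat (s x) (w x)))"
    (is "continuous_on X ?h")
proof -
  have Ac: "continuous_on X (\<lambda>x. A (s x) (w x 0))"
    by (intro continuous_on_A s continuous_on_product_then_coordinatewise[OF w(1)])
  define P where "P = X \<inter> (\<lambda>x. A (s x) (w x 0)) -` {1/2<..}"
  define N where "N = X \<inter> (\<lambda>x. A (s x) (w x 0)) -` {..<1/2}"
  have X: "P \<union> N = X"
  proof -
    have "x \<in> P \<union> N" if "x \<in> X" for x
      using that by (cases rule: A_cases[of "s x" "w x 0"]) (auto simp: P_def N_def)
    moreover have "P \<subseteq> X" "N \<subseteq> X" by (auto simp: P_def N_def)
    ultimately show ?thesis by blast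
  qed
  have "openin (top_of_set X) P" "openin (top_of_set X) N"
    unfolding P_def N_def by (intro continuous_openin_preimage_gen Ac; simp)+
  moreover have "continuous_on P ?h"
  proof -
    have P: "P \<subseteq> X" by (auto simp: P_def)
    have "A (s x) (w x 0) = 1" if "x \<in> P" for x
      using that by (cases rule: A_cases[of "s x" "w x 0"]) (auto simp: P_def)
    then have PO: "case_nat (s x) (w x) \<in> \<Omega>" if "x \<in> P" for x
      using that P w(2) by (auto simp: case_nat_Omega)
    have c: "continuous_on P (\<lambda>x. case_nat (s x) (w x))"
      using P by (intro continuous_on_case_nat continuous_on_subset[OF s] continuous_on_subset[OF w(1)])
    show ?thesis
      by (intro continuous_intros continuous_on_subset[OF Ac P]
          continuous_on_compose2[OF \<phi>_continuous c] continuous_on_compose2[OF f c]) (auto intro: PO)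
  qed
  moreover have "continuous_on N ?h"
  proof -
    have "A (s x) (w x 0) = 0" if "x \<in> N" for x
      using that by (cases rule: A_cases[of "s x" "w x 0"]) (auto simp: N_def)
    then have "continuous_on N ?h \<longleftrightarrow> continuous_on N (\<lambda>x. 0 :: 'b)"
      by (intro continuous_on_cong) auto
    then show ?thesis by simp
  qed
  ultimately show ?thesis
    using continuous_on_Un_local_open[of P N ?h] by (simp add: X)
qed

lemma integrand_bound:
  fixes f :: "(nat \<Rightarrow> 'e) \<Rightarrow> 'b::real_normed_vector"
  assumes f: "continuous_on \<Omega> f"
  shows "\<exists>B. \<forall>\<omega>\<in>\<Omega>. \<forall>t. norm (integrand f \<omega> t) \<le> B"
proof -
  obtain F where F: "F > 0" "\<forall>x\<in>\<Omega>. norm (f x) \<le> F" using continuous_bounded[OF f] by auto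
  obtain P where P: "\<forall>x\<in>\<Omega>. norm (\<phi> x) \<le> P" using continuous_bounded[OF \<phi>_continuous] by auto
  have "norm (integrand f \<omega> t) \<le> exp P * F"
    if "\<omega> \<in> \<Omega>" for t \<omega>
  proof (cases rule: A_cases[of t "\<omega> 0"])
    case 2
    then have *: "case_nat t \<omega> \<in> \<Omega>" using that by (simp add: case_nat_Omega)
    have "\<phi> (case_nat t \<omega>) \<le> P" using bspec[OF P *] by simp
    then show ?thesis using 2 bspec[OF F(2) *] F(1) by (simp add: mult_mono)
  qed (use F in simp)
  then show ?thesis by blast
qed

lemma integrable_integrand:
  fixes f :: "(nat \<Rightarrow> 'e) \<Rightarrow> 'b::{banach, second_countable_topology}"
  assumes f: "continuous_on \<Omega> f" and \<omega>: "\<omega> \<in> \<Omega>"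
  shows "integrable \<rho> (\<lambda>t. integrand f \<omega> t)"
proof -
  interpret prob_space \<rho> by (rule prob_rho)
  obtain B where B: "\<forall>\<omega>\<in>\<Omega>. \<forall>t. norm (integrand f \<omega> t) \<le> B"
    using integrand_bound[OF f] by auto
  have "(\<lambda>t. integrand f \<omega> t) \<in> borel_measurable \<rho>"
    using borel_measurable_continuous_onI[OF continuous_on_integrand[of UNIV "\<lambda>t. t" "\<lambda>t. \<omega>", OF _ _ _ f]] \<omega>
    by (simp add: measurable_cong_sets[OF borel_rho refl])
  then show ?thesis using B \<omega> by (intro integrable_const_bound[of _ B]) auto
qed

lemma T_cong: "(\<And>x. x \<in> \<Omega> \<Longrightarrow> f x = g x) \<Longrightarrow> \<omega> \<in> \<Omega> \<Longrightarrow> T f \<omega> = T g \<omega>"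
  unfolding transfer_def
proof (rule Bochner_Integration.integral_cong[OF refl])
  fix t assume "\<And>x. x \<in> \<Omega> \<Longrightarrow> f x = g x" "\<omega> \<in> \<Omega>"
  then show "integrand f \<omega> t =
    integrand g \<omega> t"
    by (cases rule: A_cases[of t "\<omega> 0"]) (auto simp: case_nat_Omega)
qed

lemma T_add: "continuous_on \<Omega> f \<Longrightarrow> continuous_on \<Omega> g \<Longrightarrow> \<omega> \<in> \<Omega> \<Longrightarrow>
    T (\<lambda>x. f x + g x) \<omega> = T f \<omega> + T g \<omega>"
  unfolding transfer_def scaleR_add_right
  by (intro Bochner_Integration.integral_add integrable_integrand)

lemma T_diff: "continuous_on \<Omega> f \<Longrightarrow> continuous_on \<Omega> g \<Longrightarrow> \<omega> \<in> \<Omega> \<Longrightarrow>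
    T (\<lambda>x. f x - g x) \<omega> = T f \<omega> - T g \<omega>"
  unfolding transfer_def scaleR_diff_right
  by (intro Bochner_Integration.integral_diff integrable_integrand)

lemma T_cmult:
  fixes f :: "(nat \<Rightarrow> 'e) \<Rightarrow> real"
  shows "T (\<lambda>x. c * f x) \<omega> = c * T f \<omega>"
  unfolding transfer_def by (simp add: mult.left_commute[of _ c] mult.assoc)

lemma T_mono:
  fixes f :: "(nat \<Rightarrow> 'e) \<Rightarrow> real"
  assumes "continuous_on \<Omega> f" "continuous_on \<Omega> g" "\<omega> \<in> \<Omega>" "\<And>x. x \<in> \<Omega> \<Longrightarrow> f x \<le> g x"
  shows "T f \<omega> \<le> T g \<omega>"
  unfolding transfer_def
proof (rule integral_mono)
  fix t
  show "integrand f \<omega> t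
      \<le> integrand g \<omega> t"
    using assms by (cases rule: A_cases[of t "\<omega> 0"]) (auto simp: case_nat_Omega)
qed (intro integrable_integrand assms)+

lemma norm_T_le:
  fixes f :: "(nat \<Rightarrow> 'e) \<Rightarrow> 'b::{banach, second_countable_topology}"
  assumes "continuous_on \<Omega> f" "\<omega> \<in> \<Omega>"
  shows "norm (T f \<omega>) \<le> T (\<lambda>x. norm (f x)) \<omega>"
proof -
  have "norm (T f \<omega>) \<le> (LINT t|\<rho>. norm (integrand f \<omega> t))"
    unfolding transfer_def by (rule integral_norm_bound)
  also have "\<dots> = T (\<lambda>x. norm (f x)) \<omega>"
    unfolding transfer_def
  proof (rule Bochner_Integration.integral_cong[OF refl])
    fix t
    show "norm (integrand f \<omega> t) =
      (exp (\<phi> (case_nat t \<omega>)) * A t (\<omega> 0)) *\<^sub>R norm (f (case_nat t \<omega>))"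
      by (cases rule: A_cases[of t "\<omega> 0"]) auto
  qed
  finally show ?thesis .
qed

text \<open>Dominated convergence: the integrand is continuous in the base point for each fixed
  prefix, and \<open>integrand_bound\<close> is uniform in both.\<close>

lemma T_continuous:
  fixes f :: "(nat \<Rightarrow> 'e) \<Rightarrow> 'b::{banach, second_countable_topology}"
  assumes f: "continuous_on \<Omega> f"
  shows "continuous_on \<Omega> (T f)"
  unfolding continuous_on_sequentially
proof (intro allI ballI impI, elim conjE)
  fix x :: "nat \<Rightarrow> nat \<Rightarrow> 'e" and a
  assume a: "a \<in> \<Omega>" and x: "\<forall>n. x n \<in> \<Omega>" "x \<longlonglongrightarrow> a"
  interpret prob_space \<rho> by (rule prob_rho)
  obtain B where B: "\<forall>\<omega>\<in>\<Omega>. \<forall>t. norm (integrand f \<omega> t) \<le> B"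
    using integrand_bound[OF f] by auto
  have "(\<lambda>n. T f (x n)) \<longlonglongrightarrow> T f a"
    unfolding transfer_def
  proof (rule integral_dominated_convergence[where w="\<lambda>t. B"])
    show "AE t in \<rho>. (\<lambda>n. integrand f (x n) t)
        \<longlonglongrightarrow> integrand f a t"
    proof (rule AE_I2)
      fix t
      have "continuous_on \<Omega> (\<lambda>\<omega>. integrand f \<omega> t)"
        by (rule continuous_on_integrand) (auto intro: f continuous_intros)
      then show "(\<lambda>n. integrand f (x n) t)
        \<longlonglongrightarrow> integrand f a t"
        using a x unfolding continuous_on_sequentially by (auto simp: o_def)
    qed
  qed (use a x B integrable_integrand[OF f] in \<open>auto intro: borel_measurable_integrable\<close>)
  then show "(T f \<circ> x) \<longlonglongrightarrow> T f a" by (simp add: o_def)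
qed

text \<open>One admissible prefix with a positive value suffices: the integrand stays above half
  that value on an open set, and such a set has positive mass by full support.\<close>

lemma T_pos:
  fixes f :: "(nat \<Rightarrow> 'e) \<Rightarrow> real"
  assumes f: "continuous_on \<Omega> f" "\<And>x. x \<in> \<Omega> \<Longrightarrow> f x \<ge> 0" and \<omega>: "\<omega> \<in> \<Omega>"
    and s: "case_nat s \<omega> \<in> \<Omega>" "f (case_nat s \<omega>) > 0"
  shows "T f \<omega> > 0"
proof -
  interpret prob_space \<rho> by (rule prob_rho)
  define h where "h t = integrand f \<omega> t" for t
  have hc: "continuous_on UNIV h"
    unfolding h_def using \<omega> by (intro continuous_on_integrand f) auto
  have h0: "h t \<ge> 0" for t
    unfolding h_def using f(2) \<omega> by (cases rule: A_cases[of t "\<omega> 0"]) (auto simp: case_nat_Omega)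
  have hs: "h s > 0" using s \<omega> unfolding h_def by (simp add: case_nat_Omega)
  define U where "U = {t. h s / 2 < h t}"
  have U: "open U" "s \<in> U"
    unfolding U_def by (rule open_Collect_less[OF continuous_on_const hc]) (use hs in simp)
  then have "0 < h s / 2 * measure \<rho> U" using full_support[OF U(1)] hs by (intro mult_pos_pos) auto
  also have "\<dots> = (LINT t|\<rho>. h s / 2 * indicator U t)"
    using U by (simp add: sets_eq_imp_space_eq[OF borel_rho])
  also have "\<dots> \<le> (LINT t|\<rho>. h t)"
  proof (rule integral_mono)
    show "integrable \<rho> (\<lambda>t. h s / 2 * indicator U t)"
      using U by (intro integrable_mult_right integrable_real_indicator) (auto simp: borel_rho emeasure_eq_measure)
    show "integrable \<rho> h" unfolding h_def by (rule integrable_integrand[OF f(1) \<omega>])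
    fix t show "h s / 2 * indicator U t \<le> h t" using h0[of t] by (auto simp: U_def indicator_def)
  qed
  finally show ?thesis by (simp add: transfer_def h_def)
qed

section \<open>Iterates of the operator and positivity along orbits\<close>

lemma iter_continuous: "continuous_on \<Omega> f \<Longrightarrow> continuous_on \<Omega> ((T ^^ n) f)"
  by (induction n) (auto intro: T_continuous)

lemma iter_add:
  assumes "continuous_on \<Omega> f" "continuous_on \<Omega> g" "\<omega> \<in> \<Omega>"
  shows "(T ^^ n) (\<lambda>x. f x + g x) \<omega> = (T ^^ n) f \<omega> + (T ^^ n) g \<omega>"
  using assms(3)
proof (induction n arbitrary: \<omega>)
  case (Suc n)
  have "T ((T ^^ n) (\<lambda>x. f x + g x)) \<omega> = T (\<lambda>x. (T ^^ n) f x + (T ^^ n) g x) \<omega>"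
    using Suc by (intro T_cong) auto
  then show ?case using Suc.prems assms by (simp add: T_add iter_continuous)
qed simp

lemma iter_cmult:
  fixes f :: "(nat \<Rightarrow> 'e) \<Rightarrow> real"
  assumes "\<omega> \<in> \<Omega>"
  shows "(T ^^ n) (\<lambda>x. c * f x) \<omega> = c * (T ^^ n) f \<omega>"
  using assms
proof (induction n arbitrary: \<omega>)
  case (Suc n)
  have "T ((T ^^ n) (\<lambda>x. c * f x)) \<omega> = T (\<lambda>x. c * (T ^^ n) f x) \<omega>"
    using Suc by (intro T_cong) auto
  then show ?case by (simp add: T_cmult)
qed simp

lemma iter_diff:
  fixes f :: "(nat \<Rightarrow> 'e) \<Rightarrow> real"
  assumes "continuous_on \<Omega> f" "continuous_on \<Omega> g" "\<omega> \<in> \<Omega>"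
  shows "(T ^^ n) (\<lambda>x. f x - c * g x) \<omega> = (T ^^ n) f \<omega> - c * (T ^^ n) g \<omega>"
  using iter_add[OF assms(1) continuous_on_mult_left[OF assms(2), of "-c"] assms(3), of n]
    iter_cmult[OF assms(3), of n "-c" g] by simp

lemma iter_mono:
  fixes f :: "(nat \<Rightarrow> 'e) \<Rightarrow> real"
  assumes "continuous_on \<Omega> f" "continuous_on \<Omega> g" "\<And>x. x \<in> \<Omega> \<Longrightarrow> f x \<le> g x" "\<omega> \<in> \<Omega>"
  shows "(T ^^ n) f \<omega> \<le> (T ^^ n) g \<omega>"
  using assms(4)
  by (induction n arbitrary: \<omega>) (auto intro!: T_mono iter_continuous assms(1,2) intro: assms(3))

lemma iter_nonneg:
  fixes f :: "(nat \<Rightarrow> 'e) \<Rightarrow> real"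
  assumes "continuous_on \<Omega> f" "\<And>x. x \<in> \<Omega> \<Longrightarrow> f x \<ge> 0" "\<omega> \<in> \<Omega>"
  shows "(T ^^ n) f \<omega> \<ge> 0"
  using iter_mono[of "\<lambda>x. 0 * f x" f, OF _ assms(1) _ assms(3), of n] assms(2) iter_cmult[OF assms(3), of n 0 f]
  by simp

lemma funpow_shift: "(shift ^^ n) x = (\<lambda>i. x (i + n))"
  by (induction n) (auto simp: shift_def)

lemma funpow_shift_Omega: "x \<in> \<Omega> \<Longrightarrow> (shift ^^ n) x \<in> \<Omega>"
  by (induction n) (auto intro: shift_Omega)

text \<open>The point \<open>x\<close> is an n-fold preimage of its n-th shift, so positivity at
  \<open>x\<close> travels forward along the orbit, one application of \<open>T_pos\<close> per
  step.\<close>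

lemma iter_pos:
  fixes f :: "(nat \<Rightarrow> 'e) \<Rightarrow> real"
  assumes f: "continuous_on \<Omega> f" "\<And>x. x \<in> \<Omega> \<Longrightarrow> f x \<ge> 0" and x: "x \<in> \<Omega>" "f x > 0"
  shows "(T ^^ n) f ((shift ^^ n) x) > 0"
proof (induction n)
  case (Suc n)
  let ?y = "(shift ^^ n) x"
  have y: "?y \<in> \<Omega>" by (rule funpow_shift_Omega[OF x(1)])
  have "T ((T ^^ n) f) (shift ?y) > 0"
    by (rule T_pos[where s="?y 0"])
      (use y Suc in \<open>auto simp: case_nat_shift intro: iter_continuous iter_nonneg f shift_Omega\<close>)
  then show ?case by simp
qed (use x in simp)

lemma iter_one_pos:
  assumes "\<omega> \<in> \<Omega>" shows "(T ^^ n) (\<lambda>x. 1) \<omega> > (0::real)"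
proof -
  have "\<exists>x\<in>\<Omega>. (shift ^^ n) x = \<omega>"
  proof (induction n)
    case (Suc n)
    then obtain x where x: "x \<in> \<Omega>" "(shift ^^ n) x = \<omega>" by auto
    obtain s where "A s (x 0) = 1" using ex_pred by blast
    then have "case_nat s x \<in> \<Omega>" using x by (simp add: case_nat_Omega)
    moreover have "(shift ^^ Suc n) (case_nat s x) = \<omega>" using x by (simp add: funpow_swap1)
    ultimately show ?case by blast
  qed (use assms in auto)
  then show ?thesis using iter_pos[of "\<lambda>x. 1"] by auto
qed

end

section \<open>Contraction of a cone of log-Lipschitz functions\<close>

text \<open>Both differences vanish to first order at 0, with slopes 5 and 1, so their quotient
  stays bounded on bounded intervals.\<close>

lemma exp_quotient_bound:
  fixes v :: real
  assumes "v \<ge> 0" "v \<le> V"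
  shows "exp (3 * v) - exp (- 2 * v) \<le> 5 * exp (3 * V) * (exp (3 * v) - exp (2 * v))"
proof -
  have "exp (3 * v) - exp (- 2 * v) = exp (3 * v) * (1 - exp (- 5 * v))"
    by (simp add: right_diff_distrib exp_add[symmetric])
  also have "\<dots> \<le> exp (3 * v) * (5 * v)"
    using exp_ge_add_one_self[of "- 5 * v"] by (intro mult_left_mono) auto
  also have "\<dots> \<le> exp (3 * V) * (5 * v)" using assms by (intro mult_right_mono) auto
  also have "\<dots> = 5 * exp (3 * V) * v" by simp
  also have "\<dots> \<le> 5 * exp (3 * V) * (exp (3 * v) - exp (2 * v))"
  proof (intro mult_left_mono)
    have "v \<le> exp v - 1" using exp_ge_add_one_self[of v] by linarith
    also have "\<dots> \<le> exp (2 * v) * (exp v - 1)"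
      using assms mult_right_mono[of 1 "exp (2 * v)" "exp v - 1"] by simp
    also have "\<dots> = exp (3 * v) - exp (2 * v)" by (simp add: right_diff_distrib exp_add[symmetric])
    finally show "v \<le> exp (3 * v) - exp (2 * v)" .
  qed simp
  finally show ?thesis .
qed

context potential
begin

text \<open>Positivity is demanded even when \<open>\<phi>\<close> is constant, because
  \<open>Lip_cone\<close> divides by \<open>C\<close>. Choosing the constants once allows the cone
  and the contraction rate to be fixed objects of the locale.\<close>

definition C :: real where
  "C = (SOME C. C > 0 \<and> (\<forall>x\<in>\<Omega>. \<forall>y\<in>\<Omega>. \<bar>\<phi> x - \<phi> y\<bar> \<le> C * d x y))"

definition r :: real where
  "r = (SOME r. r > 0 \<and> (\<forall>x y t. d x y < r \<longrightarrow> A t (x 0) = A t (y 0)))"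

lemma C: "C > 0" "x \<in> \<Omega> \<Longrightarrow> y \<in> \<Omega> \<Longrightarrow> \<bar>\<phi> x - \<phi> y\<bar> \<le> C * d x y"
proof -
  have *: "C > 0 \<and> (\<forall>x\<in>\<Omega>. \<forall>y\<in>\<Omega>. \<bar>\<phi> x - \<phi> y\<bar> \<le> C * d x y)"
    unfolding C_def by (rule someI_ex[OF LipD[OF \<phi>_Lip]])
  show "C > 0" by (rule conjunct1[OF *])
  show "x \<in> \<Omega> \<Longrightarrow> y \<in> \<Omega> \<Longrightarrow> \<bar>\<phi> x - \<phi> y\<bar> \<le> C * d x y"
    by (rule conjunct2[OF *, rule_format])
qed

lemma r: "r > 0" "d x y < r \<Longrightarrow> A t (x 0) = A t (y 0)"
proof -
  have *: "r > 0 \<and> (\<forall>x y t. d x y < r \<longrightarrow> A t (x 0) = A t (y 0))"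
    unfolding r_def by (rule someI_ex[OF A_locally_const])
  show "r > 0" by (rule conjunct1[OF *])
  show "d x y < r \<Longrightarrow> A t (x 0) = A t (y 0)" by (rule conjunct2[OF *, rule_format])
qed

text \<open>A local Lipschitz condition on the logarithm, multiplied out so that functions with
  zeros are included; differences such as \<open>f - a * g\<close> with an optimal \<open>a\<close>
  do have zeros.\<close>

definition cone :: "real \<Rightarrow> ((nat \<Rightarrow> 'e) \<Rightarrow> real) \<Rightarrow> bool" where
  "cone K f \<longleftrightarrow> continuous_on \<Omega> f \<and> (\<forall>x\<in>\<Omega>. f x \<ge> 0) \<and>
     (\<forall>x\<in>\<Omega>. \<forall>y\<in>\<Omega>. d x y < r \<longrightarrow> f x \<le> exp (K * d x y) * f y)"

lemma coneD:
  assumes "cone K f"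
  shows "continuous_on \<Omega> f" "x \<in> \<Omega> \<Longrightarrow> f x \<ge> 0"
    "x \<in> \<Omega> \<Longrightarrow> y \<in> \<Omega> \<Longrightarrow> d x y < r \<Longrightarrow> f x \<le> exp (K * d x y) * f y"
  using assms unfolding cone_def by blast+

lemma cone_cong: "(\<And>x. x \<in> \<Omega> \<Longrightarrow> f x = g x) \<Longrightarrow> cone K f \<longleftrightarrow> cone K g"
  unfolding cone_def using continuous_on_cong[of \<Omega> \<Omega> f g] by auto

lemma coneI:
  assumes "continuous_on \<Omega> f" "\<And>x. x \<in> \<Omega> \<Longrightarrow> f x \<ge> 0"
    "\<And>x y. x \<in> \<Omega> \<Longrightarrow> y \<in> \<Omega> \<Longrightarrow> d x y < r \<Longrightarrow> f x \<le> exp (K * d x y) * f y"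
  shows "cone K f"
  using assms by (simp add: cone_def)

lemma cone_mono: assumes f: "cone K f" and K: "K \<le> K'" shows "cone K' f"
proof (rule coneI)
  fix x y assume xy: "x \<in> \<Omega>" "y \<in> \<Omega>" "d x y < r"
  have "f x \<le> exp (K * d x y) * f y" by (rule coneD(3)[OF f xy])
  also have "\<dots> \<le> exp (K' * d x y) * f y"
    using K d_nonneg[of x y] coneD(2)[OF f xy(2)] by (intro mult_right_mono) (simp_all add: mult_right_mono)
  finally show "f x \<le> exp (K' * d x y) * f y" .
qed (simp_all add: coneD(1,2)[OF f])

lemma cone_cmult: assumes f: "cone K f" and c: "c \<ge> 0" shows "cone K (\<lambda>x. c * f x)"
proof (rule coneI)
  fix x y assume "x \<in> \<Omega>" "y \<in> \<Omega>" "d x y < r"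
  then have "c * f x \<le> c * (exp (K * d x y) * f y)" by (intro mult_left_mono coneD(3)[OF f] c)
  then show "c * f x \<le> exp (K * d x y) * (c * f y)" by (simp only: mult_ac)
qed (simp_all add: continuous_on_mult_left coneD(1,2)[OF f] c)

lemma cone_one: assumes "K \<ge> 0" shows "cone K (\<lambda>x. 1)"
  by (rule coneI) (simp_all add: assms d_nonneg)

text \<open>Prefixing halves the distance, so \<open>\<phi>\<close> contributes \<open>C / 2\<close>
  and \<open>f\<close> contributes \<open>3 * C / 2\<close> to the new constant. Points closer than
  \<open>r\<close> admit the same prefixes, which makes the comparison possible under the
  integral.\<close>

lemma cone_transfer:
  assumes f: "cone (3 * C) f" shows "cone (2 * C) (T f)"
  unfolding cone_def
proof (intro conjI ballI impI)
  show "continuous_on \<Omega> (T f)" by (rule T_continuous[OF coneD(1)[OF f]])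
  show "T f x \<ge> 0" if "x \<in> \<Omega>" for x
    using iter_nonneg[OF coneD(1,2)[OF f] that, of 1] by simp
next
  fix x y assume xy: "x \<in> \<Omega>" "y \<in> \<Omega>" "d x y < r"
  have "T f x \<le> (LINT t|\<rho>. exp (2 * C * d x y) * (integrand f y t))"
    unfolding transfer_def
  proof (rule integral_mono)
    fix t
    let ?x = "case_nat t x" and ?y = "case_nat t y"
    have A: "A t (x 0) = A t (y 0)" by (rule r(2)[OF xy(3)])
    show "(exp (\<phi> ?x) * A t (x 0)) *\<^sub>R f ?x \<le> exp (2 * C * d x y) * ((exp (\<phi> ?y) * A t (y 0)) *\<^sub>R f ?y)"
    proof (cases rule: A_cases[of t "x 0"])
      case 2
      then have O: "?x \<in> \<Omega>" "?y \<in> \<Omega>" using A xy by (auto simp: case_nat_Omega)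
      have dd: "d ?x ?y = d x y / 2" by (rule d_case_nat)
      have "\<phi> ?x \<le> C * d x y / 2 + \<phi> ?y" using abs_le_D1[OF C(2)[OF O]] by (simp add: dd)
      then have 1: "exp (\<phi> ?x) \<le> exp (C * d x y / 2) * exp (\<phi> ?y)" by (simp add: exp_add[symmetric])
      have 2: "f ?x \<le> exp (3 * C * (d x y / 2)) * f ?y"
        using coneD(3)[OF f O] xy(3) d_nonneg[of x y] by (simp add: dd)
      have "exp (\<phi> ?x) * f ?x \<le> (exp (C * d x y / 2) * exp (\<phi> ?y)) * (exp (3 * C * (d x y / 2)) * f ?y)"
        by (intro mult_mono 1 2) (use coneD(2)[OF f] O in auto)
      also have "\<dots> = exp (C * d x y / 2 + 3 * C * (d x y / 2)) * (exp (\<phi> ?y) * f ?y)"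
        by (simp only: exp_add mult_ac)
      also have "C * d x y / 2 + 3 * C * (d x y / 2) = 2 * C * d x y" by simp
      finally show ?thesis using \<open>A t (x 0) = 1\<close> A by simp
    qed (use A in simp)
  qed (intro integrable_mult_right integrable_integrand coneD(1)[OF f] xy)+
  also have "\<dots> = exp (2 * C * d x y) * T f y" by (simp add: transfer_def)
  finally show "T f x \<le> exp (2 * C * d x y) * T f y" .
qed

lemma cone_3C: "cone (2 * C) f \<Longrightarrow> cone (3 * C) f"
  by (erule cone_mono) (use C(1) in simp)

lemma cone_iter: "cone (3 * C) f \<Longrightarrow> cone (3 * C) ((T ^^ n) f)"
  by (induction n) (simp_all add: cone_transfer cone_3C)

lemma cone_iter2: assumes "cone (3 * C) f" "n \<ge> 1" shows "cone (2 * C) ((T ^^ n) f)"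
proof -
  obtain k where "n = Suc k" using assms(2) by (cases n) auto
  then show ?thesis using cone_transfer[OF cone_iter[OF assms(1), of k]] by simp
qed

text \<open>The connecting point follows \<open>p\<close> long enough to be close to it, then a path
  of length \<open>N\<close>, then \<open>\<omega>\<close>. The number of steps depends only on the
  diameter bound, \<open>r\<close> and \<open>N\<close>, hence not on the two points.\<close>

lemma connect:
  "\<exists>M\<ge>1. \<forall>p\<in>\<Omega>. \<forall>\<omega>\<in>\<Omega>. \<exists>x\<in>\<Omega>. d p x < r / 2 \<and> (shift ^^ M) x = \<omega>"
proof -
  obtain D where D: "D > 0" "\<And>x y. d x y \<le> D" using d_le by blast
  obtain k :: nat where k: "2 * D / r < 2 ^ k" using real_arch_pow[of 2 "2 * D / r"] by auto
  obtain N where N: "N \<ge> 1" "\<And>a b. \<exists>z :: nat \<Rightarrow> 'e. z 0 = a \<and> z N = b \<and> (\<forall>i<N. A (z i) (z (Suc i)) = 1)"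
    using path by blast
  have "\<exists>x\<in>\<Omega>. d p x < r / 2 \<and> (shift ^^ (k + N)) x = \<omega>" if p: "p \<in> \<Omega>" and \<omega>: "\<omega> \<in> \<Omega>" for p \<omega>
  proof -
    obtain z :: "nat \<Rightarrow> 'e" where z: "z 0 = p k" "z N = \<omega> 0" "\<forall>i<N. A (z i) (z (Suc i)) = 1" using N(2) by blast
    \<comment> \<open>The pieces overlap at the indices \<open>k\<close> and \<open>k + N\<close>,
      where \<open>z 0 = p k\<close> and \<open>z N = \<omega> 0\<close>; hence \<open>x2\<close>
      may include both endpoints.\<close>
    define x where "x i = (if i \<le> k then p i else if i < k + N then z (i - k) else \<omega> (i - (k + N)))" for i
    have x1: "x i = p i" if "i \<le> k" for i using that by (simp add: x_def)
    have x2: "x i = z (i - k)" if "k \<le> i" "i \<le> k + N" for i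
      using that z N(1) by (cases "i = k"; cases "i = k + N") (auto simp: x_def)
    have x3: "x i = \<omega> (i - (k + N))" if "k + N \<le> i" for i using that N(1) by (simp add: x_def)
    have "x \<in> \<Omega>" unfolding Omega_iff
    proof
      fix i
      consider "i < k" | "k \<le> i" "i < k + N" | "k + N \<le> i" by linarith
      then show "A (x i) (x (Suc i)) = 1"
      proof cases
        case 1
        then show ?thesis using p by (simp add: x1 Omega_iff)
      next
        case 2
        then show ?thesis using z(3)[rule_format, of "i - k"] by (simp add: x2 Suc_diff_le)
      next
        case 3
        then show ?thesis using \<omega> by (simp add: x3 Omega_iff Suc_diff_le)
      qed
    qed
    moreover have "d p x \<le> D / 2 ^ Suc k"
      by (rule d_le_prefix[OF D(2)]) (simp add: x1)
    moreover have "D / 2 ^ Suc k < r / 2" using k r(1) D(1) by (simp add: field_simps)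
    moreover have "(shift ^^ (k + N)) x = \<omega>" by (auto simp: funpow_shift x3)
    ultimately show ?thesis by (intro bexI[of _ x] conjI) simp_all
  qed
  then show ?thesis using N(1) by (intro exI[of _ "k + N"]) auto
qed

text \<open>By mixing, mass near a maximum point of \<open>f\<close> spreads over the whole space after finitely many
  steps; compactness makes the bound uniform.\<close>

definition harnack_bound :: "nat \<Rightarrow> real \<Rightarrow> bool" where
  "harnack_bound M R \<longleftrightarrow> M \<ge> 1 \<and> R \<ge> 1 \<and>
     (\<forall>f. cone (3 * C) f \<longrightarrow> (\<forall>x\<in>\<Omega>. \<forall>y\<in>\<Omega>. (T ^^ M) f x \<le> R * (T ^^ M) f y))"

lemma harnack: "\<exists>M R. harnack_bound M R"
proof -
  obtain M where M: "M \<ge> 1" "\<And>p \<omega>. p \<in> \<Omega> \<Longrightarrow> \<omega> \<in> \<Omega> \<Longrightarrow> \<exists>x\<in>\<Omega>. d p x < r / 2 \<and> (shift ^^ M) x = \<omega>"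
    using connect by blast
  \<comment> \<open>A tent of radius \<open>r / 2\<close>. Two points in this ball are less than
    \<open>r\<close> apart, so the cone inequality bounds \<open>f\<close> on the support of the
    tent by its value at a maximum point \<open>q\<close> in the same ball.\<close>
  define h where "h p x = max 0 (1 - 2 / r * d p x)" for p x
  have hc: "continuous_on \<Omega> (h p)" for p
    unfolding h_def by (intro continuous_intros Lip_continuous[OF Lip_d])
  have h0: "h p x \<ge> 0" for p x by (simp add: h_def)
  have "\<exists>c>0. \<forall>\<omega>\<in>\<Omega>. c \<le> (T ^^ M) (h p) \<omega>" if p: "p \<in> \<Omega>" for p
  proof (rule positive_bounded_below[OF iter_continuous[OF hc]])
    fix \<omega> assume \<omega>: "\<omega> \<in> \<Omega>"
    obtain x where x: "x \<in> \<Omega>" "d p x < r / 2" "(shift ^^ M) x = \<omega>" using M(2)[OF p \<omega>] by auto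
    have "h p x > 0" using x(2) r(1) by (simp add: h_def field_simps)
    then show "(T ^^ M) (h p) \<omega> > 0" using iter_pos[OF hc h0 x(1), of p M] x(3) by simp
  qed
  then obtain c where c: "\<And>p. p \<in> \<Omega> \<Longrightarrow> c p > 0" "\<And>p \<omega>. p \<in> \<Omega> \<Longrightarrow> \<omega> \<in> \<Omega> \<Longrightarrow> c p \<le> (T ^^ M) (h p) \<omega>"
    by metis
  have cov: "\<Omega> \<subseteq> (\<Union>p\<in>\<Omega>. {y. d p y < r / 2})" using r(1) by force
  obtain P where P: "P \<subseteq> \<Omega>" "finite P" "\<Omega> \<subseteq> (\<Union>p\<in>P. {y. d p y < r / 2})"
    by (rule compactE_image[OF compact_Omega open_d_ball cov])
  have "P \<noteq> {}" using P(3) Omega_nonempty by auto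
  define c0 where "c0 = Min (c ` P)"
  have c0: "c0 > 0" "\<And>p. p \<in> P \<Longrightarrow> c0 \<le> c p"
    unfolding c0_def using P \<open>P \<noteq> {}\<close> c(1) by (auto simp: subset_iff)
  obtain S where S: "S > 0" "\<forall>x\<in>\<Omega>. norm ((T ^^ M) (\<lambda>x. 1) x :: real) \<le> S"
    using continuous_bounded[OF iter_continuous[OF continuous_on_const[of \<Omega> "1::real"]]] by blast
  define E where "E = exp (3 * C * r)"
  have E: "E > 0" by (simp add: E_def)
  \<comment> \<open>The maximum \<open>f q\<close> gives the upper bound \<open>f q * S\<close> and
    the lower bound \<open>f q / E * c0\<close>; \<open>R\<close> dominates their quotient.\<close>
  define R where "R = max 1 (S * E / c0)"
  have "(T ^^ M) f x \<le> R * (T ^^ M) f y" if f: "cone (3 * C) f" and xy: "x \<in> \<Omega>" "y \<in> \<Omega>" for f x y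
  proof -
    note fc = coneD(1)[OF f]
    obtain q where q: "q \<in> \<Omega>" "\<And>x. x \<in> \<Omega> \<Longrightarrow> f x \<le> f q"
      using continuous_attains_sup[OF compact_Omega Omega_nonempty fc] by auto
    have fq: "f q \<ge> 0" by (rule coneD(2)[OF f q(1)])
    have "(T ^^ M) f x \<le> (T ^^ M) (\<lambda>x. f q * 1) x"
      using q xy by (intro iter_mono fc) auto
    also have "\<dots> = f q * (T ^^ M) (\<lambda>x. 1) x" by (rule iter_cmult[OF xy(1)])
    also have "\<dots> \<le> f q * S" using S(2) xy(1) fq by (intro mult_left_mono) (auto simp: abs_le_iff)
    finally have upper: "(T ^^ M) f x \<le> f q * S" .
    obtain p where p: "p \<in> P" "d p q < r / 2" using P(3) q(1) by auto
    have pO: "p \<in> \<Omega>" using p P by auto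
    have "f q / E * h p z \<le> f z" if z: "z \<in> \<Omega>" for z
    proof (cases "d p z < r / 2")
      case True
      have dqz: "d q z < r" using d_triangle[of q z p] p(2) True d_commute[of p q] by linarith
      have "f q \<le> exp (3 * C * d q z) * f z" by (rule coneD(3)[OF f q(1) z dqz])
      also have "\<dots> \<le> E * f z"
        using dqz C(1) coneD(2)[OF f z] by (auto simp: E_def intro!: mult_right_mono)
      finally have *: "f q / E \<le> f z" using E by (simp add: field_simps)
      have "f q / E * h p z \<le> f q / E * 1"
        using fq E r(1) d_nonneg[of p z] by (intro mult_left_mono) (auto simp: h_def)
      then show ?thesis using * by simp
    next
      case False
      then have "h p z = 0" using r(1) by (simp add: h_def field_simps)
      then show ?thesis using coneD(2)[OF f z] by simp
    qed
    then have "(T ^^ M) (\<lambda>z. f q / E * h p z) y \<le> (T ^^ M) f y"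
      using xy by (intro iter_mono fc continuous_on_mult_left hc) auto
    then have "f q / E * (T ^^ M) (h p) y \<le> (T ^^ M) f y" unfolding iter_cmult[OF xy(2)] .
    moreover have "f q / E * c0 \<le> f q / E * (T ^^ M) (h p) y"
      using c0(2)[OF p(1)] c(2)[OF pO xy(2)] fq E by (intro mult_left_mono) auto
    ultimately have lower: "f q / E * c0 \<le> (T ^^ M) f y" by linarith
    have "f q * S = S * E / c0 * (f q / E * c0)" using E c0(1) by simp
    also have "\<dots> \<le> R * (T ^^ M) f y"
      using lower fq E c0(1) S(1) by (intro mult_mono) (auto simp: R_def)
    finally show ?thesis using upper by linarith
  qed
  moreover have "R \<ge> 1" by (simp add: R_def)
  ultimately show ?thesis using M(1) unfolding harnack_bound_def by (intro exI[of _ M] exI[of _ R]) auto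
qed

section \<open>The contraction constants and one contraction step\<close>

definition M :: nat where "M = (SOME M. \<exists>R. harnack_bound M R)"

definition R :: real where "R = (SOME R. harnack_bound M R)"

lemma MR: "M \<ge> 1" "R \<ge> 1"
  "cone (3 * C) f \<Longrightarrow> x \<in> \<Omega> \<Longrightarrow> y \<in> \<Omega> \<Longrightarrow> (T ^^ M) f x \<le> R * (T ^^ M) f y"
proof -
  have "\<exists>R. harnack_bound M R" unfolding M_def by (rule someI_ex[of "\<lambda>M. \<exists>R. harnack_bound M R", OF harnack])
  then have "harnack_bound M R" unfolding R_def by (rule someI_ex[of "harnack_bound M"])
  then show "M \<ge> 1" "R \<ge> 1"
    "cone (3 * C) f \<Longrightarrow> x \<in> \<Omega> \<Longrightarrow> y \<in> \<Omega> \<Longrightarrow> (T ^^ M) f x \<le> R * (T ^^ M) f y"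
    unfolding harnack_bound_def by blast+
qed

text \<open>The constant of \<open>exp_quotient_bound\<close> for \<open>v = C * d x y\<close> with
  \<open>d x y < r\<close>.\<close>

definition B :: real where "B = 5 * exp (3 * (C * r))"

text \<open>Chosen so that \<open>2 * \<eta> * s\<close> is \<open>s / (R\<^sup>2 * B)\<close>:
  moving an inequality from one point to all others uses the Harnack constant once for each
  function, and \<open>B\<close> pays for the loss of regularity in the subtraction.\<close>

definition \<eta> :: real where "\<eta> = 1 / (2 * R\<^sup>2 * B)"

lemma B: "B \<ge> 1"
proof -
  have "exp (3 * (C * r)) \<ge> 1" using C(1) r(1) by simp
  then show ?thesis unfolding B_def by linarith
qed

lemma \<eta>: "0 < \<eta>" "\<eta> \<le> 1 / 2"
proof -
  have "R\<^sup>2 * B \<ge> 1"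
    using MR(2) B mult_mono[of 1 "R\<^sup>2" 1 B] by (simp add: one_le_power)
  then show "0 < \<eta>" "\<eta> \<le> 1 / 2" by (auto simp: \<eta>_def field_simps)
qed

text \<open>The difference quotient bound \<open>exp_quotient_bound\<close> leaves room between the Lipschitz constants \<open>2 C\<close>
  and \<open>3 C\<close>: a small multiple of \<open>H\<close> can be subtracted from \<open>F\<close> without leaving the larger cone.\<close>

lemma cone_subtract:
  assumes F: "cone (2 * C) F" "\<And>x y. x \<in> \<Omega> \<Longrightarrow> y \<in> \<Omega> \<Longrightarrow> F x \<le> R * F y"
    and H: "cone (2 * C) H" "\<And>x y. x \<in> \<Omega> \<Longrightarrow> y \<in> \<Omega> \<Longrightarrow> H x \<le> R * H y"
    and x0: "x0 \<in> \<Omega>" "s * H x0 \<le> F x0" "s \<ge> 0"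
  shows "cone (3 * C) (\<lambda>x. F x - 2 * \<eta> * s * H x)"
proof -
  define \<sigma> where "\<sigma> = 2 * \<eta> * s"
  have \<sigma>0: "\<sigma> \<ge> 0" using \<eta>(1) x0(3) by (simp add: \<sigma>_def)
  have R0: "R > 0" "B > 0" using MR(2) B by auto
  \<comment> \<open>The comparison at the single point \<open>x0\<close> spreads to all points
    through the Harnack inequalities for \<open>H\<close> and \<open>F\<close>, at the cost of
    \<open>R\<^sup>2\<close>.\<close>
  have FH: "\<sigma> * B * H x \<le> F x" if x: "x \<in> \<Omega>" for x
  proof -
    have "\<sigma> * B * H x = s * H x / R\<^sup>2" using R0 by (simp add: \<sigma>_def \<eta>_def)
    also have "\<dots> \<le> s * (R * H x0) / R\<^sup>2" using H(2)[OF x x0(1)] x0(3) R0 by (intro divide_right_mono mult_left_mono) auto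
    also have "\<dots> = s * H x0 / R" using R0 by (simp add: power2_eq_square)
    also have "\<dots> \<le> F x0 / R" using x0(2) R0 by (intro divide_right_mono) auto
    also have "\<dots> \<le> F x" using F(2)[OF x0(1) x] R0 by (simp add: field_simps)
    finally show ?thesis .
  qed
  have Hle: "H x \<le> B * H x" if "x \<in> \<Omega>" for x
    using mult_right_mono[OF B coneD(2)[OF H(1) that]] by simp
  have "cone (3 * C) (\<lambda>x. F x - \<sigma> * H x)"
    unfolding cone_def
  proof (intro conjI ballI impI)
    show "continuous_on \<Omega> (\<lambda>x. F x - \<sigma> * H x)"
      by (intro continuous_intros coneD(1)[OF F(1)] coneD(1)[OF H(1)])
    fix x assume x: "x \<in> \<Omega>"
    show "0 \<le> F x - \<sigma> * H x"
      using FH[OF x] mult_left_mono[OF Hle[OF x] \<sigma>0] by (simp add: mult.assoc)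
    fix y assume y: "y \<in> \<Omega>" and dxy: "d x y < r"
    define v where "v = C * d x y"
    have v: "v \<ge> 0" "v \<le> C * r" using C(1) d_nonneg[of x y] dxy by (auto simp: v_def)
    have "\<sigma> * H y * (exp (3 * v) - exp (- 2 * v)) \<le> \<sigma> * H y * (B * (exp (3 * v) - exp (2 * v)))"
      using exp_quotient_bound[OF v] coneD(2)[OF H(1) y] \<sigma>0 by (intro mult_left_mono) (auto simp: B_def)
    also have "\<dots> = \<sigma> * B * H y * (exp (3 * v) - exp (2 * v))" by simp
    also have "\<dots> \<le> F y * (exp (3 * v) - exp (2 * v))"
      using FH[OF y] v by (intro mult_right_mono) auto
    \<comment> \<open>The left side is the worst case allowed by the constant \<open>2 * C\<close>
      for both functions, with \<open>F\<close> as large and \<open>H\<close> as small as possible;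
      the right side is what the constant \<open>3 * C\<close> requires.\<close>
    finally have 1: "exp (2 * v) * F y - \<sigma> * (exp (- 2 * v) * H y) \<le> exp (3 * v) * (F y - \<sigma> * H y)"
      by (simp add: algebra_simps)
    have "F x \<le> exp (2 * v) * F y" using coneD(3)[OF F(1) x y dxy] by (simp add: v_def mult.assoc)
    moreover have "exp (- 2 * v) * H y \<le> H x"
    proof -
      have "H y \<le> exp (2 * v) * H x"
        using coneD(3)[OF H(1) y x] dxy d_commute[of x y] by (simp add: v_def mult.assoc)
      then have "exp (- 2 * v) * H y \<le> exp (- 2 * v) * (exp (2 * v) * H x)" by (rule mult_left_mono) simp
      then show ?thesis by (simp add: mult.assoc[symmetric] exp_add[symmetric])
    qed
    then have "\<sigma> * (exp (- 2 * v) * H y) \<le> \<sigma> * H x" using \<sigma>0 by (rule mult_left_mono)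
    ultimately have "F x - \<sigma> * H x \<le> exp (3 * v) * (F y - \<sigma> * H y)" using 1 by linarith
    then show "F x - \<sigma> * H x \<le> exp (3 * C * d x y) * (F y - \<sigma> * H y)" by (simp add: v_def mult.assoc)
  qed
  then show ?thesis by (simp add: \<sigma>_def)
qed

text \<open>A Birkhoff contraction with an explicit rate. The function \<open>f\<close> lies between
  \<open>a * g\<close> and \<open>b * g\<close> in the cone order, and after \<open>M\<close> steps
  a definite share of the gap can be removed on one side.\<close>

lemma contraction_step:
  assumes f: "continuous_on \<Omega> f" and g: "cone (3 * C) g" "\<And>x. x \<in> \<Omega> \<Longrightarrow> g x > 0"
    and a: "cone (3 * C) (\<lambda>x. f x - a * g x)" and b: "cone (3 * C) (\<lambda>x. b * g x - f x)"
  shows "\<exists>a' b'. b' - a' \<le> (1 - \<eta>) * (b - a) \<and>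
    cone (3 * C) (\<lambda>x. (T ^^ M) f x - a' * (T ^^ M) g x) \<and>
    cone (3 * C) (\<lambda>x. b' * (T ^^ M) g x - (T ^^ M) f x)"
proof -
  let ?Q = "T ^^ M"
  note gc = coneD(1)[OF g(1)]
  have Fa: "?Q (\<lambda>x. f x - a * g x) x = ?Q f x - a * ?Q g x" if "x \<in> \<Omega>" for x
    by (rule iter_diff[OF f gc that])
  have Fb: "?Q (\<lambda>x. b * g x - f x) x = b * ?Q g x - ?Q f x" if "x \<in> \<Omega>" for x
    using iter_diff[OF continuous_on_mult_left[OF gc] f that, of M b 1] iter_cmult[OF that, of M b g] by simp
  have ca: "cone (2 * C) (\<lambda>x. ?Q f x - a * ?Q g x)"
    by (rule iffD1[OF cone_cong[OF Fa] cone_iter2[OF a MR(1)]])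
  have cb: "cone (2 * C) (\<lambda>x. b * ?Q g x - ?Q f x)"
    by (rule iffD1[OF cone_cong[OF Fb] cone_iter2[OF b MR(1)]])
  have ha: "?Q f x - a * ?Q g x \<le> R * (?Q f y - a * ?Q g y)" if "x \<in> \<Omega>" "y \<in> \<Omega>" for x y
    using MR(3)[OF a that] Fa that by simp
  have hb: "b * ?Q g x - ?Q f x \<le> R * (b * ?Q g y - ?Q f y)" if "x \<in> \<Omega>" "y \<in> \<Omega>" for x y
    using MR(3)[OF b that] Fb that by simp
  note cg = cone_iter2[OF g(1) MR(1)] and hg = MR(3)[OF g(1)]
  obtain x0 where x0: "x0 \<in> \<Omega>" using Omega_nonempty by auto
  have "0 \<le> (f x0 - a * g x0) + (b * g x0 - f x0)"
    using coneD(2)[OF a x0] coneD(2)[OF b x0] by simp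
  then have "0 \<le> (b - a) * g x0" by (simp add: algebra_simps)
  then have ba: "b - a \<ge> 0" using g(2)[OF x0] by (simp add: zero_le_mult_iff)
  \<comment> \<open>The two gaps at \<open>x0\<close> add up to \<open>(b - a) * ?Q g x0\<close>, so
    one of them is at least half of it. This decides which bound moves, and the half cancels the
    factor 2 in \<open>cone_subtract\<close>.\<close>
  have "(?Q f x0 - a * ?Q g x0) + (b * ?Q g x0 - ?Q f x0) = (b - a) / 2 * ?Q g x0 + (b - a) / 2 * ?Q g x0"
    by (simp add: left_diff_distrib add_divide_distrib[symmetric])
  then have "(b - a) / 2 * ?Q g x0 \<le> ?Q f x0 - a * ?Q g x0 \<or> (b - a) / 2 * ?Q g x0 \<le> b * ?Q g x0 - ?Q f x0"
    by linarith
  then show ?thesis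
  proof
    assume "(b - a) / 2 * ?Q g x0 \<le> ?Q f x0 - a * ?Q g x0"
    then have "cone (3 * C) (\<lambda>x. (?Q f x - a * ?Q g x) - 2 * \<eta> * ((b - a) / 2) * ?Q g x)"
      using ba by (intro cone_subtract[OF ca ha cg hg x0]) auto
    then have "cone (3 * C) (\<lambda>x. ?Q f x - (a + \<eta> * (b - a)) * ?Q g x)"
      by (rule cone_cong[THEN iffD1, rotated]) (simp add: field_simps)
    then show ?thesis using cone_3C[OF cb]
      by (intro exI[of _ "a + \<eta> * (b - a)"] exI[of _ b]) (auto simp: algebra_simps)
  next
    assume "(b - a) / 2 * ?Q g x0 \<le> b * ?Q g x0 - ?Q f x0"
    then have "cone (3 * C) (\<lambda>x. (b * ?Q g x - ?Q f x) - 2 * \<eta> * ((b - a) / 2) * ?Q g x)"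
      using ba by (intro cone_subtract[OF cb hb cg hg x0]) auto
    then have "cone (3 * C) (\<lambda>x. (b - \<eta> * (b - a)) * ?Q g x - ?Q f x)"
      by (rule cone_cong[THEN iffD1, rotated]) (simp add: field_simps)
    then show ?thesis using cone_3C[OF ca]
      by (intro exI[of _ a] exI[of _ "b - \<eta> * (b - a)"]) (auto simp: algebra_simps)
  qed
qed

text \<open>This supplies the initial upper bound. Subtracting from \<open>2 * S\<close> rather than
  from \<open>S\<close> keeps the difference at least \<open>S\<close>, whereas \<open>S - f\<close>
  might vanish and leave no control of its logarithm.\<close>

lemma cone_upper_diff:
  assumes f: "cone (3 * C) f" "\<And>x. x \<in> \<Omega> \<Longrightarrow> f x \<le> S"
  shows "cone (3 * C) (\<lambda>x. 2 * S - f x)"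
  unfolding cone_def
proof (intro conjI ballI impI)
  show "continuous_on \<Omega> (\<lambda>x. 2 * S - f x)" by (intro continuous_intros coneD(1)[OF f(1)])
  fix x assume x: "x \<in> \<Omega>"
  have S0: "0 \<le> S" using f(2)[OF x] coneD(2)[OF f(1) x] by linarith
  show "0 \<le> 2 * S - f x" using f(2)[OF x] S0 by linarith
  fix y assume y: "y \<in> \<Omega>" and dxy: "d x y < r"
  define e where "e = exp (3 * C * d x y)"
  have e: "e \<ge> 1" using C(1) d_nonneg[of x y] by (simp add: e_def)
  have "f y \<le> e * f x" using coneD(3)[OF f(1) y x] dxy d_commute[of x y] by (simp add: e_def)
  then have "f y / e \<le> f x" using e by (simp add: field_simps)
  moreover have "f y * (e - 1 / e) \<le> S * (2 * (e - 1))"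
  proof (rule mult_mono[OF f(2)[OF y] _ S0])
    \<comment> \<open>The square is exactly the deficit in
      \<open>e - 1 / e \<le> 2 * (e - 1)\<close>.\<close>
    have "0 \<le> (e - 1) * (e - 1) / e" using e by simp
    also have "\<dots> = 2 * (e - 1) - (e - 1 / e)" using e by (simp add: field_simps)
    finally show "e - 1 / e \<le> 2 * (e - 1)" by simp
    have "1 / e \<le> 1" using e by simp
    then show "0 \<le> e - 1 / e" using e by linarith
  qed
  ultimately have "2 * S - f x \<le> e * (2 * S - f y)" by (simp add: algebra_simps)
  then show "2 * S - f x \<le> exp (3 * C * d x y) * (2 * S - f y)" by (simp add: e_def)
qed

lemma contraction_iter:
  assumes f: "cone (3 * C) f" "\<And>x. x \<in> \<Omega> \<Longrightarrow> f x \<le> S"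
  shows "\<exists>a b. b - a \<le> (1 - \<eta>) ^ n * (2 * S) \<and>
    cone (3 * C) (\<lambda>x. (T ^^ (M * n)) f x - a * (T ^^ (M * n)) (\<lambda>x. 1) x) \<and>
    cone (3 * C) (\<lambda>x. b * (T ^^ (M * n)) (\<lambda>x. 1) x - (T ^^ (M * n)) f x)"
proof (induction n)
  case 0
  show ?case using f(1) cone_upper_diff[OF f] by (intro exI[of _ 0] exI[of _ "2 * S"]) simp
next
  case (Suc n)
  let ?f = "(T ^^ (M * n)) f" and ?g = "(T ^^ (M * n)) (\<lambda>x. 1 :: real)"
  obtain a b where ab: "b - a \<le> (1 - \<eta>) ^ n * (2 * S)"
    "cone (3 * C) (\<lambda>x. ?f x - a * ?g x)" "cone (3 * C) (\<lambda>x. b * ?g x - ?f x)" using Suc.IH by (elim exE conjE) (rule that)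
  have "cone (3 * C) ?g" using cone_iter[OF cone_one] C(1) by simp
  have "\<exists>a' b'. b' - a' \<le> (1 - \<eta>) * (b - a) \<and>
    cone (3 * C) (\<lambda>x. (T ^^ M) ?f x - a' * (T ^^ M) ?g x) \<and>
    cone (3 * C) (\<lambda>x. b' * (T ^^ M) ?g x - (T ^^ M) ?f x)"
    by (rule contraction_step[OF iter_continuous[OF coneD(1)[OF f(1)]] \<open>cone (3 * C) ?g\<close> _ ab(2,3)])
      (rule iter_one_pos)
  then obtain a' b' where ab': "b' - a' \<le> (1 - \<eta>) * (b - a)"
    "cone (3 * C) (\<lambda>x. (T ^^ M) ?f x - a' * (T ^^ M) ?g x)"
    "cone (3 * C) (\<lambda>x. b' * (T ^^ M) ?g x - (T ^^ M) ?f x)" by (elim exE conjE) (rule that)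
  have "b' - a' \<le> (1 - \<eta>) * ((1 - \<eta>) ^ n * (2 * S))"
    using ab'(1) mult_left_mono[OF ab(1), of "1 - \<eta>"] \<eta> by linarith
  moreover have "(T ^^ (M * Suc n)) h = (T ^^ M) ((T ^^ (M * n)) h)" for h :: "_ \<Rightarrow> real"
    by (simp add: funpow_add)
  ultimately show ?case using ab' by (intro exI[of _ a'] exI[of _ b']) (simp add: mult.assoc)
qed

section \<open>Uniform convergence of ratios of iterates\<close>

definition \<epsilon> :: "nat \<Rightarrow> real" where "\<epsilon> k = (1 - \<eta>) ^ (k div M)"

lemma \<epsilon>_tendsto: "\<epsilon> \<longlonglongrightarrow> 0"
proof -
  have "filterlim (\<lambda>k. k div M) at_top at_top"
    unfolding filterlim_at_top
  proof (intro allI)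
    fix Z :: nat
    have "Z \<le> k div M" if "k \<ge> Z * M" for k using that MR(1) by (simp add: less_eq_div_iff_mult_less_eq)
    then show "\<forall>\<^sub>F k in sequentially. Z \<le> k div M" by (auto simp: eventually_sequentially)
  qed
  moreover have "(\<lambda>n. (1 - \<eta>) ^ n) \<longlonglongrightarrow> 0" using \<eta> by (intro LIMSEQ_power_zero) auto
  ultimately show ?thesis unfolding \<epsilon>_def by (rule filterlim_compose[rotated])
qed

lemma \<epsilon>_nonneg: "\<epsilon> k \<ge> 0"
  unfolding \<epsilon>_def using \<eta> by (intro zero_le_power) simp

text \<open>The n-th bracketing interval contains all ratios from time \<open>M * n\<close> on, at
  every point, and its length decays geometrically. Thus one constant is the limit everywhere, with
  a rate independent of \<open>f\<close> apart from the bound \<open>S\<close>.\<close>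

lemma cone_ratio_limit:
  assumes f: "cone (3 * C) f" "\<And>x. x \<in> \<Omega> \<Longrightarrow> f x \<le> S"
  shows "\<exists>c. \<forall>k. \<forall>x\<in>\<Omega>. \<bar>(T ^^ k) f x - c * (T ^^ k) (\<lambda>x. 1) x\<bar> \<le> \<epsilon> k * (2 * S) * (T ^^ k) (\<lambda>x. 1) x"
proof -
  let ?I = "\<lambda>k. (T ^^ k) (\<lambda>x. 1 :: real)"
  define u where "u k x = (T ^^ k) f x / ?I k x" for k x
  define P where "P n a b \<longleftrightarrow> b - a \<le> (1 - \<eta>) ^ n * (2 * S) \<and>
    cone (3 * C) (\<lambda>x. (T ^^ (M * n)) f x - a * ?I (M * n) x) \<and>
    cone (3 * C) (\<lambda>x. b * ?I (M * n) x - (T ^^ (M * n)) f x)" for n a b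
  have "\<forall>n. \<exists>a b. P n a b" unfolding P_def by (intro allI contraction_iter[OF f])
  then obtain a b where "\<And>n. P n (a n) (b n)" by metis
  then have ab: "\<And>n. b n - a n \<le> (1 - \<eta>) ^ n * (2 * S)"
    "\<And>n. cone (3 * C) (\<lambda>x. (T ^^ (M * n)) f x - a n * ?I (M * n) x)"
    "\<And>n. cone (3 * C) (\<lambda>x. b n * ?I (M * n) x - (T ^^ (M * n)) f x)"
    unfolding P_def by auto
  note fc = coneD(1)[OF f(1)] and oc = continuous_on_const[of \<Omega> "1::real"]
  \<comment> \<open>The brackets are known at time \<open>M * n\<close> only; positivity of the
    remaining \<open>j\<close> steps carries them to time \<open>k\<close>.\<close>
  have u: "a n \<le> u k x \<and> u k x \<le> b n" if k: "k \<ge> M * n" and x: "x \<in> \<Omega>" for n k x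
  proof -
    define j where "j = k - M * n"
    have kk: "(T ^^ k) h = (T ^^ j) ((T ^^ (M * n)) h)" for h :: "_ \<Rightarrow> real"
      using k by (simp add: j_def funpow_add[symmetric, unfolded o_def, THEN fun_cong])
    have "0 \<le> (T ^^ j) (\<lambda>x. (T ^^ (M * n)) f x - a n * ?I (M * n) x) x"
      by (rule iter_nonneg[OF coneD(1,2)[OF ab(2)] x])
    also have "\<dots> = (T ^^ k) f x - a n * ?I k x"
      unfolding kk by (rule iter_diff[OF iter_continuous[OF fc] iter_continuous[OF oc] x])
    finally have 1: "a n * ?I k x \<le> (T ^^ k) f x" by simp
    have "0 \<le> (T ^^ j) (\<lambda>x. b n * ?I (M * n) x - 1 * (T ^^ (M * n)) f x) x"
      using iter_nonneg[OF coneD(1,2)[OF ab(3)[of n]] x, of j] by simp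
    also have "\<dots> = (T ^^ j) (\<lambda>x. b n * ?I (M * n) x) x - 1 * (T ^^ k) f x"
      unfolding kk by (rule iter_diff[OF continuous_on_mult_left[OF iter_continuous[OF oc]] iter_continuous[OF fc] x])
    also have "(T ^^ j) (\<lambda>x. b n * ?I (M * n) x) x = b n * ?I k x"
      unfolding kk by (rule iter_cmult[OF x])
    finally have 2: "(T ^^ k) f x \<le> b n * ?I k x" by simp
    show ?thesis using 1 2 iter_one_pos[OF x, of k] by (simp add: u_def field_simps)
  qed
  obtain x0 where x0: "x0 \<in> \<Omega>" using Omega_nonempty by auto
  have S0: "S \<ge> 0" using f(2)[OF x0] coneD(2)[OF f(1) x0] by linarith
  have "Cauchy (\<lambda>k. u k x0)"
  proof (rule metric_CauchyI)
    fix e :: real assume e: "e > 0"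
    have "(\<lambda>n. (1 - \<eta>) ^ n * (2 * S)) \<longlonglongrightarrow> 0 * (2 * S)"
      using \<eta> by (intro tendsto_mult LIMSEQ_power_zero tendsto_const) auto
    then have "\<forall>\<^sub>F n in sequentially. (1 - \<eta>) ^ n * (2 * S) < e" using e by (intro order_tendstoD) auto
    then obtain n where n: "(1 - \<eta>) ^ n * (2 * S) < e" by (auto simp: eventually_sequentially)
    have "dist (u j x0) (u k x0) < e" if "j \<ge> M * n" "k \<ge> M * n" for j k
      using u[OF that(1) x0] u[OF that(2) x0] ab(1)[of n] n by (auto simp: dist_real_def)
    then show "\<exists>N. \<forall>j\<ge>N. \<forall>k\<ge>N. dist (u j x0) (u k x0) < e" by blast
  qed
  then obtain c where c: "(\<lambda>k. u k x0) \<longlonglongrightarrow> c" using Cauchy_convergent convergent_def by blast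
  have cab: "a n \<le> c" "c \<le> b n" for n
  proof -
    show "a n \<le> c" by (rule LIMSEQ_le_const[OF c], intro exI[of _ "M * n"]) (use u x0 in auto)
    show "c \<le> b n" by (rule LIMSEQ_le_const2[OF c], intro exI[of _ "M * n"]) (use u x0 in auto)
  qed
  have "\<bar>(T ^^ k) f x - c * ?I k x\<bar> \<le> \<epsilon> k * (2 * S) * ?I k x" if x: "x \<in> \<Omega>" for k x
  proof -
    have "\<bar>u k x - c\<bar> \<le> \<epsilon> k * (2 * S)"
      using u[of "k div M" k x] cab[of "k div M"] ab(1)[of "k div M"] x by (auto simp: \<epsilon>_def abs_le_iff)
    then have "\<bar>u k x - c\<bar> * ?I k x \<le> \<epsilon> k * (2 * S) * ?I k x"
      using iter_one_pos[OF x, of k] by (intro mult_right_mono) auto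
    moreover have "\<bar>(T ^^ k) f x - c * ?I k x\<bar> = \<bar>u k x - c\<bar> * ?I k x"
    proof -
      have "(T ^^ k) f x - c * ?I k x = (u k x - c) * ?I k x"
        using iter_one_pos[OF x, of k] by (simp add: u_def field_simps)
      then show ?thesis using iter_one_pos[OF x, of k] by (simp add: abs_mult)
    qed
    ultimately show ?thesis by simp
  qed
  then show ?thesis by blast
qed

end

section \<open>Leading eigenvalue, eigenfunction and eigenfunctional\<close>

lemma abs_ratio_diff: "b > (0::real) \<Longrightarrow> \<bar>a / b - c\<bar> = \<bar>a - c * b\<bar> / b"
proof -
  assume b: "b > 0"
  then have "a / b - c = (a - c * b) / b" by (simp add: field_simps)
  then show ?thesis using b by (simp add: abs_divide)
qed

context potential
begin

abbreviation I :: "nat \<Rightarrow> (nat \<Rightarrow> 'e) \<Rightarrow> real" where "I k \<equiv> (T ^^ k) (\<lambda>x. 1)"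

lemma I_continuous: "continuous_on \<Omega> (I k)"
  by (intro iter_continuous continuous_on_const)

lemma iter_const: "x \<in> \<Omega> \<Longrightarrow> (T ^^ k) (\<lambda>x. c) x = c * I k x"
  using iter_cmult[of x k c "\<lambda>x. 1"] by simp

lemma iter_abs_diff:
  fixes f g :: "(nat \<Rightarrow> 'e) \<Rightarrow> real"
  assumes f: "continuous_on \<Omega> f" and g: "continuous_on \<Omega> g"
    and le: "\<And>x. x \<in> \<Omega> \<Longrightarrow> \<bar>f x - g x\<bar> \<le> e" and x: "x \<in> \<Omega>"
  shows "\<bar>(T ^^ k) f x - (T ^^ k) g x\<bar> \<le> e * I k x"
proof -
  have "(T ^^ k) (\<lambda>x. f x - 1 * g x) x \<le> (T ^^ k) (\<lambda>x. e) x"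
    using le by (intro iter_mono continuous_intros f g x) (auto simp: abs_le_iff)
  moreover have "(T ^^ k) (\<lambda>x. g x - 1 * f x) x \<le> (T ^^ k) (\<lambda>x. e) x"
    using le by (intro iter_mono continuous_intros f g x) (auto simp: abs_le_iff)
  ultimately show ?thesis
    unfolding iter_const[OF x, of k e] iter_diff[OF f g x] iter_diff[OF g f x] by (simp add: abs_le_iff)
qed

text \<open>The codomain is general because the lemma is applied both to the real approximations of
  the eigenfunction and to the complex Neumann series.\<close>

lemma T_uniform_limit:
  fixes F :: "nat \<Rightarrow> (nat \<Rightarrow> 'e) \<Rightarrow> 'b::{banach, second_countable_topology}"
  assumes F: "uniform_limit \<Omega> F f sequentially" "\<And>n. continuous_on \<Omega> (F n)" and x: "x \<in> \<Omega>"
  shows "(\<lambda>n. T (F n) x) \<longlonglongrightarrow> T f x"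
proof -
  have fc: "continuous_on \<Omega> f" by (rule uniform_limit_theorem[OF _ F(1)]) (use F(2) in auto)
  define D where "D = T (\<lambda>x. 1::real) x"
  have D: "D \<ge> 0" using iter_one_pos[OF x, of 1] by (simp add: D_def)
  show ?thesis
  proof (rule tendstoI)
    fix e :: real assume e: "e > 0"
    have "e / (D + 1) > 0" using e D by simp
    with F(1) have "\<forall>\<^sub>F n in sequentially. \<forall>x\<in>\<Omega>. dist (F n x) (f x) < e / (D + 1)"
      unfolding uniform_limit_iff by blast
    then show "\<forall>\<^sub>F n in sequentially. dist (T (F n) x) (T f x) < e"
    proof eventually_elim
      case (elim n)
      have c: "continuous_on \<Omega> (\<lambda>x. F n x - f x)" by (intro continuous_intros F(2) fc)
      have "dist (T (F n) x) (T f x) = norm (T (\<lambda>x. F n x - f x) x)"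
        by (simp add: dist_norm T_diff[OF F(2) fc x])
      also have "\<dots> \<le> T (\<lambda>x. norm (F n x - f x)) x" by (rule norm_T_le[OF c x])
      also have "\<dots> \<le> T (\<lambda>x. e / (D + 1) * 1) x"
        using elim by (intro T_mono continuous_intros c x) (auto simp: dist_norm intro: less_imp_le)
      also have "\<dots> = e / (D + 1) * D" unfolding D_def by (rule T_cmult)
      also have "\<dots> < e" using e D by (simp add: field_simps)
      finally show ?case .
    qed
  qed
qed

text \<open>The error is measured relative to \<open>I k\<close> and multiplied out, so that it can
  be estimated with linearity and monotonicity of the iterates.\<close>

definition conv :: "((nat \<Rightarrow> 'e) \<Rightarrow> real) \<Rightarrow> real \<Rightarrow> bool" where
  "conv f c \<longleftrightarrow> (\<forall>e>0. \<exists>k0. \<forall>k\<ge>k0. \<forall>x\<in>\<Omega>. \<bar>(T ^^ k) f x - c * I k x\<bar> \<le> e * I k x)"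

lemma conv_tendsto:
  assumes c: "conv f c" and x: "x \<in> \<Omega>" shows "(\<lambda>k. (T ^^ k) f x / I k x) \<longlonglongrightarrow> c"
proof (rule LIMSEQ_I)
  fix e :: real assume "e > 0"
  then obtain k0 where k0: "\<forall>k\<ge>k0. \<forall>x\<in>\<Omega>. \<bar>(T ^^ k) f x - c * I k x\<bar> \<le> e / 2 * I k x"
    using c[unfolded conv_def, rule_format, of "e / 2"] by auto
  have "norm ((T ^^ k) f x / I k x - c) < e" if "k \<ge> k0" for k
  proof -
    note pos = iter_one_pos[OF x, of k]
    have "norm ((T ^^ k) f x / I k x - c) = \<bar>(T ^^ k) f x - c * I k x\<bar> / I k x"
      unfolding real_norm_def by (rule abs_ratio_diff[OF pos])
    also have "\<dots> \<le> e / 2" using k0 that x pos by (simp add: pos_divide_le_eq)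
    finally show ?thesis using \<open>e > 0\<close> by simp
  qed
  then show "\<exists>k0. \<forall>k\<ge>k0. norm ((T ^^ k) f x / I k x - c) < e" by blast
qed

text \<open>The approximate limit may depend on the tolerance: the ratios are then Cauchy at one
  point, and their limit there is close to each approximate limit, hence serves at all
  points.\<close>

lemma conv_approx:
  assumes "\<And>e. e > 0 \<Longrightarrow> \<exists>c k0. \<forall>k\<ge>k0. \<forall>x\<in>\<Omega>. \<bar>(T ^^ k) f x - c * I k x\<bar> \<le> e * I k x"
  shows "\<exists>c. conv f c"
proof -
  define u where "u k x = (T ^^ k) f x / I k x" for k x
  have u: "\<bar>u k x - c\<bar> \<le> e \<longleftrightarrow> \<bar>(T ^^ k) f x - c * I k x\<bar> \<le> e * I k x" if x: "x \<in> \<Omega>" for k x c e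
  proof -
    note pos = iter_one_pos[OF x, of k]
    have "\<bar>u k x - c\<bar> = \<bar>(T ^^ k) f x - c * I k x\<bar> / I k x"
      unfolding u_def by (rule abs_ratio_diff[OF pos])
    then show ?thesis using pos by (simp add: pos_divide_le_eq)
  qed
  obtain x0 where x0: "x0 \<in> \<Omega>" using Omega_nonempty by auto
  have ap: "\<exists>c k0. \<forall>k\<ge>k0. \<forall>x\<in>\<Omega>. \<bar>u k x - c\<bar> \<le> e" if "e > 0" for e
    using assms[OF that] u by simp
  have "Cauchy (\<lambda>k. u k x0)"
  proof (rule metric_CauchyI)
    fix e :: real assume "e > 0"
    then obtain c k0 where *: "\<forall>k\<ge>k0. \<forall>x\<in>\<Omega>. \<bar>u k x - c\<bar> \<le> e / 3" using ap[of "e / 3"] by auto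
    have "dist (u j x0) (u k x0) < e" if "j \<ge> k0" "k \<ge> k0" for j k
      using *[rule_format, OF that(1) x0] *[rule_format, OF that(2) x0] \<open>e > 0\<close>
      unfolding dist_real_def by linarith
    then show "\<exists>N. \<forall>j\<ge>N. \<forall>k\<ge>N. dist (u j x0) (u k x0) < e" by blast
  qed
  then obtain c where c: "(\<lambda>k. u k x0) \<longlonglongrightarrow> c" using Cauchy_convergent convergent_def by blast
  have "\<exists>k0. \<forall>k\<ge>k0. \<forall>x\<in>\<Omega>. \<bar>u k x - c\<bar> \<le> e" if "e > 0" for e
  proof -
    obtain c' k0 where *: "\<forall>k\<ge>k0. \<forall>x\<in>\<Omega>. \<bar>u k x - c'\<bar> \<le> e / 2" using ap[of "e / 2"] \<open>e > 0\<close> by auto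
    have "\<bar>c - c'\<bar> \<le> e / 2"
    proof (rule LIMSEQ_le_const2)
      show "(\<lambda>k. \<bar>u k x0 - c'\<bar>) \<longlonglongrightarrow> \<bar>c - c'\<bar>" by (intro tendsto_intros c)
      show "\<exists>N. \<forall>k\<ge>N. \<bar>u k x0 - c'\<bar> \<le> e / 2" using * x0 by blast
    qed
    then have "\<bar>u k x - c\<bar> \<le> e" if "k \<ge> k0" "x \<in> \<Omega>" for k x
      using *[rule_format, OF that] by linarith
    then show ?thesis by blast
  qed
  then have "conv f c" unfolding conv_def using u by simp
  then show ?thesis ..
qed

lemma cone_conv:
  assumes f: "cone (3 * C) f" shows "\<exists>c. conv f c"
proof -
  obtain S where S: "S > 0" "\<forall>x\<in>\<Omega>. norm (f x) \<le> S" using continuous_bounded[OF coneD(1)[OF f]] by blast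
  then have "f x \<le> S" if "x \<in> \<Omega>" for x using that by (auto simp: abs_le_iff)
  from cone_ratio_limit[OF f this] obtain c where
    c: "\<And>k x. x \<in> \<Omega> \<Longrightarrow> \<bar>(T ^^ k) f x - c * I k x\<bar> \<le> \<epsilon> k * (2 * S) * I k x" by auto
  have "\<exists>k0. \<forall>k\<ge>k0. \<forall>x\<in>\<Omega>. \<bar>(T ^^ k) f x - c * I k x\<bar> \<le> e * I k x" if "e > 0" for e
  proof -
    have "(\<lambda>k. \<epsilon> k * (2 * S)) \<longlonglongrightarrow> 0" by (rule tendsto_mult_left_zero[OF \<epsilon>_tendsto])
    then have "\<forall>\<^sub>F k in sequentially. \<epsilon> k * (2 * S) < e" using that by (rule order_tendstoD)
    then obtain k0 where "\<forall>k\<ge>k0. \<epsilon> k * (2 * S) < e" by (auto simp: eventually_sequentially)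
    then have "\<bar>(T ^^ k) f x - c * I k x\<bar> \<le> e * I k x" if "k \<ge> k0" "x \<in> \<Omega>" for k x
      using order_trans[OF c[OF that(2), of k] mult_right_mono[of "\<epsilon> k * (2 * S)" e "I k x"]]
        iter_one_pos[OF that(2), of k] that(1) by (simp add: less_imp_le)
    then show ?thesis by blast
  qed
  then show ?thesis unfolding conv_def by blast
qed

text \<open>A large constant lifts \<open>f\<close> above \<open>L / (3 * C)\<close>, so the
  additive error \<open>L * d x y\<close> is at most \<open>3 * C * d x y\<close> times the
  function, and \<open>1 + v \<le> exp v\<close> makes this a cone inequality.\<close>

lemma Lip_cone:
  assumes "f \<in> Lip_Omega A" shows "\<exists>s. cone (3 * C) (\<lambda>x. f x + s)"
proof -
  obtain L where L: "L > 0" "\<forall>x\<in>\<Omega>. \<forall>y\<in>\<Omega>. \<bar>f x - f y\<bar> \<le> L * d x y" using LipD[OF assms] by auto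
  obtain F where F: "\<forall>x\<in>\<Omega>. norm (f x) \<le> F" using continuous_bounded[OF Lip_continuous[OF assms]] by auto
  define s where "s = F + L / (3 * C)"
  have low: "f x + s \<ge> L / (3 * C)" if "x \<in> \<Omega>" for x using F that by (auto simp: s_def abs_le_iff)
  have "L / (3 * C) > 0" using L(1) C(1) by simp
  have "cone (3 * C) (\<lambda>x. f x + s)"
  proof (rule coneI)
    fix x y assume xy: "x \<in> \<Omega>" "y \<in> \<Omega>"
    have "f x + s \<le> (f y + s) + L * d x y" using L(2)[rule_format, OF xy] by linarith
    also have "L * d x y = 3 * C * d x y * (L / (3 * C))" using C(1) by simp
    also have "\<dots> \<le> 3 * C * d x y * (f y + s)"
      using low[OF xy(2)] C(1) d_nonneg by (intro mult_left_mono) auto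
    also have "(f y + s) + 3 * C * d x y * (f y + s) = (1 + 3 * C * d x y) * (f y + s)" by (simp add: algebra_simps)
    also have "\<dots> \<le> exp (3 * C * d x y) * (f y + s)"
      using low[OF xy(2)] \<open>L / (3 * C) > 0\<close> by (intro mult_right_mono exp_ge_add_one_self) auto
    finally show "f x + s \<le> exp (3 * C * d x y) * (f y + s)" by simp
  qed (use low \<open>L / (3 * C) > 0\<close> Lip_continuous[OF assms] in \<open>auto intro!: continuous_intros intro: order_trans less_imp_le\<close>)
  then show ?thesis ..
qed

lemma Lip_conv:
  assumes f: "f \<in> Lip_Omega A" shows "\<exists>c. conv f c"
proof -
  obtain s where s: "cone (3 * C) (\<lambda>x. f x + s)" using Lip_cone[OF f] by auto
  obtain c where c: "conv (\<lambda>x. f x + s) c" using cone_conv[OF s] by auto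
  have "(T ^^ k) (\<lambda>x. f x + s) x - c * I k x = (T ^^ k) f x - (c - s) * I k x" if "x \<in> \<Omega>" for x k
    using iter_add[OF Lip_continuous[OF f] continuous_on_const that, of k s] iter_const[OF that, of k s]
    by (simp add: algebra_simps)
  then have "conv f (c - s)" using c unfolding conv_def by simp
  then show ?thesis ..
qed

lemma continuous_conv:
  assumes f: "continuous_on \<Omega> f" shows "\<exists>c. conv f c"
proof (rule conv_approx)
  fix e :: real assume e: "e > 0"
  obtain g where g: "g \<in> Lip_Omega A" "\<forall>x\<in>\<Omega>. \<bar>f x - g x\<bar> < e / 2" using Lip_dense[OF f, of "e / 2"] e by auto
  obtain c where "conv g c" using Lip_conv[OF g(1)] by auto
  then obtain k0 where k0: "\<forall>k\<ge>k0. \<forall>x\<in>\<Omega>. \<bar>(T ^^ k) g x - c * I k x\<bar> \<le> e / 2 * I k x"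
    unfolding conv_def using e by (meson half_gt_zero)
  have "\<bar>(T ^^ k) f x - c * I k x\<bar> \<le> e * I k x" if "k \<ge> k0" "x \<in> \<Omega>" for k x
  proof -
    have "\<bar>(T ^^ k) f x - (T ^^ k) g x\<bar> \<le> e / 2 * I k x"
      using g(2) by (intro iter_abs_diff[OF f Lip_continuous[OF g(1)] _ that(2)]) (auto intro: less_imp_le)
    moreover have "e / 2 * I k x + e / 2 * I k x = e * I k x" by (simp add: algebra_simps)
    ultimately show ?thesis using k0[rule_format, OF that] by linarith
  qed
  then show "\<exists>c k0. \<forall>k\<ge>k0. \<forall>x\<in>\<Omega>. \<bar>(T ^^ k) f x - c * I k x\<bar> \<le> e * I k x" by blast
qed

section \<open>The eigenfunctional and its eigenvalue\<close>

definition base :: "nat \<Rightarrow> 'e" where "base = (SOME x. x \<in> \<Omega>)"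

lemma base: "base \<in> \<Omega>"
  unfolding base_def using Omega_nonempty by (simp add: some_in_eq)

definition Lam :: "((nat \<Rightarrow> 'e) \<Rightarrow> real) \<Rightarrow> real" where
  "Lam f = lim (\<lambda>k. (T ^^ k) f base / I k base)"

lemma conv_Lam_eq: "conv f c \<Longrightarrow> Lam f = c"
  unfolding Lam_def by (rule limI[OF conv_tendsto[OF _ base]])

lemma conv_Lam: assumes f: "continuous_on \<Omega> f" shows "conv f (Lam f)"
proof -
  obtain c where c: "conv f c" using continuous_conv[OF f] ..
  then show ?thesis unfolding conv_Lam_eq[OF c] .
qed

lemmas Lam_tendsto = conv_tendsto[OF conv_Lam]

lemma Lam_eqI: "continuous_on \<Omega> f \<Longrightarrow> (\<lambda>k. (T ^^ k) f base / I k base) \<longlonglongrightarrow> c \<Longrightarrow> Lam f = c"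
  by (rule LIMSEQ_unique[OF Lam_tendsto[OF _ base]])

sublocale Lam: positive_functional \<Omega> Lam
proof
  show "compact \<Omega>" by (rule compact_Omega)
next
  fix f g :: "(nat \<Rightarrow> 'e) \<Rightarrow> real" assume fg: "continuous_on \<Omega> f" "continuous_on \<Omega> g"
  show "Lam (\<lambda>x. f x + g x) = Lam f + Lam g"
  proof (rule Lam_eqI)
    show "(\<lambda>k. (T ^^ k) (\<lambda>x. f x + g x) base / I k base) \<longlonglongrightarrow> Lam f + Lam g"
      unfolding iter_add[OF fg base] add_divide_distrib by (intro tendsto_add Lam_tendsto fg base)
  qed (intro continuous_intros fg)
next
  fix f :: "(nat \<Rightarrow> 'e) \<Rightarrow> real" and c assume f: "continuous_on \<Omega> f"
  show "Lam (\<lambda>x. c * f x) = c * Lam f"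
  proof (rule Lam_eqI)
    show "(\<lambda>k. (T ^^ k) (\<lambda>x. c * f x) base / I k base) \<longlonglongrightarrow> c * Lam f"
      unfolding iter_cmult[OF base] times_divide_eq_right[symmetric]
      by (intro tendsto_mult tendsto_const Lam_tendsto f base)
  qed (intro continuous_intros f)
next
  fix f :: "(nat \<Rightarrow> 'e) \<Rightarrow> real" assume f: "continuous_on \<Omega> f" "\<And>x. x \<in> \<Omega> \<Longrightarrow> 0 \<le> f x"
  have "0 \<le> (T ^^ k) f base / I k base" for k
    using iter_nonneg[OF f base] iter_one_pos[OF base, of k] by simp
  then show "0 \<le> Lam f" by (intro LIMSEQ_le_const[OF Lam_tendsto[OF f(1) base]]) blast
next
  have "I k base / I k base = 1" for k using iter_one_pos[OF base, of k] by simp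
  then show "Lam (\<lambda>x. 1) = 1" by (intro Lam_eqI) simp_all
qed

definition lam :: real where "lam = Lam (T (\<lambda>x. 1))"

lemma Lam_T:
  assumes f: "continuous_on \<Omega> f" shows "Lam (T f) = lam * Lam f"
proof (rule Lam_eqI[OF T_continuous[OF f]])
  \<comment> \<open>Inserting \<open>I (Suc k)\<close>, which is also \<open>(T ^^ k)\<close> of
    \<open>T 1\<close>, factors the ratio into one that tends to \<open>lam\<close> and one that
    tends to \<open>Lam f\<close>.\<close>
  have "(T ^^ k) (T f) base / I k base =
      ((T ^^ k) (T (\<lambda>x. 1)) base / I k base) * ((T ^^ Suc k) f base / I (Suc k) base)" for k
    using iter_one_pos[OF base, of k] iter_one_pos[OF base, of "Suc k"] by (simp add: funpow_swap1)
  moreover have "(\<lambda>k. ((T ^^ k) (T (\<lambda>x. 1)) base / I k base) * ((T ^^ Suc k) f base / I (Suc k) base))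
      \<longlonglongrightarrow> lam * Lam f"
    unfolding lam_def
    by (rule tendsto_mult[OF Lam_tendsto[OF T_continuous base] LIMSEQ_Suc[OF Lam_tendsto[OF f base]]]) simp
  ultimately show "(\<lambda>k. (T ^^ k) (T f) base / I k base) \<longlonglongrightarrow> lam * Lam f" by simp
qed

lemma Lam_iter: "continuous_on \<Omega> f \<Longrightarrow> Lam ((T ^^ n) f) = lam ^ n * Lam f"
  by (induction n) (simp_all add: Lam_T iter_continuous)

lemma lam_pos: "lam > 0"
proof -
  have "\<exists>c>0. \<forall>x\<in>\<Omega>. c \<le> T (\<lambda>x. 1::real) x"
    by (rule positive_bounded_below[OF T_continuous[OF continuous_on_const]]) (use iter_one_pos[where n=1] in simp)
  then obtain c where c: "c > 0" "\<forall>x\<in>\<Omega>. c \<le> T (\<lambda>x. 1::real) x" by auto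
  have "c = Lam (\<lambda>x. c)" by (simp add: Lam.const)
  also have "\<dots> \<le> lam" unfolding lam_def using c by (intro Lam.mono T_continuous) auto
  finally show ?thesis using c(1) by linarith
qed

section \<open>The positive eigenfunction as a limit of normalised iterates\<close>

definition Gn :: "nat \<Rightarrow> (nat \<Rightarrow> 'e) \<Rightarrow> real" where "Gn n x = I n x / lam ^ n"

definition G :: "(nat \<Rightarrow> 'e) \<Rightarrow> real" where "G x = lim (\<lambda>n. Gn n x)"

lemma Gn_eq: "Gn n = (\<lambda>x. (1 / lam ^ n) * I n x)"
  by (simp add: Gn_def fun_eq_iff)

lemma Gn_continuous: "continuous_on \<Omega> (Gn n)"
  unfolding Gn_eq by (intro continuous_on_mult_left I_continuous)

lemma Lam_Gn: "Lam (Gn n) = 1"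
proof -
  have "Lam (Gn n) = 1 / lam ^ n * Lam (I n)" unfolding Gn_eq by (rule Lam.scale[OF I_continuous])
  also have "Lam (I n) = lam ^ n" using Lam_iter[of "\<lambda>x. 1" n] by (simp add: Lam.const)
  finally show ?thesis using lam_pos by simp
qed

lemma cone_Gn: "cone (3 * C) (Gn n)"
  unfolding Gn_eq using C(1) lam_pos by (intro cone_cmult cone_iter cone_one) simp_all

lemma cone2_Gn: "n \<ge> 1 \<Longrightarrow> cone (2 * C) (Gn n)"
  unfolding Gn_eq using C(1) lam_pos by (intro cone_cmult cone_iter2 cone_one) simp_all

lemma Gn_harnack:
  assumes n: "n \<ge> M" and xy: "x \<in> \<Omega>" "y \<in> \<Omega>" shows "Gn n x \<le> R * Gn n y"
proof -
  have "I n = (T ^^ M) (I (n - M))" using n by (simp add: funpow_add[symmetric, THEN fun_cong, unfolded o_def])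
  then have "I n x \<le> R * I n y" using MR(3)[OF cone_iter[OF cone_one] xy] C(1) by simp
  then show ?thesis using lam_pos by (simp add: Gn_def divide_right_mono)
qed

text \<open>Applying \<open>Lam\<close> to the Harnack inequality in one of its two variables
  replaces that side by \<open>Lam (Gn n) = 1\<close>, which turns a bound on quotients into
  absolute bounds.\<close>

lemma Gn_bounds:
  assumes n: "n \<ge> M" and x: "x \<in> \<Omega>" shows "Gn n x \<le> R" "1 / R \<le> Gn n x"
proof -
  have "Lam (\<lambda>y. Gn n x) \<le> Lam (\<lambda>y. R * Gn n y)"
    by (intro Lam.mono continuous_intros Gn_continuous Gn_harnack[OF n x]) auto
  then show "Gn n x \<le> R" by (simp add: Lam.const Lam.scale[OF Gn_continuous] Lam_Gn)
  have "Lam (Gn n) \<le> Lam (\<lambda>y. R * Gn n x)"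
    by (intro Lam.mono continuous_intros Gn_continuous Gn_harnack[OF n _ x]) auto
  then show "1 / R \<le> Gn n x" using MR(2) by (simp add: Lam.const Lam_Gn field_simps)
qed

text \<open>\<open>Gn (n + k)\<close> arises from \<open>Gn n\<close> by \<open>k\<close> normalised
  steps, and the ratio limit of \<open>Gn n\<close> is \<open>Lam (Gn n) = 1\<close>. Hence it
  approaches \<open>Gn k\<close> at rate \<open>\<epsilon> k\<close>, uniformly in
  \<open>n\<close>.\<close>

lemma Gn_diff:
  assumes n: "n \<ge> M" and k: "k \<ge> M" and x: "x \<in> \<Omega>"
  shows "\<bar>Gn (n + k) x - Gn k x\<bar> \<le> 2 * R\<^sup>2 * \<epsilon> k"
proof -
  have "\<exists>c. \<forall>k. \<forall>x\<in>\<Omega>. \<bar>(T ^^ k) (Gn n) x - c * I k x\<bar> \<le> \<epsilon> k * (2 * R) * I k x"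
    by (rule cone_ratio_limit[OF cone_Gn]) (rule Gn_bounds(1)[OF n])
  then obtain c where c: "\<And>k x. x \<in> \<Omega> \<Longrightarrow> \<bar>(T ^^ k) (Gn n) x - c * I k x\<bar> \<le> \<epsilon> k * (2 * R) * I k x"
    by metis
  have "(\<lambda>k. (T ^^ k) (Gn n) base / I k base) \<longlonglongrightarrow> c"
  proof (rule LIM_zero_cancel, rule Lim_null_comparison)
    show "\<forall>\<^sub>F k in sequentially. norm ((T ^^ k) (Gn n) base / I k base - c) \<le> \<epsilon> k * (2 * R)"
    proof (rule always_eventually, rule allI)
      fix k
      note pos = iter_one_pos[OF base, of k]
      have "norm ((T ^^ k) (Gn n) base / I k base - c) = \<bar>(T ^^ k) (Gn n) base - c * I k base\<bar> / I k base"
        unfolding real_norm_def by (rule abs_ratio_diff[OF pos])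
      then show "norm ((T ^^ k) (Gn n) base / I k base - c) \<le> \<epsilon> k * (2 * R)"
        using c[OF base, of k] pos by (simp add: pos_divide_le_eq)
    qed
    show "(\<lambda>k. \<epsilon> k * (2 * R)) \<longlonglongrightarrow> 0" by (rule tendsto_mult_left_zero[OF \<epsilon>_tendsto])
  qed
  then have "c = 1" using Lam_eqI[OF Gn_continuous, of n c] Lam_Gn by simp
  have pk: "lam ^ k > 0" using lam_pos by simp
  have "(T ^^ k) (Gn n) x = 1 / lam ^ n * I (n + k) x"
    unfolding Gn_eq iter_cmult[OF x] by (simp add: funpow_add[THEN fun_cong] add.commute[of n k])
  then have e: "(T ^^ k) (Gn n) x / lam ^ k = Gn (n + k) x" by (simp add: Gn_def power_add)
  have "\<bar>Gn (n + k) x - Gn k x\<bar> = \<bar>(T ^^ k) (Gn n) x - c * I k x\<bar> / lam ^ k"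
    unfolding e[symmetric] using lam_pos by (simp add: Gn_def \<open>c = 1\<close> diff_divide_distrib[symmetric] abs_divide)
  also have "\<dots> \<le> \<epsilon> k * (2 * R) * I k x / lam ^ k" using c[OF x, of k] pk by (intro divide_right_mono) auto
  also have "\<dots> = \<epsilon> k * (2 * R) * Gn k x" by (simp add: Gn_def)
  also have "\<dots> \<le> \<epsilon> k * (2 * R) * R"
    using Gn_bounds(1)[OF k x] \<epsilon>_nonneg MR(2) by (intro mult_left_mono) auto
  finally show ?thesis by (simp add: power2_eq_square mult_ac)
qed

lemma G_tendsto:
  assumes x: "x \<in> \<Omega>" shows "(\<lambda>n. Gn n x) \<longlonglongrightarrow> G x"
proof -
  have "Cauchy (\<lambda>n. Gn n x)"
  proof (rule metric_CauchyI)
    fix e :: real assume e: "e > 0"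
    have "(\<lambda>k. 2 * R\<^sup>2 * \<epsilon> k) \<longlonglongrightarrow> 0" by (rule tendsto_mult_right_zero[OF \<epsilon>_tendsto])
    then have "\<forall>\<^sub>F k in sequentially. 2 * R\<^sup>2 * \<epsilon> k < e / 2" using e by (intro order_tendstoD) auto
    then obtain k0 where k0: "\<And>k. k \<ge> k0 \<Longrightarrow> 2 * R\<^sup>2 * \<epsilon> k < e / 2" unfolding eventually_sequentially by blast
    define k where "k = max k0 M"
    have b: "\<bar>Gn n x - Gn k x\<bar> < e / 2" if "n \<ge> M + k" for n
    proof -
      have "\<bar>Gn ((n - k) + k) x - Gn k x\<bar> \<le> 2 * R\<^sup>2 * \<epsilon> k"
        using that by (intro Gn_diff x) (auto simp: k_def)
      then show ?thesis using k0[of k] that by (simp add: k_def)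
    qed
    have "dist (Gn m x) (Gn n x) < e" if "m \<ge> M + k" "n \<ge> M + k" for m n
      using b[OF that(1)] b[OF that(2)] unfolding dist_real_def by linarith
    then show "\<exists>N. \<forall>m\<ge>N. \<forall>n\<ge>N. dist (Gn m x) (Gn n x) < e" by blast
  qed
  then show ?thesis unfolding G_def using Cauchy_convergent convergent_LIMSEQ_iff by blast
qed

lemma G_Gn:
  assumes k: "k \<ge> M" and x: "x \<in> \<Omega>" shows "\<bar>Gn k x - G x\<bar> \<le> 2 * R\<^sup>2 * \<epsilon> k"
proof (rule LIMSEQ_le_const2)
  show "(\<lambda>n. \<bar>Gn k x - Gn (n + k) x\<bar>) \<longlonglongrightarrow> \<bar>Gn k x - G x\<bar>"
    by (intro tendsto_intros LIMSEQ_ignore_initial_segment G_tendsto x)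
  show "\<exists>N. \<forall>n\<ge>N. \<bar>Gn k x - Gn (n + k) x\<bar> \<le> 2 * R\<^sup>2 * \<epsilon> k"
    using Gn_diff[OF _ k x] by (intro exI[of _ M] allI impI) (simp only: abs_minus_commute[of "Gn k x"])
qed

lemma Gn_uniform: "uniform_limit \<Omega> Gn G sequentially"
  unfolding uniform_limit_iff
proof (intro allI impI)
  fix e :: real assume e: "e > 0"
  have "(\<lambda>k. 2 * R\<^sup>2 * \<epsilon> k) \<longlonglongrightarrow> 0" by (rule tendsto_mult_right_zero[OF \<epsilon>_tendsto])
  then have "\<forall>\<^sub>F k in sequentially. 2 * R\<^sup>2 * \<epsilon> k < e" using e by (intro order_tendstoD) auto
  then show "\<forall>\<^sub>F n in sequentially. \<forall>x\<in>\<Omega>. dist (Gn n x) (G x) < e"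
    using eventually_ge_at_top[of M]
  proof eventually_elim
    case (elim k)
    then show ?case using G_Gn[OF elim(2)] by (auto simp: dist_real_def intro: le_less_trans)
  qed
qed

lemma G_continuous: "continuous_on \<Omega> G"
  by (rule uniform_limit_theorem[OF _ Gn_uniform]) (simp_all add: Gn_continuous)

lemma G_pos: assumes x: "x \<in> \<Omega>" shows "G x > 0"
proof -
  have "1 / R \<le> G x"
    by (rule LIMSEQ_le_const[OF G_tendsto[OF x]], intro exI[of _ M]) (use Gn_bounds(2) x in blast)
  moreover have "1 / R > 0" using MR(2) by simp
  ultimately show ?thesis by linarith
qed

lemma cone_G: "cone (2 * C) G"
proof (rule coneI[OF G_continuous less_imp_le[OF G_pos]])
  fix x y assume xy: "x \<in> \<Omega>" "y \<in> \<Omega>" "d x y < r"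
  show "G x \<le> exp (2 * C * d x y) * G y"
  proof (rule LIMSEQ_le[OF G_tendsto[OF xy(1)] tendsto_mult_left[OF G_tendsto[OF xy(2)]]])
    show "\<exists>N. \<forall>n\<ge>N. Gn n x \<le> exp (2 * C * d x y) * Gn n y"
      using coneD(3)[OF cone2_Gn xy] by blast
  qed
qed

lemma cone_Lip:
  assumes f: "cone K f" and K: "K \<ge> 0" shows "f \<in> Lip_Omega A"
proof -
  obtain S where S: "S > 0" "\<forall>x\<in>\<Omega>. norm (f x) \<le> S" using continuous_bounded[OF coneD(1)[OF f]] by blast
  define L where "L = K * exp (K * r) * S"
  have *: "f x - f y \<le> L * d x y" if xy: "x \<in> \<Omega>" "y \<in> \<Omega>" "d x y < r" for x y
  proof -
    define v where "v = K * d x y"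
    have v: "0 \<le> v" "v \<le> K * r" using K d_nonneg[of x y] xy(3) by (auto simp: v_def intro: mult_left_mono)
    have "f x - f y \<le> (exp v - 1) * f y" using coneD(3)[OF f xy] by (simp add: v_def algebra_simps)
    also have "\<dots> \<le> (exp (K * r) * v) * S"
    proof (rule mult_mono)
      have "exp v - 1 = exp v * (1 - exp (- v))" by (simp add: right_diff_distrib exp_add[symmetric])
      also have "\<dots> \<le> exp v * v"
        using exp_ge_add_one_self[of "- v"] by (intro mult_left_mono exp_ge_zero) linarith
      also have "\<dots> \<le> exp (K * r) * v" using v by (intro mult_right_mono) auto
      finally show "exp v - 1 \<le> exp (K * r) * v" .
      show "f y \<le> S" using S(2) xy(2) by (auto simp: abs_le_iff)
    qed (use v coneD(2)[OF f xy(2)] in auto)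
    also have "\<dots> = L * d x y" by (simp add: L_def v_def)
    finally show ?thesis .
  qed
  show ?thesis
  proof (rule Lip_local[OF r(1)])
    fix x assume "x \<in> \<Omega>" then show "\<bar>f x\<bar> \<le> S" using S(2) by auto
  next
    fix x y assume xy: "x \<in> \<Omega>" "y \<in> \<Omega>" "d x y < r"
    then show "\<bar>f x - f y\<bar> \<le> L * d x y" using *[OF xy] *[OF xy(2,1)] d_commute[of x y] by (simp add: abs_le_iff)
  qed
qed

lemma G_Lip: "G \<in> Lip_Omega A"
  using cone_Lip[OF cone_G] C(1) by simp

text \<open>After adding a constant the function lies in the cone; \<open>cone_transfer\<close>
  applies, and the contribution of the constant is a multiple of \<open>T 1\<close>, itself in the
  smaller cone.\<close>

lemma T_Lip:
  assumes f: "f \<in> Lip_Omega A" shows "T f \<in> Lip_Omega A"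
proof -
  obtain s where s: "cone (3 * C) (\<lambda>x. f x + s)" using Lip_cone[OF f] by auto
  have 1: "T (\<lambda>x. f x + s) \<in> Lip_Omega A" using cone_Lip[OF cone_transfer[OF s]] C(1) by simp
  have 2: "T (\<lambda>x. 1) \<in> Lip_Omega A" using cone_Lip[OF cone_transfer[OF cone_one]] C(1) by simp
  have "T f x = T (\<lambda>x. f x + s) x - s * T (\<lambda>x. 1) x" if "x \<in> \<Omega>" for x
    using T_add[OF Lip_continuous[OF f] continuous_on_const that, of s] iter_const[OF that, of 1 s] by simp
  moreover have "(\<lambda>x. T (\<lambda>x. f x + s) x - s * T (\<lambda>x. 1) x) \<in> Lip_Omega A"
    by (intro Lip_diff Lip_cmult 1 2)
  ultimately show ?thesis by (simp add: Lip_Omega_def)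
qed

lemma G_eigen: assumes x: "x \<in> \<Omega>" shows "T G x = lam * G x"
proof (rule LIMSEQ_unique)
  show "(\<lambda>n. T (Gn n) x) \<longlonglongrightarrow> T G x" by (rule T_uniform_limit[OF Gn_uniform Gn_continuous x])
  have "T (Gn n) x = lam * Gn (Suc n) x" for n
    unfolding Gn_eq T_cmult using lam_pos by simp
  moreover have "(\<lambda>n. lam * Gn (Suc n) x) \<longlonglongrightarrow> lam * G x"
    by (intro tendsto_mult_left LIMSEQ_Suc G_tendsto x)
  ultimately show "(\<lambda>n. T (Gn n) x) \<longlonglongrightarrow> lam * G x" by simp
qed

lemma iter_eigen:
  fixes f :: "(nat \<Rightarrow> 'e) \<Rightarrow> real"
  assumes "\<And>x. x \<in> \<Omega> \<Longrightarrow> T f x = l * f x" and "x \<in> \<Omega>"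
  shows "(T ^^ k) f x = l ^ k * f x"
  using assms(2)
proof (induction k arbitrary: x)
  case (Suc k)
  have "T ((T ^^ k) f) x = T (\<lambda>y. l ^ k * f y) x" using Suc by (intro T_cong) auto
  then show ?case using Suc.prems by (simp add: T_cmult assms(1))
qed simp

lemma Lam_G: "Lam G = 1"
proof (rule Lam_eqI[OF G_continuous])
  have it: "(T ^^ k) G x = lam ^ k * G x" if "x \<in> \<Omega>" for k x
    by (rule iter_eigen[OF G_eigen that])
  have "(T ^^ k) G base / I k base = G base / Gn k base" for k
    using lam_pos by (simp add: it[OF base] Gn_def)
  moreover have "(\<lambda>k. G base / Gn k base) \<longlonglongrightarrow> G base / G base"
    using G_pos[OF base] by (intro tendsto_divide tendsto_const G_tendsto base) auto
  ultimately show "(\<lambda>k. (T ^^ k) G base / I k base) \<longlonglongrightarrow> 1" using G_pos[OF base] by simp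
qed

end

section \<open>Spectral radius and Gibbs measures\<close>

context shift_space
begin

lemma norm_le_sup_norm:
  fixes f :: "(nat \<Rightarrow> 'e) \<Rightarrow> 'b::real_normed_vector"
  assumes f: "continuous_on \<Omega> f" and x: "x \<in> \<Omega>" shows "norm (f x) \<le> sup_norm A f"
proof -
  obtain B where B: "\<forall>x\<in>\<Omega>. norm (f x) \<le> B" using continuous_bounded[OF f] by auto
  then have "bdd_above ((\<lambda>x. norm (f x)) ` \<Omega>)" by (intro bdd_aboveI2[of _ _ B]) blast
  then show ?thesis unfolding sup_norm_def using x by (intro cSUP_upper)
qed

lemma sup_norm_le:
  assumes "\<And>x. x \<in> \<Omega> \<Longrightarrow> norm (f x) \<le> B" shows "sup_norm A f \<le> B"
  unfolding sup_norm_def using assms Omega_nonempty by (intro cSUP_least)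

end

context potential
begin

lemma T_of_real: "T (\<lambda>x. complex_of_real (f x)) \<omega> = complex_of_real (T f \<omega>)"
proof -
  have "T (\<lambda>x. complex_of_real (f x)) \<omega> =
      (LINT t|\<rho>. complex_of_real (integrand f \<omega> t))"
    unfolding transfer_def by (simp add: scaleR_conv_of_real)
  also have "\<dots> = complex_of_real (T f \<omega>)"
    unfolding transfer_def by (rule integral_complex_of_real)
  finally show ?thesis .
qed

lemma T_sum:
  fixes f :: "nat \<Rightarrow> (nat \<Rightarrow> 'e) \<Rightarrow> complex"
  assumes f: "\<And>i. continuous_on \<Omega> (f i)" and x: "x \<in> \<Omega>"
  shows "T (\<lambda>x. \<Sum>i<n. f i x) x = (\<Sum>i<n. T (f i) x)"
proof (induction n)
  case 0
  show ?case by (simp add: transfer_def)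
next
  case (Suc n)
  have "T (\<lambda>x. (\<Sum>i<n. f i x) + f n x) x = T (\<lambda>x. \<Sum>i<n. f i x) x + T (f n) x"
    by (intro T_add continuous_on_sum f x)
  then show ?case using Suc by simp
qed

text \<open>An arbitrary positive continuous eigenfunction is allowed: besides \<open>G\<close> with
  \<open>lam\<close>, the constant 1 with eigenvalue 1 is used later for normalised
  potentials.\<close>

context
  fixes H :: "(nat \<Rightarrow> 'e) \<Rightarrow> real" and l :: real
  assumes H: "continuous_on \<Omega> H" "\<And>x. x \<in> \<Omega> \<Longrightarrow> H x > 0"
    and eig: "\<And>x. x \<in> \<Omega> \<Longrightarrow> T H x = l * H x"
begin

lemma eigenvalue_pos: "l > 0"
proof -
  obtain x where x: "x \<in> \<Omega>" using Omega_nonempty by auto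
  obtain s where s: "A s (x 0) = 1" using ex_pred by blast
  have "T H x > 0"
    by (rule T_pos[OF H(1) less_imp_le[OF H(2)] x, of s]) (use s x in \<open>simp_all add: H(2) case_nat_Omega\<close>)
  then show ?thesis using eig[OF x] H(2)[OF x] by (simp add: zero_less_mult_iff)
qed

lemma T_weighted_bound:
  fixes f :: "(nat \<Rightarrow> 'e) \<Rightarrow> complex" and B :: real
  assumes f: "continuous_on \<Omega> f" "\<And>x. x \<in> \<Omega> \<Longrightarrow> norm (f x) \<le> B * H x" and x: "x \<in> \<Omega>"
  shows "norm (T f x) \<le> B * (l * H x)"
proof -
  have "norm (T f x) \<le> T (\<lambda>x. norm (f x)) x" by (rule norm_T_le[OF f(1) x])
  also have "\<dots> \<le> T (\<lambda>x. B * H x) x"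
    by (rule T_mono[OF continuous_on_norm[OF f(1)] continuous_on_mult_left[OF H(1)] x f(2)])
  also have "\<dots> = B * (l * H x)" by (simp only: T_cmult eig[OF x])
  finally show ?thesis .
qed

lemma eigenvalue_in_spectrum: "complex_of_real l \<in> transfer_spectrum \<rho> A \<phi>"
proof -
  let ?R = "resolvent_op \<rho> A \<phi> (complex_of_real l)"
  define h where "h = (\<lambda>x\<in>\<Omega>. complex_of_real (H x))"
  define zf where "zf = (\<lambda>x\<in>\<Omega>. 0 :: complex)"
  have "continuous_on \<Omega> h \<longleftrightarrow> continuous_on \<Omega> (\<lambda>x. complex_of_real (H x))"
    by (rule continuous_on_cong) (simp_all add: h_def)
  then have hC: "h \<in> C0 A" using H(1) by (simp add: C0_def h_def continuous_on_of_real)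
  have "continuous_on \<Omega> zf \<longleftrightarrow> continuous_on \<Omega> (\<lambda>x. 0 :: complex)"
    by (rule continuous_on_cong) (simp_all add: zf_def)
  then have zfC: "zf \<in> C0 A" by (simp add: C0_def zf_def)
  have "T h x = complex_of_real (l * H x)" if "x \<in> \<Omega>" for x
    using T_cong[of h "\<lambda>x. complex_of_real (H x)" x] that by (simp add: h_def T_of_real eig)
  then have "?R h = zf" by (auto simp: resolvent_op_def zf_def h_def)
  moreover have "T zf x = 0" if "x \<in> \<Omega>" for x
    using T_cong[of zf "\<lambda>x. 0" x] that by (simp add: zf_def transfer_def)
  then have "?R zf = zf" by (auto simp: resolvent_op_def zf_def)
  moreover have "h \<noteq> zf"
  proof
    assume "h = zf"
    obtain x where x: "x \<in> \<Omega>" using Omega_nonempty by auto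
    then show False using fun_cong[OF \<open>h = zf\<close>, of x] H(2)[OF x] by (simp add: h_def zf_def)
  qed
  ultimately have "\<not> inj_on ?R (C0 A)" using hC zfC by (metis inj_onD)
  then show ?thesis by (simp add: transfer_spectrum_def bij_betw_def)
qed

text \<open>At a maximum point of \<open>norm f / H\<close> the term \<open>T f\<close> is at most
  \<open>l\<close> times \<open>norm f\<close>, so \<open>z * f\<close> exceeds it by a fixed share.
  The bound yields the bounded inverse and, with \<open>E = 0\<close>, also injectivity.\<close>

lemma resolvent_bound:
  assumes z: "cmod z > l"
  shows "\<exists>K. \<forall>f E. continuous_on \<Omega> f \<longrightarrow> (\<forall>x\<in>\<Omega>. norm (z * f x - T f x) \<le> E) \<longrightarrow> (\<forall>y\<in>\<Omega>. norm (f y) \<le> K * E)"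
proof -
  obtain c where c: "c > 0" "\<forall>x\<in>\<Omega>. c \<le> H x" using positive_bounded_below[OF H] by blast
  obtain S where S: "S > 0" "\<forall>x\<in>\<Omega>. norm (H x) \<le> S" using continuous_bounded[OF H(1)] by blast
  define q where "q = cmod z - l"
  have q: "q > 0" using z by (simp add: q_def)
  have "norm (f y) \<le> (S / c / q) * E"
    if f: "continuous_on \<Omega> f" and E: "\<forall>x\<in>\<Omega>. norm (z * f x - T f x) \<le> E" and y: "y \<in> \<Omega>" for f E y
  proof -
    have "continuous_on \<Omega> (\<lambda>x. norm (f x) / H x)"
      using H by (intro continuous_on_divide continuous_on_norm f) force+
    then obtain x where x: "x \<in> \<Omega>" "\<And>y. y \<in> \<Omega> \<Longrightarrow> norm (f y) / H y \<le> norm (f x) / H x"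
      using continuous_attains_sup[OF compact_Omega Omega_nonempty] by meson
    define B where "B = norm (f x) / H x"
    have fB: "norm (f y) \<le> B * H y" if "y \<in> \<Omega>" for y
      using x(2)[OF that] H(2)[OF that] by (simp add: B_def[symmetric] pos_divide_le_eq)
    have BH: "B * H x = norm (f x)" using H(2)[OF x(1)] by (simp add: B_def)
    have "norm (z * f x) \<le> norm (z * f x - T f x) + norm (T f x)" by norm
    also have "\<dots> \<le> E + B * (l * H x)"
      using E x(1) by (intro add_mono T_weighted_bound[OF f fB]) auto
    also have "B * (l * H x) = l * norm (f x)" unfolding BH[symmetric] by simp
    finally have "q * norm (f x) \<le> E" by (simp add: q_def norm_mult algebra_simps)
    then have fx: "norm (f x) \<le> E / q" using q by (simp add: field_simps)
    have "norm (f y) \<le> B * H y" by (rule fB[OF y])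
    also have "\<dots> \<le> (norm (f x) / c) * S"
      unfolding B_def
      using c S y x(1) H(2)[OF x(1)] H(2)[OF y] by (intro mult_mono divide_left_mono) (auto simp: abs_le_iff)
    also have "\<dots> \<le> (E / q / c) * S" using fx c S(1) by (intro mult_right_mono divide_right_mono) auto
    finally show ?thesis by (simp add: mult_ac)
  qed
  then show ?thesis by blast
qed

text \<open>The Neumann series, convergent because \<open>T\<close> has norm at most \<open>l\<close> in the sup norm weighted by \<open>1 / H\<close>.\<close>

lemma resolvent_surj:
  assumes z: "cmod z > l" and g: "continuous_on \<Omega> g"
  shows "\<exists>f. continuous_on \<Omega> f \<and> (\<forall>x\<in>\<Omega>. z * f x - T f x = g x)"
proof -
  have z0: "cmod z > 0" using z eigenvalue_pos by linarith
  then have zn: "z \<noteq> 0" by auto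
  obtain c where c: "c > 0" "\<forall>x\<in>\<Omega>. c \<le> H x" using positive_bounded_below[OF H] by blast
  obtain S where S: "S > 0" "\<forall>x\<in>\<Omega>. norm (H x) \<le> S" using continuous_bounded[OF H(1)] by blast
  obtain F where F: "F > 0" "\<forall>x\<in>\<Omega>. norm (g x) \<le> F" using continuous_bounded[OF g] by blast
  \<comment> \<open>The n-th term of the Neumann series is \<open>(T ^^ n) g / z ^ (n + 1)\<close>,
    written recursively so that continuity and bounds follow by induction.\<close>
  define D where "D n = ((\<lambda>h x. (1 / z) * T h x) ^^ n) (\<lambda>x. (1 / z) * g x)" for n
  have D0: "D 0 = (\<lambda>x. (1 / z) * g x)" and DS: "D (Suc n) = (\<lambda>x. (1 / z) * T (D n) x)" for n
    by (simp_all add: D_def)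
  have Dc: "continuous_on \<Omega> (D n)" for n
  proof (induction n)
    case 0
    show ?case unfolding D0 by (intro continuous_on_mult_left g)
  next
    case (Suc n)
    show ?case unfolding DS by (intro continuous_on_mult_left T_continuous Suc)
  qed
  define q where "q = l / cmod z"
  have q: "0 \<le> q" "q < 1" using z z0 eigenvalue_pos by (auto simp: q_def)
  define B where "B = F / c / cmod z"
  have DB: "norm (D n x) \<le> B * q ^ n * H x" if "x \<in> \<Omega>" for n x
    using that
  proof (induction n arbitrary: x)
    case 0
    have "norm (g x) \<le> F / c * H x"
    proof -
      have "norm (g x) \<le> F / c * c" using F(2) 0 c(1) by simp
      also have "\<dots> \<le> F / c * H x" using c 0 F(1) by (intro mult_left_mono) auto
      finally show ?thesis .
    qed
    then have "norm (g x) / cmod z \<le> F / c * H x / cmod z" using z0 by (intro divide_right_mono) auto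
    then show ?case by (simp add: D0 B_def norm_divide)
  next
    case (Suc n)
    have "norm (T (D n) x) \<le> B * q ^ n * (l * H x)" by (rule T_weighted_bound[OF Dc Suc.IH Suc.prems])
    then have "norm (T (D n) x) / cmod z \<le> B * q ^ n * (l * H x) / cmod z" using z0 by (intro divide_right_mono) auto
    then show ?case by (simp add: DS q_def norm_divide mult_ac)
  qed
  define f where "f = (\<lambda>x. \<Sum>n. D n x)"
  have B0: "B \<ge> 0" using F(1) c(1) by (simp add: B_def)
  have ul: "uniform_limit \<Omega> (\<lambda>n x. \<Sum>i<n. D i x) f sequentially"
    unfolding f_def
  proof (rule Weierstrass_m_test[where M="\<lambda>n. B * q ^ n * S"])
    fix n x assume x: "x \<in> \<Omega>"
    have "B * q ^ n * H x \<le> B * q ^ n * S"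
      using S(2) x B0 q by (intro mult_left_mono) (auto simp: abs_le_iff)
    then show "norm (D n x) \<le> B * q ^ n * S" using DB[OF x, of n] by linarith
  next
    show "summable (\<lambda>n. B * q ^ n * S)"
      using q by (intro summable_mult2 summable_mult summable_geometric) auto
  qed
  have Sc: "continuous_on \<Omega> (\<lambda>x. \<Sum>i<n. D i x)" for n by (intro continuous_on_sum Dc)
  have fc: "continuous_on \<Omega> f"
    by (rule uniform_limit_theorem[OF _ ul]) (simp_all add: Sc)
  have "z * f x - T f x = g x" if x: "x \<in> \<Omega>" for x
  proof -
    have lim: "(\<lambda>n. \<Sum>i<n. D i x) \<longlonglongrightarrow> f x" by (rule tendsto_uniform_limitI[OF ul x])
    have TL: "(\<lambda>n. T (\<lambda>x. \<Sum>i<n. D i x) x) \<longlonglongrightarrow> T f x" by (rule T_uniform_limit[OF ul Sc x])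
    have e: "T (\<lambda>x. \<Sum>i<n. D i x) x = z * (\<Sum>i<Suc n. D i x) - g x" for n
    proof -
      have "T (D i) x = z * D (Suc i) x" for i using zn by (simp add: DS)
      then have "T (\<lambda>x. \<Sum>i<n. D i x) x = z * (\<Sum>i<n. D (Suc i) x)"
        unfolding T_sum[of D, OF Dc x] by (simp add: sum_distrib_left)
      moreover have "z * D 0 x = g x" using zn by (simp add: D0)
      ultimately show ?thesis
        unfolding sum.lessThan_Suc_shift by (simp add: distrib_left)
    qed
    have "(\<lambda>n. z * (\<Sum>i<Suc n. D i x) - g x) \<longlonglongrightarrow> z * f x - g x"
      by (rule tendsto_diff[OF tendsto_mult_left[OF LIMSEQ_Suc[OF lim]] tendsto_const])
    then have "T f x = z * f x - g x" using LIMSEQ_unique[OF TL] unfolding e by blast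
    then show ?thesis by simp
  qed
  then show ?thesis using fc by blast
qed

lemma not_in_spectrum:
  assumes z: "cmod z > l" shows "z \<notin> transfer_spectrum \<rho> A \<phi>"
proof -
  let ?R = "resolvent_op \<rho> A \<phi> z"
  obtain K where K: "\<And>f E y. continuous_on \<Omega> f \<Longrightarrow> (\<forall>x\<in>\<Omega>. norm (z * f x - T f x) \<le> E) \<Longrightarrow> y \<in> \<Omega> \<Longrightarrow>
      norm (f y) \<le> K * E" using resolvent_bound[OF z] by meson
  have C0D: "continuous_on \<Omega> f" "f \<in> extensional \<Omega>" if "f \<in> C0 A" for f :: "(nat \<Rightarrow> 'e) \<Rightarrow> complex"
    using that by (simp_all add: C0_def)
  have Rx: "?R f x = z * f x - T f x" if "x \<in> \<Omega>" for f x using that by (simp add: resolvent_op_def)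
  have restr: "continuous_on \<Omega> (restrict f \<Omega>) \<longleftrightarrow> continuous_on \<Omega> f" for f :: "(nat \<Rightarrow> 'e) \<Rightarrow> complex"
    by (rule continuous_on_cong) simp_all
  have RC: "?R f \<in> C0 A" if "f \<in> C0 A" for f
    unfolding C0_def resolvent_op_def
    using C0D(1)[OF that] by (simp add: restr continuous_on_diff continuous_on_mult_left T_continuous)
  have "inj_on ?R (C0 A)"
  proof (rule inj_onI)
    fix f g assume f: "f \<in> C0 A" and g: "g \<in> C0 A" and eq: "?R f = ?R g"
    note fg = C0D(1)[OF f] C0D(1)[OF g]
    have "z * (f x - g x) - T (\<lambda>x. f x - g x) x = 0" if x: "x \<in> \<Omega>" for x
      using fun_cong[OF eq, of x] unfolding Rx[OF x] T_diff[OF fg x] by (simp add: algebra_simps)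
    then have "norm (f y - g y) \<le> K * 0" if "y \<in> \<Omega>" for y
      using that by (intro K continuous_on_diff fg) auto
    then show "f = g" using C0D(2)[OF f] C0D(2)[OF g] by (intro extensionalityI[of _ \<Omega>]) auto
  qed
  moreover have "?R ` C0 A = C0 A"
  proof
    show "?R ` C0 A \<subseteq> C0 A" using RC by blast
    show "C0 A \<subseteq> ?R ` C0 A"
    proof
      fix g :: "(nat \<Rightarrow> 'e) \<Rightarrow> complex" assume g: "g \<in> C0 A"
      obtain f where f: "continuous_on \<Omega> f" "\<forall>x\<in>\<Omega>. z * f x - T f x = g x"
        using resolvent_surj[OF z C0D(1)[OF g]] by blast
      let ?f = "restrict f \<Omega>"
      have "?f \<in> C0 A" using f(1) by (simp add: C0_def restr)
      moreover have "?R ?f = g"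
      proof (rule extensionalityI[of _ \<Omega>])
        fix x assume x: "x \<in> \<Omega>"
        have "T ?f x = T f x" by (rule T_cong) (simp_all add: x)
        then show "?R ?f x = g x" using f(2) x by (simp add: Rx)
      qed (use C0D(2)[OF g] in \<open>simp_all add: resolvent_op_def\<close>)
      ultimately show "g \<in> ?R ` C0 A" by blast
    qed
  qed
  moreover have "sup_norm A f \<le> K * sup_norm A (?R f)" if f: "f \<in> C0 A" for f
  proof (rule sup_norm_le, rule K[OF C0D(1)[OF f]], intro ballI)
    fix x assume x: "x \<in> \<Omega>"
    show "norm (z * f x - T f x) \<le> sup_norm A (?R f)"
      using norm_le_sup_norm[OF C0D(1)[OF RC[OF f]] x] unfolding Rx[OF x] .
  qed
  ultimately show ?thesis by (auto simp: transfer_spectrum_def bij_betw_def)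
qed

lemma spec_rad_eqI: "spec_rad \<rho> A \<phi> = l"
  unfolding spec_rad_def
proof (rule cSup_eq_maximum)
  show "l \<in> cmod ` transfer_spectrum \<rho> A \<phi>"
    using eigenvalue_in_spectrum eigenvalue_pos by (intro image_eqI[of _ _ "complex_of_real l"]) auto
  fix x assume "x \<in> cmod ` transfer_spectrum \<rho> A \<phi>"
  then show "x \<le> l" using not_in_spectrum by (auto simp: not_less[symmetric])
qed

end

section \<open>Identification of the spectral radius, conformal measure and eigenfunction\<close>

lemma spec_rad_lam: "spec_rad \<rho> A \<phi> = lam"
  by (rule spec_rad_eqI[OF G_continuous G_pos G_eigen])

lemma ex_conformal: "\<exists>\<nu>\<in>prob_Omega A. \<forall>f. continuous_on \<Omega> f \<longrightarrow> (LINT x|\<nu>. f x) = Lam f"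
  using Lam.representing_measure by (simp add: prob_Omega_def Bex_def conj_assoc)

text \<open>Iterating \<open>inv\<close>, the integral of \<open>h w\<close> is \<open>lam ^ (- k)\<close> times that of \<open>((T ^^ k) h) w\<close>, and \<open>(T ^^ k) h\<close>
  is uniformly close to \<open>Lam h\<close> times \<open>I k\<close>.\<close>

lemma eigenfunctional_unique:
  assumes \<mu>: "\<mu> \<in> prob_Omega A" and w: "continuous_on \<Omega> w" "\<And>x. x \<in> \<Omega> \<Longrightarrow> w x \<ge> 0"
    and inv: "\<And>h. h \<in> Lip_Omega A \<Longrightarrow> (LINT x|\<mu>. T h x * w x) = lam * (LINT x|\<mu>. h x * w x)"
    and h: "h \<in> Lip_Omega A"
  shows "(LINT x|\<mu>. h x * w x) = Lam h * (LINT x|\<mu>. w x)"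
proof -
  define m where "m f = (LINT x|\<mu>. f x * w x)" for f :: "(nat \<Rightarrow> 'e) \<Rightarrow> real"
  have int: "integrable \<mu> (\<lambda>x. f x * w x)" if "continuous_on \<Omega> f" for f :: "(nat \<Rightarrow> 'e) \<Rightarrow> real"
    by (intro integrable_continuous[OF \<mu>] continuous_on_mult that w)
  have sp: "space \<mu> = \<Omega>" by (rule prob_OmegaD[OF \<mu>])
  have itL: "(T ^^ k) f \<in> Lip_Omega A" if "f \<in> Lip_Omega A" for f k
    by (induction k) (simp_all add: that T_Lip)
  have mk: "m ((T ^^ k) f) = lam ^ k * m f" if "f \<in> Lip_Omega A" for f k
    using inv[OF itL[OF that]] by (induction k) (simp_all add: m_def)
  note hc = Lip_continuous[OF h]
  have m1: "m (\<lambda>x. 1) = (LINT x|\<mu>. w x)" by (simp add: m_def)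
  have m0: "m (\<lambda>x. 1) \<ge> 0" unfolding m1 using w(2) sp by (intro Bochner_Integration.integral_nonneg) simp
  have "\<bar>m h - Lam h * m (\<lambda>x. 1)\<bar> \<le> 0"
  proof (rule field_le_epsilon)
    fix e :: real assume e: "e > 0"
    define e' where "e' = e / (m (\<lambda>x. 1) + 1)"
    have e': "e' > 0" "e' * m (\<lambda>x. 1) \<le> e" using e m0 by (simp_all add: e'_def field_simps)
    obtain k where k: "\<forall>x\<in>\<Omega>. \<bar>(T ^^ k) h x - Lam h * I k x\<bar> \<le> e' * I k x"
      using conv_Lam[OF hc, unfolded conv_def, rule_format, OF e'(1)] by blast
    have c: "continuous_on \<Omega> (\<lambda>x. Lam h * I k x)" by (intro continuous_on_mult_left I_continuous)
    have i0: "integrable \<mu> (\<lambda>x. I k x * w x)" by (rule int[OF I_continuous])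
    have i1: "integrable \<mu> (\<lambda>x. (T ^^ k) h x * w x)" by (rule int[OF iter_continuous[OF hc]])
    have i2: "integrable \<mu> (\<lambda>x. Lam h * (I k x * w x))" by (rule integrable_mult_right) (rule i0)
    have eq: "m ((T ^^ k) h) - Lam h * m (I k) = (LINT x|\<mu>. (T ^^ k) h x * w x - Lam h * (I k x * w x))"
      unfolding m_def Bochner_Integration.integral_diff[OF i1 i2] by simp
    have "\<bar>m ((T ^^ k) h) - Lam h * m (I k)\<bar> \<le> (LINT x|\<mu>. \<bar>(T ^^ k) h x * w x - Lam h * (I k x * w x)\<bar>)"
      unfolding eq by (rule integral_abs_bound)
    also have "\<dots> \<le> (LINT x|\<mu>. e' * (I k x * w x))"
    proof (rule integral_mono)
      show "integrable \<mu> (\<lambda>x. \<bar>(T ^^ k) h x * w x - Lam h * (I k x * w x)\<bar>)"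
        by (rule integrable_abs[OF Bochner_Integration.integrable_diff[OF i1 i2]])
      show "integrable \<mu> (\<lambda>x. e' * (I k x * w x))" by (rule integrable_mult_right) (rule i0)
      fix x assume "x \<in> space \<mu>"
      then have x: "x \<in> \<Omega>" by (simp add: sp)
      have "\<bar>(T ^^ k) h x * w x - Lam h * (I k x * w x)\<bar> = \<bar>(T ^^ k) h x - Lam h * I k x\<bar> * w x"
        using w(2)[OF x] abs_mult[of "(T ^^ k) h x - Lam h * I k x" "w x"] by (simp add: left_diff_distrib mult.assoc)
      also have "\<dots> \<le> e' * I k x * w x" using k x w(2)[OF x] by (intro mult_right_mono) auto
      finally show "\<bar>(T ^^ k) h x * w x - Lam h * (I k x * w x)\<bar> \<le> e' * (I k x * w x)" by (simp add: mult.assoc)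
    qed
    also have "\<dots> = e' * m (I k)" by (simp add: m_def)
    finally have "\<bar>lam ^ k * (m h - Lam h * m (\<lambda>x. 1))\<bar> \<le> lam ^ k * (e' * m (\<lambda>x. 1))"
      unfolding mk[OF h] mk[OF Lip_const] by (simp add: algebra_simps)
    then have "lam ^ k * \<bar>m h - Lam h * m (\<lambda>x. 1)\<bar> \<le> lam ^ k * (e' * m (\<lambda>x. 1))"
      using lam_pos by (simp add: abs_mult)
    then have "\<bar>m h - Lam h * m (\<lambda>x. 1)\<bar> \<le> e' * m (\<lambda>x. 1)" using lam_pos by simp
    then show "\<bar>m h - Lam h * m (\<lambda>x. 1)\<bar> \<le> 0 + e" using e'(2) by linarith
  qed
  then show ?thesis by (simp add: m_def[symmetric] m1[symmetric])
qed

lemma restrict_C0: "continuous_on \<Omega> f \<Longrightarrow> restrict f \<Omega> \<in> C0 A"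
  for f :: "(nat \<Rightarrow> 'e) \<Rightarrow> 'b::real_normed_vector"
  using continuous_on_cong[of \<Omega> \<Omega> "restrict f \<Omega>" f] by (simp add: C0_def)

lemma integral_cong_Omega: "\<mu> \<in> prob_Omega A \<Longrightarrow> (\<And>x. x \<in> \<Omega> \<Longrightarrow> f x = g x) \<Longrightarrow> (LINT x|\<mu>. f x) = (LINT x|\<mu>. g x)"
  by (rule Bochner_Integration.integral_cong[OF refl]) (simp add: prob_OmegaD(3))

lemma conformal_measure:
  shows conformal_prob: "conformal_measure \<rho> A \<phi> \<in> prob_Omega A"
    and conformal_integral: "continuous_on \<Omega> f \<Longrightarrow> (LINT x|conformal_measure \<rho> A \<phi>. f x) = Lam f"
proof -
  obtain \<nu> where \<nu>: "\<nu> \<in> prob_Omega A" "\<And>f. continuous_on \<Omega> f \<Longrightarrow> (LINT x|\<nu>. f x) = Lam f"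
    using ex_conformal by blast
  have "conformal_measure \<rho> A \<phi> = \<nu>"
    unfolding conformal_measure_def spec_rad_lam
  proof (rule the_equality, intro conjI allI impI \<nu>(1))
    fix f :: "(nat \<Rightarrow> 'e) \<Rightarrow> real" assume "f \<in> C0 A"
    then have f: "continuous_on \<Omega> f" by (simp add: C0_def)
    show "(LINT x|\<nu>. T f x) = lam * (LINT x|\<nu>. f x)"
      by (simp only: \<nu>(2)[OF T_continuous[OF f]] \<nu>(2)[OF f] Lam_T[OF f])
  next
    fix \<kappa> assume "\<kappa> \<in> prob_Omega A \<and> (\<forall>f :: (nat \<Rightarrow> 'e) \<Rightarrow> real. f \<in> C0 A \<longrightarrow>
      (LINT x|\<kappa>. T f x) = lam * (LINT x|\<kappa>. f x))"
    then have \<kappa>: "\<kappa> \<in> prob_Omega A"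
      and inv: "\<And>f :: (nat \<Rightarrow> 'e) \<Rightarrow> real. f \<in> C0 A \<Longrightarrow> (LINT x|\<kappa>. T f x) = lam * (LINT x|\<kappa>. f x)" by auto
    interpret prob_space \<kappa> by (rule prob_OmegaD[OF \<kappa>])
    \<comment> \<open>The defining property tests only extensional functions, so a Lipschitz
      \<open>h\<close> is restricted to \<open>\<Omega>\<close> first; \<open>T_cong\<close> shows
      that \<open>T\<close> does not notice.\<close>
    have inv': "(LINT x|\<kappa>. T h x * 1) = lam * (LINT x|\<kappa>. h x * 1)" if h: "h \<in> Lip_Omega A" for h
    proof -
      have "(LINT x|\<kappa>. T h x) = (LINT x|\<kappa>. T (restrict h \<Omega>) x)"
        by (rule integral_cong_Omega[OF \<kappa>]) (rule T_cong, simp_all)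
      also have "\<dots> = lam * (LINT x|\<kappa>. restrict h \<Omega> x)" by (rule inv[OF restrict_C0[OF Lip_continuous[OF h]]])
      also have "(LINT x|\<kappa>. restrict h \<Omega> x) = (LINT x|\<kappa>. h x)" by (rule integral_cong_Omega[OF \<kappa>]) simp
      finally show ?thesis by simp
    qed
    show "\<kappa> = \<nu>"
    proof (rule prob_Omega_eqI[OF \<kappa> \<nu>(1)])
      fix f assume f: "f \<in> Lip_Omega A"
      have "(LINT x|\<kappa>. f x * 1) = Lam f * (LINT x|\<kappa>. 1)"
        by (rule eigenfunctional_unique[OF \<kappa> continuous_on_const _ inv' f]) simp
      then show "(LINT x|\<kappa>. f x) = (LINT x|\<nu>. f x)" by (simp add: prob_space \<nu>(2)[OF Lip_continuous[OF f]])
    qed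
  qed
  then show "conformal_measure \<rho> A \<phi> \<in> prob_Omega A"
    "continuous_on \<Omega> f \<Longrightarrow> (LINT x|conformal_measure \<rho> A \<phi>. f x) = Lam f" using \<nu> by simp_all
qed

lemma eigenfunction_eq: "x \<in> \<Omega> \<Longrightarrow> eigenfunction \<rho> A \<phi> x = G x"
proof -
  have "eigenfunction \<rho> A \<phi> = restrict G \<Omega>"
    unfolding eigenfunction_def spec_rad_lam
  proof (rule the_equality, intro conjI ballI)
    show "restrict G \<Omega> \<in> extensional \<Omega>" by simp
    show "restrict G \<Omega> \<in> Lip_Omega A" using G_Lip by (simp add: Lip_Omega_def)
    show "restrict G \<Omega> x > 0" if "x \<in> \<Omega>" for x using G_pos[OF that] that by simp
    show "T (restrict G \<Omega>) x = lam * restrict G \<Omega> x" if "x \<in> \<Omega>" for x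
      using T_cong[of "restrict G \<Omega>" G x] G_eigen[OF that] that by simp
    have "(LINT x|conformal_measure \<rho> A \<phi>. restrict G \<Omega> x) = (LINT x|conformal_measure \<rho> A \<phi>. G x)"
      by (rule integral_cong_Omega[OF conformal_prob]) simp
    then show "(LINT x|conformal_measure \<rho> A \<phi>. restrict G \<Omega> x) = 1"
      by (simp only: conformal_integral[OF G_continuous] Lam_G)
  next
    fix F assume *: "F \<in> extensional \<Omega> \<and> F \<in> Lip_Omega A \<and> (\<forall>x\<in>\<Omega>. F x > 0) \<and>
      (\<forall>x\<in>\<Omega>. T F x = lam * F x) \<and> (LINT x|conformal_measure \<rho> A \<phi>. F x) = 1"
    then have Fc: "continuous_on \<Omega> F" using Lip_continuous by blast
    have LF: "Lam F = 1" using * conformal_integral[OF Fc] by simp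
    \<comment> \<open>For a competing eigenfunction the ratios are \<open>F x / Gn k x\<close>; they
      tend both to \<open>Lam F = 1\<close> and to \<open>F x / G x\<close>.\<close>
    have it: "(T ^^ k) F x = lam ^ k * F x" if "x \<in> \<Omega>" for k x
      by (rule iter_eigen[OF _ that]) (use * in simp)
    show "F = restrict G \<Omega>"
    proof (rule extensionalityI[of _ \<Omega>])
      fix x assume x: "x \<in> \<Omega>"
      have "(T ^^ k) F x / I k x = F x / Gn k x" for k
        using lam_pos by (simp add: it[OF x] Gn_def)
      then have "(\<lambda>k. F x / Gn k x) \<longlonglongrightarrow> 1" using Lam_tendsto[OF Fc x] by (simp add: LF)
      moreover have "(\<lambda>k. F x / Gn k x) \<longlonglongrightarrow> F x / G x"
        using G_pos[OF x] by (intro tendsto_divide tendsto_const G_tendsto x) simp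
      ultimately have "F x / G x = 1" using LIMSEQ_unique by blast
      then show "F x = restrict G \<Omega> x" using G_pos[OF x] x by (simp add: field_simps)
    qed (use * in simp_all)
  qed
  then show "x \<in> \<Omega> \<Longrightarrow> eigenfunction \<rho> A \<phi> x = G x" by simp
qed

section \<open>The Gibbs measure and its shift invariance\<close>

abbreviation gibbs :: "(nat \<Rightarrow> 'e) measure" where "gibbs \<equiv> gibbs_measure \<rho> A \<phi>"

lemma sets_gibbs: "sets gibbs = sets (restrict_space borel \<Omega>)"
  using prob_OmegaD(2)[OF conformal_prob] by (simp add: gibbs_measure_def)

lemma eigenfunction_meas: "eigenfunction \<rho> A \<phi> \<in> borel_measurable (conformal_measure \<rho> A \<phi>)"
proof -
  have "eigenfunction \<rho> A \<phi> \<in> borel_measurable (conformal_measure \<rho> A \<phi>) \<longleftrightarrow>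
      G \<in> borel_measurable (conformal_measure \<rho> A \<phi>)"
    by (rule measurable_cong) (simp add: prob_OmegaD(3)[OF conformal_prob] eigenfunction_eq)
  then show ?thesis using measurable_continuous[OF conformal_prob G_continuous] by simp
qed

lemma gibbs_integral:
  fixes f :: "(nat \<Rightarrow> 'e) \<Rightarrow> real"
  assumes f: "continuous_on \<Omega> f" shows "(LINT x|gibbs. f x) = Lam (\<lambda>x. G x * f x)"
proof -
  let ?\<nu> = "conformal_measure \<rho> A \<phi>"
  have sp: "space ?\<nu> = \<Omega>" by (rule prob_OmegaD(3)[OF conformal_prob])
  have "(LINT x|gibbs. f x) = (LINT x|?\<nu>. eigenfunction \<rho> A \<phi> x *\<^sub>R f x)"
    unfolding gibbs_measure_def
  proof (rule integral_density[OF measurable_continuous[OF conformal_prob f] eigenfunction_meas])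
    show "AE x in ?\<nu>. 0 \<le> eigenfunction \<rho> A \<phi> x"
      by (rule AE_I2) (simp add: sp eigenfunction_eq G_pos less_imp_le)
  qed
  also have "\<dots> = (LINT x|?\<nu>. G x * f x)"
    by (rule integral_cong_Omega[OF conformal_prob]) (simp add: eigenfunction_eq)
  also have "\<dots> = Lam (\<lambda>x. G x * f x)"
    by (intro conformal_integral continuous_on_mult G_continuous f)
  finally show ?thesis .
qed

lemma gibbs_prob: "gibbs \<in> prob_Omega A"
proof -
  let ?\<nu> = "conformal_measure \<rho> A \<phi>"
  have sp: "space ?\<nu> = \<Omega>" by (rule prob_OmegaD(3)[OF conformal_prob])
  have "emeasure gibbs (space gibbs) = (\<integral>\<^sup>+x. ennreal (eigenfunction \<rho> A \<phi> x) * indicator (space ?\<nu>) x \<partial>?\<nu>)"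
    unfolding gibbs_measure_def using eigenfunction_meas by (subst emeasure_density) simp_all
  also have "\<dots> = (\<integral>\<^sup>+x. ennreal (G x) \<partial>?\<nu>)"
    by (rule nn_integral_cong) (simp add: sp eigenfunction_eq)
  also have "\<dots> = ennreal (LINT x|?\<nu>. G x)"
    by (rule nn_integral_eq_integral[OF integrable_continuous[OF conformal_prob G_continuous]])
      (rule AE_I2, simp add: sp G_pos less_imp_le)
  also have "\<dots> = 1" by (simp add: conformal_integral[OF G_continuous] Lam_G)
  finally have "prob_space gibbs" by (rule prob_spaceI)
  then show ?thesis using sets_gibbs by (simp add: prob_Omega_def)
qed

end

context shift_space
begin

lemma shift_measurable: "\<mu> \<in> prob_Omega A \<Longrightarrow> shift \<in> measurable \<mu> \<mu>"
proof -
  assume \<mu>: "\<mu> \<in> prob_Omega A"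
  have "shift \<in> measurable borel (borel :: (nat \<Rightarrow> 'e) measure)"
    by (rule borel_measurable_continuous_onI[OF continuous_shift])
  then have "shift \<in> measurable (restrict_space borel \<Omega>) (restrict_space borel \<Omega>)"
    by (intro measurable_restrict_space2 measurable_restrict_space1)
      (simp_all add: space_restrict_space shift_Omega)
  then show ?thesis by (simp add: measurable_cong_sets[OF prob_OmegaD(2)[OF \<mu>] prob_OmegaD(2)[OF \<mu>]])
qed

lemma distr_shift_prob: assumes \<mu>: "\<mu> \<in> prob_Omega A" shows "distr \<mu> \<mu> shift \<in> prob_Omega A"
  using prob_space.prob_space_distr[OF prob_OmegaD(1)[OF \<mu>] shift_measurable[OF \<mu>]] prob_OmegaD(2)[OF \<mu>]
  by (simp add: prob_Omega_def)

lemma integral_distr_shift: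
  fixes f :: "(nat \<Rightarrow> 'e) \<Rightarrow> real"
  assumes \<mu>: "\<mu> \<in> prob_Omega A" and f: "continuous_on \<Omega> f"
  shows "(LINT x|distr \<mu> \<mu> shift. f x) = (LINT x|\<mu>. f (shift x))"
  by (rule integral_distr[OF shift_measurable[OF \<mu>] measurable_continuous[OF \<mu> f]])

lemma M_sigmaD:
  fixes f :: "(nat \<Rightarrow> 'e) \<Rightarrow> real"
  assumes "\<mu> \<in> M_sigma A"
  shows "\<mu> \<in> prob_Omega A"
    "continuous_on \<Omega> f \<Longrightarrow> (LINT x|\<mu>. f (shift x)) = (LINT x|\<mu>. f x)"
  using assms integral_distr_shift[of \<mu> f] by (simp_all add: M_sigma_def)

lemma M_sigmaI:
  assumes \<mu>: "\<mu> \<in> prob_Omega A"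
    and inv: "\<And>f :: (nat \<Rightarrow> 'e) \<Rightarrow> real. continuous_on \<Omega> f \<Longrightarrow> (LINT x|\<mu>. f (shift x)) = (LINT x|\<mu>. f x)"
  shows "\<mu> \<in> M_sigma A"
proof -
  have "distr \<mu> \<mu> shift = \<mu>"
    by (rule prob_Omega_eqI[OF distr_shift_prob[OF \<mu>] \<mu>])
      (simp only: integral_distr_shift[OF \<mu> Lip_continuous] inv[OF Lip_continuous])
  then show ?thesis using \<mu> by (simp add: M_sigma_def)
qed

end

context potential
begin

lemma T_mult_shift: "T (\<lambda>x. g x * f (shift x)) \<omega> = T g \<omega> * f \<omega>" for f :: "(nat \<Rightarrow> 'e) \<Rightarrow> real"
  unfolding transfer_def by (simp add: mult.assoc[symmetric])

text \<open>\<open>T_mult_shift\<close> pulls a shifted factor out of \<open>T\<close>; together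
  with the eigenfunction equation for \<open>G\<close> and the eigenfunctional equation for
  \<open>Lam\<close>, both sides acquire the same factor \<open>lam\<close>.\<close>

lemma gibbs_M_sigma: "gibbs \<in> M_sigma A"
proof (rule M_sigmaI[OF gibbs_prob])
  fix f :: "(nat \<Rightarrow> 'e) \<Rightarrow> real" assume f: "continuous_on \<Omega> f"
  note fs = continuous_on_shift_comp[OF f]
  have c: "continuous_on \<Omega> (\<lambda>x. G x * f (shift x))" and c': "continuous_on \<Omega> (\<lambda>x. G x * f x)"
    by (intro continuous_on_mult G_continuous fs f)+
  have "lam * Lam (\<lambda>x. G x * f (shift x)) = Lam (T (\<lambda>x. G x * f (shift x)))" by (rule Lam_T[OF c, symmetric])
  also have "\<dots> = Lam (\<lambda>x. lam * (G x * f x))"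
    by (rule Lam.cong[OF T_continuous[OF c] continuous_on_mult_left[OF c']]) (simp add: T_mult_shift G_eigen)
  also have "\<dots> = lam * Lam (\<lambda>x. G x * f x)" by (rule Lam.scale[OF c'])
  finally show "(LINT x|gibbs. f (shift x)) = (LINT x|gibbs. f x)"
    using lam_pos by (simp add: gibbs_integral[OF fs] gibbs_integral[OF f])
qed

end

section \<open>Equilibrium states\<close>

context potential
begin

text \<open>Jensen's inequality for the operator \<open>\<lambda>f. T (G f) / (lam G)\<close>, which is Markov and preserves the
  Gibbs measure.\<close>

lemma ln_eigenvalue_subgradient:
  assumes \<kappa>: "\<kappa> \<in> Lip_Omega A"
  shows "ln lam + (LINT x|gibbs. \<kappa> x) - (LINT x|gibbs. \<phi> x) \<le> ln (spec_rad \<rho> A \<kappa>)"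
proof -
  interpret K: potential \<rho> A \<kappa> by unfold_locales (rule \<kappa>)
  define u where "u x = ln (K.G x) - ln (G x)" for x
  define v where "v x = \<kappa> x - \<phi> x + u x" for x
  have uc: "continuous_on \<Omega> u"
    unfolding u_def using K.G_pos G_pos
    by (intro continuous_on_diff continuous_on_ln K.G_continuous G_continuous) force+
  have vc: "continuous_on \<Omega> v"
    unfolding v_def by (intro continuous_on_add continuous_on_diff uc Lip_continuous \<kappa> \<phi>_Lip)
  have Gv: "continuous_on \<Omega> (\<lambda>x. G x * v x)" by (intro continuous_on_mult G_continuous vc)
  define c where "c \<omega> = T (\<lambda>x. G x * v x) \<omega> / (lam * G \<omega>)" for \<omega>
  have cc: "continuous_on \<Omega> c"
    unfolding c_def using lam_pos G_pos
    by (intro continuous_on_divide continuous_on_mult_left T_continuous Gv G_continuous) force+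
  \<comment> \<open>\<open>v\<close> is the logarithm of the weight that rewrites the operator of
    \<open>\<kappa>\<close> on its own eigenfunction through the operator of \<open>\<phi>\<close>
    on \<open>G\<close>.\<close>
  have KT: "K.T K.G \<omega> = T (\<lambda>x. G x * exp (v x)) \<omega>" if \<omega>: "\<omega> \<in> \<Omega>" for \<omega>
    unfolding transfer_def
  proof (rule Bochner_Integration.integral_cong[OF refl])
    fix t
    let ?y = "case_nat t \<omega>"
    show "(exp (\<kappa> ?y) * A t (\<omega> 0)) *\<^sub>R K.G ?y = (exp (\<phi> ?y) * A t (\<omega> 0)) *\<^sub>R (G ?y * exp (v ?y))"
    proof (cases rule: A_cases[of t "\<omega> 0"])
      case 2
      then have y: "?y \<in> \<Omega>" using \<omega> by (simp add: case_nat_Omega)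
      have "exp (v ?y) = exp (\<kappa> ?y) / exp (\<phi> ?y) * (K.G ?y / G ?y)"
        using K.G_pos[OF y] G_pos[OF y] by (simp add: v_def u_def exp_add exp_diff)
      then show ?thesis using 2 G_pos[OF y] by simp
    qed simp
  qed
  have "c \<omega> \<le> ln K.lam - ln lam + u \<omega>" if \<omega>: "\<omega> \<in> \<Omega>" for \<omega>
  proof -
    \<comment> \<open>The conditional mean of \<open>v\<close>. Jensen's inequality is the tangent
      line of \<open>exp\<close> at this point, whose linear term averages to zero.\<close>
    define a where "a = c \<omega>"
    note pos = lam_pos G_pos[OF \<omega>] K.lam_pos K.G_pos[OF \<omega>]
    have "T (\<lambda>x. G x * v x) \<omega> = a * (lam * G \<omega>)" using pos by (simp add: a_def c_def)
    moreover have "T (\<lambda>x. (1 - a) * G x + G x * v x) \<omega> = T (\<lambda>x. (1 - a) * G x) \<omega> + T (\<lambda>x. G x * v x) \<omega>"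
      by (intro T_add continuous_on_mult_left G_continuous Gv \<omega>)
    ultimately have "T (\<lambda>x. (1 - a) * G x + G x * v x) \<omega> = lam * G \<omega>"
      unfolding T_cmult G_eigen[OF \<omega>] by (simp add: algebra_simps)
    then have "exp a * (lam * G \<omega>) = T (\<lambda>x. exp a * ((1 - a) * G x + G x * v x)) \<omega>"
      by (simp only: T_cmult)
    also have "\<dots> \<le> T (\<lambda>x. G x * exp (v x)) \<omega>"
    proof (intro T_mono continuous_on_mult_left continuous_on_add continuous_on_mult continuous_on_exp
        G_continuous vc \<omega>)
      fix x assume x: "x \<in> \<Omega>"
      have "exp a * (1 + (v x - a)) \<le> exp a * exp (v x - a)" by (intro mult_left_mono exp_ge_add_one_self) simp
      then have "exp a * (1 + (v x - a)) \<le> exp (v x)" by (simp add: exp_diff)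
      then have "G x * (exp a * (1 + (v x - a))) \<le> G x * exp (v x)"
        using G_pos[OF x] by (intro mult_left_mono) simp_all
      then show "exp a * ((1 - a) * G x + G x * v x) \<le> G x * exp (v x)" by (simp add: algebra_simps)
    qed
    also have "\<dots> = K.lam * K.G \<omega>" unfolding KT[OF \<omega>, symmetric] by (rule K.G_eigen[OF \<omega>])
    finally have "ln (exp a * (lam * G \<omega>)) \<le> ln (K.lam * K.G \<omega>)" using pos by (intro ln_mono) simp_all
    then show ?thesis using pos by (simp add: a_def u_def ln_mult)
  qed
  then have "(LINT x|gibbs. c x) \<le> (LINT x|gibbs. (ln K.lam - ln lam) + u x)"
    by (intro integral_mono integrable_continuous[OF gibbs_prob] cc continuous_on_add continuous_on_const uc)
      (simp add: prob_OmegaD(3)[OF gibbs_prob])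
  moreover have "(LINT x|gibbs. (ln K.lam - ln lam) + u x) = (ln K.lam - ln lam) + (LINT x|gibbs. u x)"
  proof -
    interpret prob_space gibbs by (rule prob_OmegaD(1)[OF gibbs_prob])
    show ?thesis using integrable_continuous[OF gibbs_prob uc] by (simp add: prob_space)
  qed
  moreover have "(LINT x|gibbs. c x) = (LINT x|gibbs. v x)"
  proof -
    \<comment> \<open>Averaging by the Markov operator does not change the Gibbs integral, so
      \<open>c\<close> and \<open>v\<close> have the same mean.\<close>
    have "lam * Lam (\<lambda>x. G x * c x) = Lam (\<lambda>x. lam * (G x * c x))"
      by (rule Lam.scale[symmetric]) (intro continuous_on_mult G_continuous cc)
    also have "\<dots> = Lam (T (\<lambda>x. G x * v x))"
    proof (rule Lam.cong)
      fix x assume x: "x \<in> \<Omega>"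
      show "lam * (G x * c x) = T (\<lambda>x. G x * v x) x" using lam_pos G_pos[OF x] by (simp add: c_def)
    qed (intro continuous_on_mult_left continuous_on_mult G_continuous cc T_continuous Gv)+
    also have "\<dots> = lam * Lam (\<lambda>x. G x * v x)" by (rule Lam_T[OF Gv])
    finally show ?thesis using lam_pos by (simp add: gibbs_integral[OF cc] gibbs_integral[OF vc])
  qed
  moreover have "(LINT x|gibbs. v x) = (LINT x|gibbs. \<kappa> x) - (LINT x|gibbs. \<phi> x) + (LINT x|gibbs. u x)"
    unfolding v_def
    using integrable_continuous[OF gibbs_prob uc] integrable_continuous[OF gibbs_prob Lip_continuous[OF \<kappa>]]
      integrable_continuous[OF gibbs_prob Lip_continuous[OF \<phi>_Lip]] by simp
  ultimately show ?thesis by (simp add: K.spec_rad_lam)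
qed

text \<open>\<open>tangent\<close> says that \<open>\<phi>\<close> attains the infimum defining the
  entropy of \<open>\<mu>\<close>; equivalently, \<open>\<mu>\<close> is a subgradient at
  \<open>\<phi>\<close> of the logarithm of the spectral radius.\<close>

context
  fixes \<mu>
  assumes \<mu>: "\<mu> \<in> M_sigma A"
    and tangent: "\<And>\<kappa>. \<kappa> \<in> Lip_Omega A \<Longrightarrow> ln lam - (LINT x|\<mu>. \<phi> x) \<le> ln (spec_rad \<rho> A \<kappa>) - (LINT x|\<mu>. \<kappa> x)"
begin

lemmas \<mu>_prob = M_sigmaD(1)[OF \<mu>]

text \<open>The potential \<open>\<phi> + ln h - ln (T h \<circ> shift)\<close> is normalised: its transfer operator fixes \<open>1\<close>.\<close>

lemma donsker_varadhan:
  assumes h: "h \<in> Lip_Omega A" "\<And>x. x \<in> \<Omega> \<Longrightarrow> h x > 0"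
  shows "ln lam \<le> (LINT x|\<mu>. ln (T h x)) - (LINT x|\<mu>. ln (h x))"
proof -
  have Tpos: "T h x > 0" if x: "x \<in> \<Omega>" for x
  proof -
    obtain s where s: "A s (x 0) = 1" using ex_pred by blast
    show ?thesis
      by (rule T_pos[OF Lip_continuous[OF h(1)] less_imp_le[OF h(2)] x, of s])
        (use s x in \<open>simp_all add: h(2) case_nat_Omega\<close>)
  qed
  \<comment> \<open>At a prefixed point the shifted term is \<open>T h \<omega>\<close>, which is
    independent of the prefix and can be taken out of the integral.\<close>
  define \<kappa> where "\<kappa> = (\<lambda>x. (\<phi> x + ln (h x)) - ln (T h (shift x)))"
  have L1: "(\<lambda>x. ln (h x)) \<in> Lip_Omega A" by (rule Lip_ln[OF h])
  have L2: "(\<lambda>x. ln (T h x)) \<in> Lip_Omega A" by (rule Lip_ln[OF T_Lip[OF h(1)] Tpos])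
  have L3: "(\<lambda>x. ln (T h (shift x))) \<in> Lip_Omega A" by (rule Lip_shift[OF L2])
  have \<kappa>: "\<kappa> \<in> Lip_Omega A" unfolding \<kappa>_def by (intro Lip_diff Lip_add \<phi>_Lip L1 L3)
  interpret K: potential \<rho> A \<kappa> by unfold_locales (rule \<kappa>)
  have "K.T (\<lambda>x. 1 :: real) \<omega> = 1" if \<omega>: "\<omega> \<in> \<Omega>" for \<omega> :: "nat \<Rightarrow> 'e"
  proof -
    have "K.T (\<lambda>x. 1 :: real) \<omega> = (LINT t|\<rho>. (1 / T h \<omega>) * (integrand h \<omega> t))"
      unfolding transfer_def[of _ _ \<kappa>]
    proof (rule Bochner_Integration.integral_cong[OF refl])
      fix t
      let ?y = "case_nat t \<omega>"
      show "(exp (\<kappa> ?y) * A t (\<omega> 0)) *\<^sub>R 1 = (1 / T h \<omega>) * ((exp (\<phi> ?y) * A t (\<omega> 0)) *\<^sub>R h ?y)"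
      proof (cases rule: A_cases[of t "\<omega> 0"])
        case 2
        then have y: "?y \<in> \<Omega>" using \<omega> by (simp add: case_nat_Omega)
        show ?thesis using 2 h(2)[OF y] Tpos[OF \<omega>] by (simp add: \<kappa>_def exp_add exp_diff)
      qed simp
    qed
    also have "\<dots> = (1 / T h \<omega>) * T h \<omega>"
      unfolding transfer_def[of \<rho> A \<phi> h \<omega>] by (rule integral_mult_right_zero)
    also have "\<dots> = 1" using Tpos[OF \<omega>] by simp
    finally show ?thesis .
  qed
  then have "spec_rad \<rho> A \<kappa> = 1"
    by (intro K.spec_rad_eqI[of "\<lambda>x. 1" 1]) simp_all
  with tangent[OF \<kappa>] have 1: "ln lam - (LINT x|\<mu>. \<phi> x) \<le> - (LINT x|\<mu>. \<kappa> x)" by simp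
  note i = integrable_continuous[OF \<mu>_prob Lip_continuous]
  have "(LINT x|\<mu>. \<kappa> x) = (LINT x|\<mu>. \<phi> x) + (LINT x|\<mu>. ln (h x)) - (LINT x|\<mu>. ln (T h (shift x)))"
    unfolding \<kappa>_def Bochner_Integration.integral_diff[OF i[OF Lip_add[OF \<phi>_Lip L1]] i[OF L3]]
      Bochner_Integration.integral_add[OF i[OF \<phi>_Lip] i[OF L1]] ..
  moreover have "(LINT x|\<mu>. ln (T h (shift x))) = (LINT x|\<mu>. ln (T h x))"
    by (rule M_sigmaD(2)[OF \<mu> Lip_continuous[OF L2]])
  ultimately show ?thesis using 1 by linarith
qed

text \<open>First-order condition at \<open>h = G\<close>, where \<open>donsker_varadhan\<close> is an equality.\<close>

lemma tangent_stationary: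
  assumes g: "g \<in> Lip_Omega A"
  shows "(LINT x|\<mu>. T g x * inverse (G x)) = lam * (LINT x|\<mu>. g x * inverse (G x))"
proof -
  interpret prob_space \<mu> by (rule prob_OmegaD(1)[OF \<mu>_prob])
  define p where "p x = T g x / (lam * G x)" for x
  define q where "q x = g x / G x" for x
  have pc: "continuous_on \<Omega> p" unfolding p_def using lam_pos G_pos
    by (intro continuous_on_divide continuous_on_mult_left T_continuous Lip_continuous[OF g] G_continuous) force+
  have qc: "continuous_on \<Omega> q" unfolding q_def using G_pos
    by (intro continuous_on_divide Lip_continuous[OF g] G_continuous) force
  obtain P where P: "P > 0" "\<forall>x\<in>\<Omega>. norm (p x) \<le> P" using continuous_bounded[OF pc] by blast
  obtain Q where Q: "Q > 0" "\<forall>x\<in>\<Omega>. norm (q x) \<le> Q" using continuous_bounded[OF qc] by blast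
  define b where "b = P + Q"
  have b: "b > 0" "\<And>x. x \<in> \<Omega> \<Longrightarrow> \<bar>p x\<bar> \<le> b" "\<And>x. x \<in> \<Omega> \<Longrightarrow> \<bar>q x\<bar> \<le> b"
    using P Q unfolding b_def real_norm_def by (linarith, force, force)
  \<comment> \<open>\<open>p\<close> and \<open>q\<close> are the relative first-order changes of
    \<open>T h\<close> and \<open>h\<close> along \<open>h = G + s * g\<close>, so \<open>D\<close>
    is the derivative at \<open>s = 0\<close> of the right side of
    \<open>donsker_varadhan\<close>.\<close>
  define D where "D = (LINT x|\<mu>. p x) - (LINT x|\<mu>. q x)"
  note ip = integrable_continuous[OF \<mu>_prob pc] and iq = integrable_continuous[OF \<mu>_prob qc]
  \<comment> \<open>The logarithm of \<open>1 + s * p\<close> is bounded above by its linear part,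
    that of \<open>1 + s * q\<close> below with a quadratic error valid for arguments up to
    \<open>1 / 2\<close>; the zeroth-order terms cancel.\<close>
  have key: "0 \<le> s * D + 2 * s\<^sup>2 * b\<^sup>2" if s: "\<bar>s\<bar> * b \<le> 1 / 2" for s
  proof -
    have sp: "\<bar>s * p x\<bar> \<le> 1 / 2" and sq: "\<bar>s * q x\<bar> \<le> 1 / 2" if "x \<in> \<Omega>" for x
      using mult_left_mono[OF b(2)[OF that], of "\<bar>s\<bar>"] mult_left_mono[OF b(3)[OF that], of "\<bar>s\<bar>"] s
      by (simp_all add: abs_mult)
    have sq2: "(s * q x)\<^sup>2 \<le> s\<^sup>2 * b\<^sup>2" if "x \<in> \<Omega>" for x
      using power_mono[OF b(3)[OF that] abs_ge_zero, of 2] by (simp add: power_mult_distrib mult_left_mono)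
    have pos: "1 + s * p x > 0" "1 + s * q x > 0" if "x \<in> \<Omega>" for x
      using sp[OF that] sq[OF that] by (auto simp: abs_le_iff)
    define h where "h = (\<lambda>x. G x + s * g x)"
    have hL: "h \<in> Lip_Omega A" unfolding h_def by (intro Lip_add Lip_cmult G_Lip g)
    have hq: "h x = G x * (1 + s * q x)" if "x \<in> \<Omega>" for x
      using G_pos[OF that] by (simp add: h_def q_def field_simps)
    have hp: "T h x = (lam * G x) * (1 + s * p x)" if "x \<in> \<Omega>" for x
    proof -
      have "T h x = T G x + T (\<lambda>x. s * g x) x"
        unfolding h_def by (intro T_add G_continuous continuous_on_mult_left Lip_continuous[OF g] that)
      then show ?thesis using G_pos[OF that] lam_pos by (simp add: T_cmult G_eigen[OF that] p_def field_simps)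
    qed
    have h0: "h x > 0" if "x \<in> \<Omega>" for x
      unfolding hq[OF that] by (intro mult_pos_pos G_pos pos that)
    have lGc: "continuous_on \<Omega> (\<lambda>x. ln (G x))" by (rule Lip_continuous[OF Lip_ln[OF G_Lip G_pos]])
    note il = integrable_continuous[OF \<mu>_prob lGc]
    have "ln lam \<le> (LINT x|\<mu>. ln (T h x)) - (LINT x|\<mu>. ln (h x))" by (rule donsker_varadhan[OF hL h0])
    also have "(LINT x|\<mu>. ln (T h x)) \<le> (LINT x|\<mu>. (ln lam + ln (G x)) + s * p x)"
    proof (rule integral_mono)
      have "T h x > 0" if "x \<in> \<Omega>" for x
        unfolding hp[OF that] by (intro mult_pos_pos G_pos pos lam_pos that)
      then show "integrable \<mu> (\<lambda>x. ln (T h x))"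
        by (intro integrable_continuous[OF \<mu>_prob] Lip_continuous Lip_ln T_Lip hL)
      show "integrable \<mu> (\<lambda>x. (ln lam + ln (G x)) + s * p x)" using il ip by simp
      fix x assume "x \<in> space \<mu>"
      then have x: "x \<in> \<Omega>" by (simp add: prob_OmegaD(3)[OF \<mu>_prob])
      show "ln (T h x) \<le> (ln lam + ln (G x)) + s * p x"
        using ln_le_minus_one[OF pos(1)[OF x]] lam_pos G_pos[OF x] pos(1)[OF x]
        unfolding hp[OF x] by (simp add: ln_mult)
    qed
    also have "(LINT x|\<mu>. (ln lam + ln (G x)) + s * p x) = ln lam + (LINT x|\<mu>. ln (G x)) + s * (LINT x|\<mu>. p x)"
      using il ip by (simp add: prob_space)
    finally have 1: "(LINT x|\<mu>. ln (h x)) \<le> (LINT x|\<mu>. ln (G x)) + s * (LINT x|\<mu>. p x)" by simp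
    have "(LINT x|\<mu>. ln (G x) + s * q x - 2 * s\<^sup>2 * b\<^sup>2) \<le> (LINT x|\<mu>. ln (h x))"
    proof (rule integral_mono)
      show "integrable \<mu> (\<lambda>x. ln (G x) + s * q x - 2 * s\<^sup>2 * b\<^sup>2)" using il iq by simp
      show "integrable \<mu> (\<lambda>x. ln (h x))"
        by (intro integrable_continuous[OF \<mu>_prob] Lip_continuous Lip_ln hL h0)
      fix x assume "x \<in> space \<mu>"
      then have x: "x \<in> \<Omega>" by (simp add: prob_OmegaD(3)[OF \<mu>_prob])
      have "s * q x - 2 * (s * q x)\<^sup>2 \<le> ln (1 + s * q x)"
        using abs_ln_one_plus_x_minus_x_bound[OF sq[OF x]] by linarith
      then show "ln (G x) + s * q x - 2 * s\<^sup>2 * b\<^sup>2 \<le> ln (h x)"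
        using sq2[OF x] G_pos[OF x] pos(2)[OF x] unfolding hq[OF x] by (simp add: ln_mult)
    qed
    moreover have "(LINT x|\<mu>. ln (G x) + s * q x - 2 * s\<^sup>2 * b\<^sup>2) =
        (LINT x|\<mu>. ln (G x)) + s * (LINT x|\<mu>. q x) - 2 * s\<^sup>2 * b\<^sup>2"
      using il iq by (simp add: prob_space)
    ultimately show ?thesis using 1 unfolding D_def by (simp add: right_diff_distrib)
  qed
  have "\<bar>D\<bar> \<le> 0"
  proof (rule field_le_epsilon)
    fix e :: real assume e: "e > 0"
    \<comment> \<open>The first entry keeps \<open>s * b\<close> at most \<open>1 / 2\<close>, the
      second makes the quadratic error at most \<open>e\<close> after division by \<open>s\<close>.
      Using \<open>s\<close> and \<open>- s\<close> bounds \<open>D\<close> from both sides.\<close>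
    define s where "s = min (1 / (2 * b)) (e / (2 * b\<^sup>2))"
    have s: "s > 0" "\<bar>s\<bar> * b \<le> 1 / 2" "2 * s * b\<^sup>2 \<le> e"
    proof -
      show "s > 0" using b(1) e by (simp add: s_def)
      have "s \<le> 1 / (2 * b)" "s \<le> e / (2 * b\<^sup>2)" by (simp_all add: s_def)
      then show "\<bar>s\<bar> * b \<le> 1 / 2" "2 * s * b\<^sup>2 \<le> e" using b(1) \<open>s > 0\<close> by (simp_all add: field_simps)
    qed
    have "0 \<le> s * (D + 2 * s * b\<^sup>2)" using key[OF s(2)] by (simp add: power2_eq_square algebra_simps)
    then have "0 \<le> D + 2 * s * b\<^sup>2" using s(1) by (simp add: zero_le_mult_iff)
    moreover have "0 \<le> s * (- D + 2 * s * b\<^sup>2)"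
      using key[of "- s"] s(2) by (simp add: power2_eq_square algebra_simps)
    then have "0 \<le> - D + 2 * s * b\<^sup>2" using s(1) by (simp add: zero_le_mult_iff)
    ultimately show "\<bar>D\<bar> \<le> 0 + e" using s(3) by linarith
  qed
  then have "(LINT x|\<mu>. p x) = (LINT x|\<mu>. q x)" by (simp add: D_def)
  moreover have "(LINT x|\<mu>. T g x * inverse (G x)) = lam * (LINT x|\<mu>. p x)"
  proof -
    have "(LINT x|\<mu>. T g x * inverse (G x)) = (LINT x|\<mu>. lam * p x)"
      by (rule integral_cong_Omega[OF \<mu>_prob]) (use lam_pos in \<open>simp add: p_def field_simps\<close>)
    then show ?thesis by simp
  qed
  moreover have "(LINT x|\<mu>. g x * inverse (G x)) = (LINT x|\<mu>. q x)"
    by (simp add: q_def divide_inverse)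
  ultimately show ?thesis by simp
qed

text \<open>The weighted functional is a multiple of \<open>Lam\<close>. Testing it with
  \<open>G\<close> fixes the multiple as 1, and testing with \<open>G * f\<close> recovers the
  integral of \<open>f\<close>.\<close>

lemma tangent_eq_gibbs: "\<mu> = gibbs"
proof (rule prob_Omega_eqI[OF \<mu>_prob gibbs_prob])
  interpret prob_space \<mu> by (rule prob_OmegaD(1)[OF \<mu>_prob])
  have w: "continuous_on \<Omega> (\<lambda>x. inverse (G x))" by (rule Lip_continuous[OF Lip_inverse[OF G_Lip G_pos]])
  have eq: "(LINT x|\<mu>. h x * inverse (G x)) = Lam h * (LINT x|\<mu>. inverse (G x))" if "h \<in> Lip_Omega A" for h
    by (rule eigenfunctional_unique[OF \<mu>_prob w _ tangent_stationary that])
      (simp add: G_pos less_imp_le)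
  have GG: "(LINT x|\<mu>. (G x * f x) * inverse (G x)) = (LINT x|\<mu>. f x)" for f
  proof (rule integral_cong_Omega[OF \<mu>_prob])
    fix x assume "x \<in> \<Omega>"
    then show "(G x * f x) * inverse (G x) = f x" using G_pos[of x] by simp
  qed
  have "(LINT x|\<mu>. inverse (G x)) = 1"
    using eq[OF G_Lip] GG[of "\<lambda>x. 1"] by (simp add: Lam_G prob_space)
  then show "(LINT x|\<mu>. f x) = (LINT x|gibbs. f x)" if "f \<in> Lip_Omega A" for f
    using eq[OF Lip_mult[OF G_Lip that]] GG[of f] gibbs_integral[OF Lip_continuous[OF that]] by simp
qed

end

end

section \<open>Scalar form of the entropy and characterisation of equilibrium states\<close>

context shift_space
begin

lemma Lip_sum: "(\<And>i. i \<in> J \<Longrightarrow> f i \<in> Lip_Omega A) \<Longrightarrow> (\<lambda>x. \<Sum>i\<in>J. f i x) \<in> Lip_Omega A"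
  by (induction J rule: infinite_finite_induct) (simp_all add: Lip_const Lip_add)

lemma Lip_inner:
  fixes \<xi> :: "(nat \<Rightarrow> 'e) \<Rightarrow> real ^ 'q::finite"
  assumes "\<xi> \<in> Lip_Omega_vec A" shows "(\<lambda>\<omega>. t \<bullet> \<xi> \<omega>) \<in> Lip_Omega A"
proof -
  have "(\<lambda>\<omega>. \<Sum>i\<in>UNIV. t $ i * (\<xi> \<omega> $ i)) \<in> Lip_Omega A"
    using assms by (intro Lip_sum Lip_cmult) (simp add: Lip_Omega_vec_def)
  then show ?thesis by (simp add: inner_vec_def)
qed

lemma integral_inner_vec:
  fixes \<xi> :: "(nat \<Rightarrow> 'e) \<Rightarrow> real ^ 'q::finite"
  assumes \<mu>: "\<mu> \<in> prob_Omega A" and \<xi>: "\<xi> \<in> Lip_Omega_vec A"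
  shows "(LINT \<omega>|\<mu>. t \<bullet> \<xi> \<omega>) = t \<bullet> (LINT \<omega>|\<mu>. \<xi> \<omega>)"
proof -
  have "continuous_on \<Omega> (\<lambda>\<omega>. \<chi> i. \<xi> \<omega> $ i)"
    using \<xi> by (intro continuous_on_vec_lambda Lip_continuous) (simp add: Lip_Omega_vec_def)
  then have "integrable \<mu> \<xi>" by (intro integrable_continuous[OF \<mu>]) simp
  then show ?thesis by (rule integral_inner_right)
qed

text \<open>Each \<open>t \<bullet> \<xi>\<close> is one scalar Lipschitz potential, and each scalar
  potential arises as a component along a unit vector; the number of auxiliary potentials is
  therefore immaterial.\<close>

lemma entropy_hat_eq:
  assumes \<mu>: "\<mu> \<in> prob_Omega A"
  shows "entropy_hat TYPE('q::finite) \<rho> A \<mu> =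
    (INF \<kappa>\<in>Lip_Omega A. ereal (ln (spec_rad \<rho> A \<kappa>) - (LINT x|\<mu>. \<kappa> x)))"
  unfolding entropy_hat_def H_fun_def
proof (rule antisym)
  show "(INF \<kappa>\<in>Lip_Omega A. ereal (ln (spec_rad \<rho> A \<kappa>) - (LINT x|\<mu>. \<kappa> x))) \<le>
    (INF \<xi>\<in>Lip_Omega_vec A. INF t :: real ^ 'q. ereal (ln (spec_rad \<rho> A (\<lambda>\<omega>. t \<bullet> \<xi> \<omega>)) - t \<bullet> (LINT \<omega>|\<mu>. \<xi> \<omega>)))"
  proof (intro INF_greatest)
    fix \<xi> :: "(nat \<Rightarrow> 'e) \<Rightarrow> real ^ 'q" and t :: "real ^ 'q"
    assume \<xi>: "\<xi> \<in> Lip_Omega_vec A"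
    show "(INF \<kappa>\<in>Lip_Omega A. ereal (ln (spec_rad \<rho> A \<kappa>) - (LINT x|\<mu>. \<kappa> x))) \<le>
      ereal (ln (spec_rad \<rho> A (\<lambda>\<omega>. t \<bullet> \<xi> \<omega>)) - t \<bullet> (LINT \<omega>|\<mu>. \<xi> \<omega>))"
      unfolding integral_inner_vec[OF \<mu> \<xi>, symmetric] by (rule INF_lower[OF Lip_inner[OF \<xi>]])
  qed
next
  show "(INF \<xi>\<in>Lip_Omega_vec A. INF t :: real ^ 'q. ereal (ln (spec_rad \<rho> A (\<lambda>\<omega>. t \<bullet> \<xi> \<omega>)) - t \<bullet> (LINT \<omega>|\<mu>. \<xi> \<omega>)))
    \<le> (INF \<kappa>\<in>Lip_Omega A. ereal (ln (spec_rad \<rho> A \<kappa>) - (LINT x|\<mu>. \<kappa> x)))"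
  proof (rule INF_greatest)
    fix \<kappa> assume \<kappa>: "\<kappa> \<in> Lip_Omega A"
    \<comment> \<open>Any coordinate axis works; \<open>undefined\<close> merely names some
      index.\<close>
    define a :: "real ^ 'q" where "a = axis undefined 1"
    define \<xi> where "\<xi> \<omega> = \<kappa> \<omega> *\<^sub>R a" for \<omega>
    have \<xi>: "\<xi> \<in> Lip_Omega_vec A"
      by (simp add: Lip_Omega_vec_def \<xi>_def Lip_mult[OF \<kappa> Lip_const])
    have "a \<bullet> \<xi> \<omega> = \<kappa> \<omega>" for \<omega> by (simp add: \<xi>_def a_def inner_axis_axis)
    then have "ereal (ln (spec_rad \<rho> A (\<lambda>\<omega>. a \<bullet> \<xi> \<omega>)) - a \<bullet> (LINT \<omega>|\<mu>. \<xi> \<omega>)) =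
        ereal (ln (spec_rad \<rho> A \<kappa>) - (LINT x|\<mu>. \<kappa> x))"
      unfolding integral_inner_vec[OF \<mu> \<xi>, symmetric] by simp
    then show "(INF \<xi>\<in>Lip_Omega_vec A. INF t :: real ^ 'q. ereal (ln (spec_rad \<rho> A (\<lambda>\<omega>. t \<bullet> \<xi> \<omega>)) - t \<bullet> (LINT \<omega>|\<mu>. \<xi> \<omega>)))
      \<le> ereal (ln (spec_rad \<rho> A \<kappa>) - (LINT x|\<mu>. \<kappa> x))"
      by (intro INF_lower2[OF \<xi>] INF_lower2[OF UNIV_I, of _ a]) simp
  qed
qed

lemma entropy_le:
  assumes \<mu>: "\<mu> \<in> M_sigma A" and \<kappa>: "\<kappa> \<in> Lip_Omega A"
  shows "entropy_hat TYPE('q::finite) \<rho> A \<mu> \<le> ereal (ln (spec_rad \<rho> A \<kappa>) - (LINT x|\<mu>. \<kappa> x))"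
  unfolding entropy_hat_eq[OF M_sigmaD(1)[OF \<mu>]] by (rule INF_lower[OF \<kappa>])

lemma gibbs_equilibrium:
  assumes \<kappa>: "\<kappa> \<in> Lip_Omega A"
  shows "gibbs_measure \<rho> A \<kappa> \<in> M_sigma A"
    and "entropy_hat TYPE('q::finite) \<rho> A (gibbs_measure \<rho> A \<kappa>) =
      ereal (ln (spec_rad \<rho> A \<kappa>) - (LINT x|gibbs_measure \<rho> A \<kappa>. \<kappa> x))"
proof -
  interpret K: potential \<rho> A \<kappa> by unfold_locales (rule \<kappa>)
  show M: "K.gibbs \<in> M_sigma A" by (rule K.gibbs_M_sigma)
  show "entropy_hat TYPE('q) \<rho> A K.gibbs = ereal (ln (spec_rad \<rho> A \<kappa>) - (LINT x|K.gibbs. \<kappa> x))"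
  proof (rule antisym[OF entropy_le[OF M \<kappa>]])
    show "ereal (ln (spec_rad \<rho> A \<kappa>) - (LINT x|K.gibbs. \<kappa> x)) \<le> entropy_hat TYPE('q) \<rho> A K.gibbs"
      unfolding entropy_hat_eq[OF K.gibbs_prob]
    proof (rule INF_greatest)
      fix \<xi> assume "\<xi> \<in> Lip_Omega A"
      from K.ln_eigenvalue_subgradient[OF this]
      show "ereal (ln (spec_rad \<rho> A \<kappa>) - (LINT x|K.gibbs. \<kappa> x)) \<le> ereal (ln (spec_rad \<rho> A \<xi>) - (LINT x|K.gibbs. \<xi> x))"
        by (simp add: K.spec_rad_lam)
    qed
  qed
qed

lemma equilibrium_unique:
  assumes \<mu>: "\<mu> \<in> M_sigma A" and \<kappa>: "\<kappa> \<in> Lip_Omega A"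
    and eq: "entropy_hat TYPE('q::finite) \<rho> A \<mu> = ereal (ln (spec_rad \<rho> A \<kappa>) - (LINT x|\<mu>. \<kappa> x))"
  shows "\<mu> = gibbs_measure \<rho> A \<kappa>"
proof -
  interpret K: potential \<rho> A \<kappa> by unfold_locales (rule \<kappa>)
  show ?thesis
  proof (rule K.tangent_eq_gibbs[OF \<mu>])
    fix \<xi> assume "\<xi> \<in> Lip_Omega A"
    from entropy_le[OF \<mu> this, where 'q='q]
    show "ln K.lam - (LINT x|\<mu>. \<kappa> x) \<le> ln (spec_rad \<rho> A \<xi>) - (LINT x|\<mu>. \<xi> x)"
      unfolding eq by (simp add: K.spec_rad_lam)
  qed
qed

end

section \<open>The two maximisations coincide\<close>

theorem theorem2:
  fixes \<rho> :: "'e::metric_space measure"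
    and A :: "'e \<Rightarrow> 'e \<Rightarrow> real"
    and \<psi> :: "(nat \<Rightarrow> 'e) \<Rightarrow> real ^ 'q::finite"
    and \<beta> :: real
  assumes compact_E: "compact (UNIV :: 'e set)"
    and prob_rho: "prob_space \<rho>"
    and borel_rho: "sets \<rho> = sets borel"
    and full_support: "\<And>U. open U \<Longrightarrow> U \<noteq> {} \<Longrightarrow> measure \<rho> U > 0"
    and ball_continuous:
      "\<exists>\<epsilon>0>0. \<forall>\<epsilon>. 0 < \<epsilon> \<and> \<epsilon> < \<epsilon>0 \<longrightarrow> continuous_on UNIV (\<lambda>x. measure \<rho> (ball x \<epsilon>))"
    and A_01: "\<And>a b. A a b \<in> {0, 1}"
    and A_continuous: "continuous_on UNIV (\<lambda>(a, b). A a b)"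
    and A_Lipschitz: "\<exists>L. \<forall>a. L-lipschitz_on UNIV (A a)"
    and A_mixing:
      "\<exists>N\<ge>1. \<forall>n\<ge>N. \<forall>a b. \<exists>z :: nat \<Rightarrow> 'e. z 0 = a \<and> z n = b \<and> (\<Prod>i<n. A (z i) (z (Suc i))) = 1"
    and psi_Lipschitz: "\<psi> \<in> Lip_Omega_vec A"
    and beta_nonneg: "\<beta> \<ge> 0"
  shows "{\<mu> \<in> M_sigma A. quad_energy \<rho> A \<psi> \<beta> \<mu> = quad_pressure \<rho> A \<psi> \<beta>} =
         {gibbs_measure \<rho> A (\<lambda>\<omega>. (\<beta> *\<^sub>R t) \<bullet> \<psi> \<omega>) | t. \<forall>s. varphi \<rho> A \<psi> \<beta> s \<le> varphi \<rho> A \<psi> \<beta> t}"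
proof -
  interpret shift_space \<rho> A
    by (rule shift_space.intro[OF compact_E prob_rho borel_rho full_support A_01 A_continuous A_Lipschitz A_mixing])
  let ?E = "quad_energy \<rho> A \<psi> \<beta>" and ?P = "quad_pressure \<rho> A \<psi> \<beta>" and ?v = "varphi \<rho> A \<psi> \<beta>"
  define \<Phi> where "\<Phi> t = (\<lambda>\<omega>. (\<beta> *\<^sub>R t) \<bullet> \<psi> \<omega>)" for t
  define p where "p t = ln (spec_rad \<rho> A (\<Phi> t))" for t
  define m where "m \<mu> = (LINT \<omega>|\<mu>. \<psi> \<omega>)" for \<mu>
  define g where "g t = gibbs_measure \<rho> A (\<Phi> t)" for t
  have \<Phi>: "\<Phi> t \<in> Lip_Omega A" for t unfolding \<Phi>_def by (rule Lip_inner[OF psi_Lipschitz])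
  have int\<Phi>: "(LINT x|\<mu>. \<Phi> t x) = \<beta> * (t \<bullet> m \<mu>)" if "\<mu> \<in> M_sigma A" for \<mu> t
    unfolding \<Phi>_def m_def integral_inner_vec[OF M_sigmaD(1)[OF that] psi_Lipschitz] by simp
  have v: "?v t = - (\<beta> / 2) * (t \<bullet> t) + p t" for t
    by (simp add: varphi_def p_def \<Phi>_def power2_norm_eq_inner)
  have E: "?E \<mu> = entropy_hat TYPE('q) \<rho> A \<mu> + ereal (\<beta> / 2 * (m \<mu> \<bullet> m \<mu>))" for \<mu>
    by (simp add: quad_energy_def m_def power2_norm_eq_inner)
  have ent_le: "entropy_hat TYPE('q) \<rho> A \<mu> \<le> ereal (p t - \<beta> * (t \<bullet> m \<mu>))" if "\<mu> \<in> M_sigma A" for \<mu> t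
    using entropy_le[OF that \<Phi>, where 'q='q] unfolding int\<Phi>[OF that] p_def .
  have gM: "g t \<in> M_sigma A" for t unfolding g_def by (rule gibbs_equilibrium(1)[OF \<Phi>])
  have ent_g: "entropy_hat TYPE('q) \<rho> A (g t) = ereal (p t - \<beta> * (t \<bullet> m (g t)))" for t
    using gibbs_equilibrium(2)[OF \<Phi>, where 'q='q] int\<Phi>[OF gM] unfolding p_def g_def by simp
  \<comment> \<open>The choice \<open>t = m \<mu>\<close> makes the linear bound on the entropy and
    the quadratic term combine exactly into \<open>varphi\<close>.\<close>
  have upper: "?E \<mu> \<le> ereal (?v (m \<mu>))" if "\<mu> \<in> M_sigma A" for \<mu>
  proof -
    have "?E \<mu> \<le> ereal (p (m \<mu>) - \<beta> * (m \<mu> \<bullet> m \<mu>)) + ereal (\<beta> / 2 * (m \<mu> \<bullet> m \<mu>))"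
      unfolding E by (intro add_right_mono ent_le that)
    then show ?thesis by (simp add: v)
  qed
  \<comment> \<open>The difference of the two sides is \<open>\<beta> / 2\<close> times the squared
    distance of \<open>t\<close> from \<open>m (g t)\<close>, nonnegative since
    \<open>\<beta> \<ge> 0\<close>.\<close>
  have lower: "ereal (?v t) \<le> ?E (g t)" for t
  proof -
    have "0 \<le> \<beta> / 2 * ((t - m (g t)) \<bullet> (t - m (g t)))" using beta_nonneg by simp
    then have "?v t \<le> (p t - \<beta> * (t \<bullet> m (g t))) + \<beta> / 2 * (m (g t) \<bullet> m (g t))"
      unfolding v by (simp add: inner_diff inner_commute algebra_simps)
    then show ?thesis by (simp add: E ent_g)
  qed
  have EP: "?E \<mu> \<le> ?P" if "\<mu> \<in> M_sigma A" for \<mu>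
    unfolding quad_pressure_def by (rule SUP_upper[OF that])
  have "(\<mu> \<in> M_sigma A \<and> ?E \<mu> = ?P) \<longleftrightarrow> (\<exists>t. \<mu> = g t \<and> (\<forall>s. ?v s \<le> ?v t))" for \<mu>
  proof (intro iffI; elim conjE exE)
    assume \<mu>: "\<mu> \<in> M_sigma A" and max: "?E \<mu> = ?P"
    let ?t = "m \<mu>"
    \<comment> \<open>For a maximiser \<open>\<mu>\<close>, every \<open>?v s\<close> lies below
      \<open>?E \<mu>\<close>, which lies below \<open>?v ?t\<close>. So \<open>?t\<close> maximises
      \<open>?v\<close>, and equality holds in \<open>upper\<close>.\<close>
    have le: "ereal (?v s) \<le> ?E \<mu>" for s using order_trans[OF lower EP[OF gM]] by (simp add: max)
    have "ereal (?v s) \<le> ereal (?v ?t)" for s by (rule order_trans[OF le upper[OF \<mu>]])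
    then have vmax: "\<forall>s. ?v s \<le> ?v ?t" by simp
    have "?E \<mu> = ereal (?v ?t)" by (rule antisym[OF upper[OF \<mu>] le])
    \<comment> \<open>A finite energy excludes infinite entropy, so the quadratic term can be
      cancelled in \<open>ereal\<close>.\<close>
    then have "entropy_hat TYPE('q) \<rho> A \<mu> = ereal (p ?t - \<beta> * (?t \<bullet> m \<mu>))"
      unfolding E v by (cases "entropy_hat TYPE('q) \<rho> A \<mu>") auto
    then have "\<mu> = g ?t"
      unfolding g_def p_def int\<Phi>[OF \<mu>, symmetric] by (rule equilibrium_unique[OF \<mu> \<Phi>])
    then show "\<exists>t. \<mu> = g t \<and> (\<forall>s. ?v s \<le> ?v t)" using vmax by blast
  next
    fix t assume \<mu>: "\<mu> = g t" and max: "\<forall>s. ?v s \<le> ?v t"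
    have "?P \<le> ?E \<mu>"
      unfolding quad_pressure_def \<mu>
    proof (rule SUP_least)
      fix \<nu> assume "\<nu> \<in> M_sigma A"
      then have "?E \<nu> \<le> ereal (?v (m \<nu>))" by (rule upper)
      also have "\<dots> \<le> ereal (?v t)" using max by simp
      also have "\<dots> \<le> ?E (g t)" by (rule lower)
      finally show "?E \<nu> \<le> ?E (g t)" .
    qed
    then show "\<mu> \<in> M_sigma A \<and> ?E \<mu> = ?P" using EP[OF gM[of t]] gM[of t] \<mu> by (simp add: antisym)
  qed
  then show ?thesis unfolding g_def \<Phi>_def by blast
qed

end
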